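(* Let $L \subseteq \mathbb{R}^n$ be an $n$-dimensional root lattice. Then every deep hole $c$ of $L$ is a stable cold spot of $L$; that is, there exists a finite $\alpha_0$ such that for every $\alpha \geq \alpha_0$ the point $c$ is a minimizer of the function $z \mapsto \sum_{x \in L} e^{-\alpha\|x-z\|^2}$ over $\mathbb{R}^n$.
   Context: A root lattice is a lattice $L$ that is integral ($x\cdot y \in \mathbb{Z}$ for all $x,y \in L$) and generated as an abelian group by its vectors of squared norm $2$. A deep hole of $L$ is a point $c \in \mathbb{R}^n$ with $\min_{x\in L}\|x-c\| = \max_{z \in \mathbb{R}^n}\min_{x \in L}\|x-z\|$. *)

theory Defs
  imports "HOL-Analysis.Analysis" "HOL-Computational_Algebra.Group_Closure"
begin

text \<open>A lattice is the set of integer combinations of linearly independent vectors;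
  it need not have full rank, so the rank is stated separately.\<close>
definition euclidean_lattice :: "'a::euclidean_space set \<Rightarrow> bool" where
  "euclidean_lattice L \<longleftrightarrow> (\<exists>B. independent B \<and> L = group_closure B)"

definition root_lattice :: "'a::euclidean_space set \<Rightarrow> bool" where
  "root_lattice L \<longleftrightarrow>
     euclidean_lattice L \<and>
     (\<forall>x\<in>L. \<forall>y\<in>L. x \<bullet> y \<in> \<int>) \<and>
     L = group_closure {v \<in> L. (norm v)\<^sup>2 = 2}"

text \<open>For a lattice (nonempty and closed) the infimum \<^term>\<open>infdist z L\<close> is attained,
  so it is the minimum of the distances from \<^term>\<open>z\<close> to the points of \<^term>\<open>L\<close>.\<close>
definition deep_hole :: "'a::euclidean_space set \<Rightarrow> 'a \<Rightarrow> bool" where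
  "deep_hole L c \<longleftrightarrow> (\<forall>z. infdist z L \<le> infdist c L)"

text \<open>For a lattice and \<^term>\<open>\<alpha> > 0\<close> the sum converges. For \<^term>\<open>\<alpha> \<le> 0\<close> and an infinite
  lattice it diverges for every \<^term>\<open>z\<close>, and \<^const>\<open>infsum\<close> returns the default value 0;
  this does not affect the definition of stable cold spots, which concerns all large
  \<^term>\<open>\<alpha>\<close>.\<close>
definition gaussian_sum :: "'a::euclidean_space set \<Rightarrow> real \<Rightarrow> 'a \<Rightarrow> real" where
  "gaussian_sum L \<alpha> z = (\<Sum>\<^sub>\<infinity>x\<in>L. exp (- \<alpha> * (norm (x - z))\<^sup>2))"

definition stable_cold_spot :: "'a::euclidean_space set \<Rightarrow> 'a \<Rightarrow> bool" where
  "stable_cold_spot L c \<longleftrightarrow>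
     (\<exists>\<alpha>\<^sub>0. \<forall>\<alpha>\<ge>\<alpha>\<^sub>0. \<forall>z. gaussian_sum L \<alpha> c \<le> gaussian_sum L \<alpha> z)"

end

theory Submission
  imports Defs
begin

text \<open>Translate the deep hole so that the origin is a nearest lattice point. Sums of roots can be shortened
  until the roots have pairwise nonnegative inner products, so the Voronoi cell of the origin is
  \<open>{z. r \<bullet> z \<le> 1 for all roots r}\<close>, and the deep holes in it are the points of maximal norm.
  The roots \<open>r\<close> with \<open>r \<bullet> c = 1\<close> span the space at a deep hole \<open>c\<close>, and the affine reflections
  belonging to them fix \<open>c\<close> and preserve \<open>L\<close>; hence \<open>c\<close> is a critical point of the Gaussian sum for every
  \<open>\<alpha>\<close>, and convexity of \<open>exp\<close> together with the lattice points nearest to \<open>c\<close> makes it a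
  minimum on a neighbourhood that does not depend on \<open>\<alpha>\<close>. Far from the deep holes the nearest lattice point alone
  contributes more than the whole sum at \<open>c\<close>. So it only remains to see that the Gaussian sum takes the same value at
  all deep holes.

  For this, move two deep holes into the closed Weyl chamber of a simple system. In each irreducible
  component with highest root \<open>\<theta> = \<Sum>\<^sub>j m\<^sub>j \<alpha>\<^sub>j\<close> the component of a deep hole is a
  vertex \<open>\<omega>\<^sub>j / m\<^sub>j\<close> of the alcove of maximal norm. The squared norm of this vertex is the effective
  resistance between \<open>j\<close> and the affine node \<open>-\<theta>\<close> in the extended Dynkin diagram, where the
  edge \<open>jk\<close> has conductance \<open>m\<^sub>j m\<^sub>k\<close>. The marks are harmonic
  (\<open>2 m\<^sub>j\<close> is the sum of the neighbouring marks), so walking from \<open>-\<theta>\<close> determines the diagram: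
  it is a cycle, a chain with two leaves at each end, or a star with bare arms. In each case two nodes of
  maximal resistance are exchanged by a diagram automorphism, which induces an isometry of \<open>L\<close>.\<close>

section \<open>Marked extended Dynkin diagrams\<close>

text \<open>Distinct vertices of one alcove are never related by the affine Weyl group. If two deep
  holes had different Gaussian sums at some \<open>\<alpha>\<close>, the one with the larger sum
  could not be a minimizer there. So no local analysis suffices, and the diagram symmetries are
  essential. The shapes are told apart by the arithmetic of the marks alone, without the
  classification of root systems. Resistances enter because harmonicity turns the squared norm of
  the sum of \<open>f u * m u\<close> times \<open>u\<close> into the sum of
  \<open>m u * m v * (f u - f v)^2\<close> over the edges \<open>uv\<close>. The vectors
  \<open>m u\<close> times \<open>u\<close> thus have a weighted graph Laplacian as Gram matrix. The
  \<open>c j\<close> form the dual basis once \<open>z\<close> is grounded, so their Gram matrix is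
  the inverse of the grounded Laplacian and carries the resistances on its diagonal. Near a hole, a
  displacement \<open>h\<close> costs a relative \<open>\<alpha> * |h|^2\<close> to first order,
  while the nearest lattice points gain of order \<open>(\<alpha> * |h|)^2\<close>. The extra factor
  \<open>\<alpha>\<close> is why the neighbourhood need not shrink.\<close>

text \<open>\<open>K\<close> stands for the simple roots of an irreducible component, \<open>z\<close> for minus the highest root,
  \<open>m\<close> for the marks, and \<open>c j\<close> for the vertex \<open>\<omega>\<^sub>j / m\<^sub>j\<close> of the alcove.\<close>

locale marked_diagram =
  fixes K :: "'a::euclidean_space set" and z :: 'a and m :: "'a \<Rightarrow> nat" and c :: "'a \<Rightarrow> 'a"
  assumes finite_K: "finite K" and z_notin_K: "z \<notin> K"
    and norm_two: "v \<in> insert z K \<Longrightarrow> v \<bullet> v = 2"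
    and inner_cases: "u \<in> insert z K \<Longrightarrow> v \<in> insert z K \<Longrightarrow> u \<noteq> v \<Longrightarrow> u \<bullet> v = 0 \<or> u \<bullet> v = -1"
    and mark_pos: "v \<in> insert z K \<Longrightarrow> 0 < m v" and mark_z: "m z = 1"
    and relation: "(\<Sum>v\<in>insert z K. real (m v) *\<^sub>R v) = 0"
    and c_span: "j \<in> K \<Longrightarrow> c j \<in> span K" and c_z: "c z = 0"
    and c_dual: "j \<in> K \<Longrightarrow> k \<in> K \<Longrightarrow> c j \<bullet> k = (if j = k then 1 / real (m j) else 0)"
begin

section \<open>Adjacency, harmonic marks and connectedness\<close>

definition V where "V = insert z K"

definition N where "N v = {u \<in> V. u \<bullet> v = -1}"

lemma finite_V: "finite V" and K_subset: "K \<subseteq> V" and z_in_V: "z \<in> V"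
  by (auto simp: V_def finite_K)

lemma V_cases: "v \<in> V \<Longrightarrow> v \<noteq> z \<Longrightarrow> v \<in> K"
  by (auto simp: V_def)

lemma N_subset: "N v \<subseteq> V" and finite_N: "finite (N v)"
  using finite_V by (auto simp: N_def)

lemma N_sym: "v \<in> V \<Longrightarrow> u \<in> N v \<Longrightarrow> v \<in> N u"
  by (auto simp: N_def inner_commute)

lemma N_irrefl: "v \<in> V \<Longrightarrow> v \<notin> N v"
  using norm_two[of v] by (auto simp: N_def V_def)

lemma inner_V: "u \<in> V \<Longrightarrow> v \<in> V \<Longrightarrow> u \<bullet> v = (if u = v then 2 else if u \<in> N v then -1 else 0)"
  using norm_two[of v] inner_cases[of u v] by (auto simp: N_def V_def)

lemma marks_V: "v \<in> V \<Longrightarrow> 0 < m v"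
  using mark_pos by (auto simp: V_def)

lemma sum_inner:
  assumes "v \<in> V" "X \<subseteq> V"
  shows "(\<Sum>u\<in>X. real (m u) *\<^sub>R u) \<bullet> v
    = (if v \<in> X then 2 * real (m v) else 0) - real (\<Sum>u\<in>N v \<inter> X. m u)"
proof -
  have fin: "finite X" using assms finite_V finite_subset by blast
  have "(\<Sum>u\<in>X. real (m u) *\<^sub>R u) \<bullet> v
      = (\<Sum>u\<in>X. (if u = v then 2 * real (m v) else 0) - (if u \<in> N v then real (m u) else 0))"
    unfolding inner_sum_left
    by (intro sum.cong refl) (use assms N_irrefl in \<open>auto simp: inner_V subset_iff\<close>)
  also have "\<dots> = (if v \<in> X then 2 * real (m v) else 0) - (\<Sum>u\<in>X. if u \<in> N v then real (m u) else 0)"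
    using fin by (simp add: sum_subtractf)
  also have "(\<Sum>u\<in>X. if u \<in> N v then real (m u) else 0) = (\<Sum>u\<in>N v \<inter> X. real (m u))"
    using fin by (subst sum.inter_restrict[symmetric]) (auto simp: Int_commute)
  finally show ?thesis by simp
qed

lemma harmonic: "v \<in> V \<Longrightarrow> 2 * m v = (\<Sum>u\<in>N v. m u)"
proof -
  assume v: "v \<in> V"
  have "N v \<inter> V = N v" using N_subset by auto
  then have "real (2 * m v) = real (\<Sum>u\<in>N v. m u)"
    using sum_inner[OF v order_refl] v relation unfolding V_def[symmetric] by simp
  then show ?thesis by (simp only: of_nat_eq_iff)
qed

text \<open>\<open>v\<close> is one of the neighbours whose marks add up to \<open>2 * m u\<close>.
  This bound is what limits branching later.\<close>

lemma mark_le: "v \<in> V \<Longrightarrow> u \<in> N v \<Longrightarrow> m v \<le> 2 * m u"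
  using harmonic[of u] member_le_sum[of v "N u" m] N_sym[of v u] N_subset[of v] finite_N[of u]
  by (simp add: subset_iff)

text \<open>For a set \<open>X\<close> closed under adjacency the vector \<open>\<Sum>\<^sub>x\<^sub>\<in>\<^sub>X m\<^sub>x x\<close> is orthogonal to itself.\<close>

lemma connected:
  assumes "X \<subseteq> V" "X \<noteq> {}" "\<And>x. x \<in> X \<Longrightarrow> N x \<subseteq> X"
  shows "X = V"
proof -
  have zero: "(\<Sum>u\<in>Y. real (m u) *\<^sub>R u) = 0"
    if Y: "Y \<subseteq> V" "\<And>x. x \<in> Y \<Longrightarrow> N x \<subseteq> Y" for Y
  proof -
    let ?s = "\<Sum>u\<in>Y. real (m u) *\<^sub>R u"
    have "?s \<bullet> v = 0" if v: "v \<in> Y" for v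
    proof -
      have "v \<in> V" "N v \<inter> Y = N v" using Y v by auto
      then show ?thesis using sum_inner[of v Y] harmonic[of v] Y(1) v
        by simp (metis of_nat_mult of_nat_numeral of_nat_sum)
    qed
    then have "(\<Sum>u\<in>Y. ?s \<bullet> (real (m u) *\<^sub>R u)) = 0"
      by (intro sum.neutral) simp
    moreover have "?s \<bullet> ?s = (\<Sum>u\<in>Y. ?s \<bullet> (real (m u) *\<^sub>R u))" by (rule inner_sum_right)
    ultimately have "?s \<bullet> ?s = 0" by simp
    then show ?thesis by simp
  qed
  have nonz: "Y = {}" if Y: "Y \<subseteq> K" "(\<Sum>u\<in>Y. real (m u) *\<^sub>R u) = 0" for Y
  proof (rule ccontr)
    assume "Y \<noteq> {}"
    then obtain j where j: "j \<in> Y" by blast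
    have fin: "finite Y" using Y finite_K finite_subset by blast
    have "0 = c j \<bullet> (\<Sum>u\<in>Y. real (m u) *\<^sub>R u)" using Y by simp
    also have "\<dots> = (\<Sum>u\<in>Y. if u = j then 1 else 0)"
      unfolding inner_sum_right
      using Y j K_subset marks_V by (intro sum.cong refl) (force simp: c_dual subset_iff)
    also have "\<dots> = (1::real)" using fin j by simp
    finally show False by simp
  qed
  \<comment> \<open>Adjacency is symmetric, so the complement of \<open>X\<close> is closed too. A
    nonempty closed set cannot lie inside \<open>K\<close> by \<open>nonz\<close>, which puts
    \<open>z\<close> into \<open>X\<close> and then empties the complement.\<close>
  have compl: "N x \<subseteq> V - X" if "x \<in> V - X" for x
  proof
    fix u assume u: "u \<in> N x"
    then have "u \<in> V" using N_subset by auto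
    moreover have "u \<notin> X" using assms(3)[of u] N_sym[of x u] u that by auto
    ultimately show "u \<in> V - X" by simp
  qed
  have "z \<in> X"
  proof (rule ccontr)
    assume "z \<notin> X"
    then have "X \<subseteq> K" using assms by (auto simp: V_def)
    then show False using nonz[of X] zero[of X] assms by auto
  qed
  then have "V - X \<subseteq> K" by (auto simp: V_def)
  then have "V - X = {}" using nonz[of "V - X"] zero[of "V - X"] compl by auto
  then show ?thesis using assms by auto
qed

section \<open>Effective resistance across a bridge\<close>

lemma span_orthogonal_zero: "x \<in> span K \<Longrightarrow> (\<And>a. a \<in> K \<Longrightarrow> x \<bullet> a = 0) \<Longrightarrow> x = 0"
  by (metis inner_eq_zero_iff orthogonal_def orthogonal_to_span)

definition g where "g j = c j \<bullet> c j"

lemma g_z: "g z = 0" by (simp add: g_def c_z)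

text \<open>Across a bridge \<open>c j - c k\<close> is proportional to \<open>\<Sum>\<^sub>u\<^sub>\<in>\<^sub>J m\<^sub>u u\<close>, which is
  orthogonal to \<open>c k\<close>: effective resistances in series add up.\<close>

lemma bridge:
  assumes J: "J \<subseteq> K" "j \<in> J" and k: "k \<in> V" "k \<notin> J" "j \<in> N k"
    and sep: "\<And>u w. u \<in> J \<Longrightarrow> w \<in> N u \<Longrightarrow> w \<notin> J \<Longrightarrow> u = j \<and> w = k"
  shows "g j = g k + 1 / (real (m j) * real (m k))"
proof -
  let ?v = "\<Sum>u\<in>J. real (m u) *\<^sub>R u"
  have JV: "J \<subseteq> V" using J K_subset by auto
  have fin: "finite J" using J finite_K finite_subset by blast
  have jV: "j \<in> V" using J JV by auto
  have pos: "0 < m j" "0 < m k" using jV k marks_V by auto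
  have kNj: "k \<in> N j" using N_sym k by auto
  \<comment> \<open>Harmonicity cancels all contributions inside \<open>J\<close>. Only the bridge
    is left: \<open>m k\<close> at its end \<open>j\<close> and \<open>- m j\<close> at its end
    \<open>k\<close>.\<close>
  have va: "?v \<bullet> a = (if a = j then real (m k) else if a = k then - real (m j) else 0)" if a: "a \<in> V" for a
  proof (cases "a \<in> J")
    case True
    have eq: "2 * m a = (\<Sum>u\<in>N a \<inter> J. m u) + (\<Sum>u\<in>N a - J. m u)"
      unfolding harmonic[OF a] by (rule sum.Int_Diff[OF finite_N])
    have "N a - J = (if a = j then {k} else {})"
    proof (cases "a = j")
      case True
      have "w = k" if "w \<in> N j - J" for w using sep[OF J(2), of w] that by blast
      then have "N j - J = {k}" using kNj k(2) by blast
      then show ?thesis using True by simp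
    next
      case False
      have "w \<in> J" if "w \<in> N a" for w using sep[OF True that] False by blast
      then show ?thesis using False by auto
    qed
    then have "(\<Sum>u\<in>N a - J. m u) = (\<Sum>u\<in>(if a = j then {k} else {}). m u)" by (rule arg_cong)
    then have "(\<Sum>u\<in>N a - J. m u) = (if a = j then m k else 0)" by (cases "a = j") simp_all
    then have "real (2 * m a) = real ((\<Sum>u\<in>N a \<inter> J. m u) + (if a = j then m k else 0))"
      using eq by simp
    moreover have "a \<noteq> k" using True k by auto
    ultimately show ?thesis unfolding sum_inner[OF a JV] using True by simp
  next
    case False
    have "N a \<inter> J = (if a = k then {j} else {})"
    proof -
      have *: "u = j \<and> a = k" if "u \<in> N a" "u \<in> J" for u
        using sep[OF that(2) N_sym[OF a that(1)] False] .
      show ?thesis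
      proof (cases "a = k")
        case True
        have "u = j" if "u \<in> N a \<inter> J" for u using * that by blast
        then have "N a \<inter> J = {j}" using k(3) J(2) True by blast
        then show ?thesis using True by simp
      next
        case False then show ?thesis using * by auto
      qed
    qed
    moreover have "a \<noteq> j" using False J by auto
    ultimately show ?thesis unfolding sum_inner[OF a JV] using False by simp
  qed
  have ck: "c k \<bullet> a = (if a = k then 1 / real (m k) else 0)" if "a \<in> K" for a
    using c_dual[of k a] V_cases[of k] c_z that z_notin_K k by (cases "k = z") auto
  have spn: "c k \<in> span K"
    using c_span[of k] V_cases[of k] c_z k by (cases "k = z") (auto simp: span_0)
  have "(real (m j) * real (m k)) *\<^sub>R (c j - c k) - ?v = 0"
  proof (rule span_orthogonal_zero)
    show "(real (m j) * real (m k)) *\<^sub>R (c j - c k) - ?v \<in> span K"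
      using J c_span spn by (intro span_diff span_scale span_sum) (auto intro: span_base)
    fix a assume a: "a \<in> K"
    have "j \<in> K" using J by auto
    then show "((real (m j) * real (m k)) *\<^sub>R (c j - c k) - ?v) \<bullet> a = 0"
      using va[of a] ck[OF a] c_dual[of j a] a K_subset pos k J
      by (auto simp: inner_diff_left)
  qed
  then have d: "(real (m j) * real (m k)) *\<^sub>R (c j - c k) = ?v" by simp
  have cj1: "c j \<bullet> ?v = 1"
  proof -
    have "c j \<bullet> ?v = (\<Sum>u\<in>J. if u = j then 1 else 0)"
      unfolding inner_sum_right
      using J pos by (intro sum.cong refl) (auto simp: c_dual subset_iff)
    then show ?thesis using fin J by simp
  qed
  have ck0: "c k \<bullet> ?v = 0"
    unfolding inner_sum_right
    using J k by (intro sum.neutral ballI) (auto simp: ck subset_iff)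
  have "(real (m j) * real (m k)) * (g j - g k) = (c j + c k) \<bullet> ((real (m j) * real (m k)) *\<^sub>R (c j - c k))"
    by (simp add: g_def inner_add_left inner_diff_right inner_commute algebra_simps)
  also have "\<dots> = 1" unfolding d by (simp add: inner_add_left cj1 ck0)
  finally show ?thesis using pos by (simp add: field_simps)
qed

section \<open>Symmetries of the diagram\<close>

text \<open>Only \<open>K\<close> is permuted, since the permutation is later extended linearly from
  the simple roots to an isometry of the lattice that fixes the origin.\<close>

definition exchangeable :: "'a \<Rightarrow> 'a \<Rightarrow> bool" where
  "exchangeable i j \<longleftrightarrow> (\<exists>\<sigma>. bij_betw \<sigma> K K \<and> (\<forall>u\<in>K. \<forall>v\<in>K. \<sigma> u \<bullet> \<sigma> v = u \<bullet> v) \<and> \<sigma> i = j)"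

lemma exchangeable_refl: "exchangeable i i"
  unfolding exchangeable_def by (rule exI[of _ id]) auto

text \<open>Adjacency determines every inner product by \<open>inner_V\<close>, and for an
  involution preserving adjacency in one direction already gives the converse.\<close>

lemma exchangeableI:
  assumes img: "\<And>u. u \<in> K \<Longrightarrow> \<sigma> u \<in> K" and inv: "\<And>u. u \<in> K \<Longrightarrow> \<sigma> (\<sigma> u) = u"
    and adj: "\<And>u v. u \<in> K \<Longrightarrow> v \<in> K \<Longrightarrow> v \<in> N u \<Longrightarrow> \<sigma> v \<in> N (\<sigma> u)"
    and "\<sigma> i = j"
  shows "exchangeable i j"
proof -
  have "bij_betw \<sigma> K K"
    by (rule bij_betw_byWitness[of _ \<sigma>]) (use img inv in auto)
  moreover have "\<sigma> u \<bullet> \<sigma> v = u \<bullet> v" if "u \<in> K" "v \<in> K" for u v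
  proof -
    have "\<sigma> u = \<sigma> v \<longleftrightarrow> u = v" using inv that by metis
    moreover have "\<sigma> u \<in> N (\<sigma> v) \<longleftrightarrow> u \<in> N v"
      using adj[of v u] adj[of "\<sigma> v" "\<sigma> u"] inv img that by metis
    ultimately show ?thesis
      using inner_V[of u v] inner_V[of "\<sigma> u" "\<sigma> v"] img that K_subset by (simp add: subset_iff)
  qed
  ultimately show ?thesis using assms(4) unfolding exchangeable_def by blast
qed

section \<open>Arms: unbranched ends with decreasing marks\<close>

text \<open>The arm \<open>x 1, \<dots>, x t\<close> is attached to the node \<open>p = x 0\<close>, which does not count as part of it.\<close>

definition arm :: "'a \<Rightarrow> (nat \<Rightarrow> 'a) \<Rightarrow> nat \<Rightarrow> nat \<Rightarrow> bool" where
  "arm p x t d \<longleftrightarrow> p \<in> V \<and> x 0 = p \<and> 0 < d \<and> 0 < t \<and> m p = (t + 1) * d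
    \<and> (\<forall>s\<le>t. x s \<in> V \<and> m (x s) + s * d = m p)
    \<and> (\<forall>s. 0 < s \<longrightarrow> s < t \<longrightarrow> N (x s) = {x (s - 1), x (s + 1)}) \<and> N (x t) = {x (t - 1)}"

text \<open>The neighbours of \<open>y\<close> other than \<open>p\<close> have total mark
  \<open>2 * m y - m p\<close>, less than \<open>m y\<close>, but each has mark at least
  \<open>m y / 2\<close> by \<open>mark_le\<close>. So there is at most one, and then its mark is
  again lower by \<open>d\<close>. The descent continues at the constant rate \<open>d\<close> until
  a leaf of mark \<open>d\<close>.\<close>

lemma arm_exists:
  assumes "p \<in> V" "y \<in> N p" "m y < m p"
  shows "\<exists>x t d. arm p x t d \<and> x 1 = y"
  using assms
proof (induction "m y" arbitrary: p y rule: less_induct)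
  case less
  have yV: "y \<in> V" using less.prems N_subset by auto
  define d where "d = m p - m y"
  define Y where "Y = N y - {p}"
  have py: "p \<in> N y" using N_sym less.prems by auto
  have finY: "finite Y" using finite_N by (auto simp: Y_def)
  have sum: "2 * m y = m p + (\<Sum>u\<in>Y. m u)"
    using harmonic[OF yV] sum.remove[OF finite_N py, of m] by (simp add: Y_def)
  have d: "0 < d" "m p = m y + d" using less.prems by (auto simp: d_def)
  have "card Y * m y \<le> (\<Sum>u\<in>Y. 2 * m u)"
    using sum_mono[of Y "\<lambda>_. m y" "\<lambda>u. 2 * m u"] mark_le[OF yV] by (auto simp: Y_def)
  also have "\<dots> = 2 * (\<Sum>u\<in>Y. m u)" by (simp add: sum_distrib_left)
  also have "\<dots> < 2 * m y" using sum d by simp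
  finally have "card Y < 2" by simp
  then consider "card Y = 0" | "card Y = 1" by linarith
  then show ?case
  proof cases
    case 1
    then have Y: "Y = {}" using finY by simp
    then have "N y = {p}" using py by (auto simp: Y_def)
    moreover have "m y = d" using sum d Y by simp
    ultimately have "arm p (\<lambda>s. if s = 0 then p else y) 1 d"
      using less.prems yV d by (auto simp: arm_def le_Suc_eq)
    then show ?thesis by (intro exI[of _ "\<lambda>s. if s = 0 then p else y"] exI[of _ 1] exI[of _ d]) simp
  next
    case 2
    then obtain w where w: "Y = {w}" by (auto simp: card_1_singleton_iff)
    then have Ny: "N y = {p, w}" using py by (auto simp: Y_def)
    have mw: "m y = m w + d" using sum d w by simp
    have "m w < m y" "w \<in> N y" using mw d Ny by auto
    from less.hyps[OF this(1) yV this(2) this(1)]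
    obtain x t e where x: "arm y x t e" "x 1 = w" by auto
    have e: "e = d" using x mw by (auto simp: arm_def dest!: spec[of _ 1])
    have "arm p (\<lambda>s. if s = 0 then p else x (s - 1)) (t + 1) d"
      unfolding arm_def
    proof (intro conjI allI impI)
      fix s assume s: "0 < s" "s < t + 1"
      show "N (if s = 0 then p else x (s - 1))
        = {if s - 1 = 0 then p else x (s - 1 - 1), if s + 1 = 0 then p else x (s + 1 - 1)}"
      proof (cases "s = 1")
        case True then show ?thesis using x Ny by (auto simp: arm_def)
      next
        case False
        then show ?thesis using x s by (auto simp: arm_def dest!: spec[of _ "s - 1"])
      qed
    next
      show "N (if t + 1 = 0 then p else x (t + 1 - 1)) = {if t + 1 - 1 = 0 then p else x (t + 1 - 1 - 1)}"
        using x by (auto simp: arm_def)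
    next
      fix s assume s: "s \<le> t + 1"
      show "(if s = 0 then p else x (s - 1)) \<in> V" using x s less.prems by (auto simp: arm_def)
      show "m (if s = 0 then p else x (s - 1)) + s * d = m p"
        using x s d e by (cases s) (auto simp: arm_def)
    qed (use x d e less.prems in \<open>auto simp: arm_def\<close>)
    moreover have "x 0 = y" using x by (simp add: arm_def)
    then have "(\<lambda>s. if s = 0 then p else x (s - 1)) 1 = y" by simp
    ultimately show ?thesis by blast
  qed
qed

context
  fixes p x t d assumes arm: "arm p x t d"
begin

lemma arm_marks: "s \<le> t \<Longrightarrow> m (x s) = m p - s * d" and arm_V: "s \<le> t \<Longrightarrow> x s \<in> V"
  and arm_0: "x 0 = p" and arm_t: "0 < t" "1 \<le> t" and arm_d: "0 < d" and arm_mp: "m p = (t + 1) * d"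
  using arm unfolding arm_def by (auto dest!: spec[of _ s])

text \<open>Marks strictly decrease along an arm, so they identify its nodes.\<close>

lemma arm_inj: "s \<le> t \<Longrightarrow> r \<le> t \<Longrightarrow> x s = x r \<longleftrightarrow> s = r"
proof
  assume *: "s \<le> t" "r \<le> t" "x s = x r"
  have "m (x s) + s * d = m p" "m (x r) + r * d = m p" using arm *(1,2) unfolding arm_def by auto
  then have "s * d = r * d" unfolding *(3) by linarith
  then show "s = r" using arm_d by simp
qed simp

lemma arm_N: "0 < s \<Longrightarrow> s \<le> t \<Longrightarrow> N (x s) = insert (x (s - 1)) (if s < t then {x (s + 1)} else {})"
  using arm unfolding arm_def by (cases "s = t") auto

lemma arm_index: "s \<le> t \<Longrightarrow> (m p - m (x s)) div d = s"
proof -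
  assume "s \<le> t"
  then have "m (x s) + s * d = m p" using arm unfolding arm_def by auto
  then have "m p - m (x s) = s * d" by linarith
  then show ?thesis using arm_d by simp
qed

text \<open>The tail of an arm hangs on a single edge, which is the separation that
  \<open>bridge\<close> asks for.\<close>

lemma arm_exit:
  assumes "u \<in> x ` {s..t}" "w \<in> N u" "w \<notin> x ` {s..t}" "0 < s"
  shows "u = x s \<and> w = x (s - 1)"
proof -
  obtain r where r: "u = x r" "s \<le> r" "r \<le> t" using assms by auto
  have "w = x (r - 1) \<or> (r < t \<and> w = x (r + 1))"
    using arm_N[of r] r assms by (auto split: if_splits)
  then show ?thesis
  proof
    assume w: "w = x (r - 1)"
    then have "\<not> s \<le> r - 1" using assms r by auto
    then have "r = s" using r assms by linarith
    then show ?thesis using w r by simp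
  next
    assume w: "r < t \<and> w = x (r + 1)"
    then have "w \<in> x ` {s..t}" using r by (intro image_eqI[of _ _ "r + 1"]) auto
    then show ?thesis using assms by simp
  qed
qed

lemma arm_enter:
  assumes "0 < s" "s \<le> t" shows "p \<in> N (x s) \<longleftrightarrow> s = 1"
proof
  assume "p \<in> N (x s)"
  then have "x 0 = x (s - 1) \<or> s < t \<and> x 0 = x (s + 1)"
    using arm_N[OF assms] arm_0 by (auto split: if_splits)
  then show "s = 1" using arm_inj[of 0 "s - 1"] arm_inj[of 0 "s + 1"] assms by auto
next
  assume "s = 1" then show "p \<in> N (x s)" using arm_N[OF assms] arm_0 by auto
qed

lemma arm_p_notin: "p \<notin> x ` {1..t}"
proof
  assume "p \<in> x ` {1..t}"
  then obtain r where "p = x r" "1 \<le> r" "r \<le> t" by auto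
  then show False using arm_inj[of 0 r] arm_0 by auto
qed

lemma arm_bridge:
  assumes "z \<notin> x ` {1..t}" "0 < s" "s \<le> t"
  shows "g (x s) = g (x (s - 1)) + 1 / (real (m (x s)) * real (m (x (s - 1))))"
proof (rule bridge[of "x ` {s..t}"])
  show "x ` {s..t} \<subseteq> K"
  proof
    fix u assume "u \<in> x ` {s..t}"
    then obtain r where r: "u = x r" "s \<le> r" "r \<le> t" by auto
    then have "u \<in> x ` {1..t}" using assms by auto
    then have "u \<noteq> z" using assms(1) by auto
    then show "u \<in> K" using r arm_V[of r] V_cases by auto
  qed
  show "x (s - 1) \<notin> x ` {s..t}"
  proof
    assume "x (s - 1) \<in> x ` {s..t}"
    then obtain r where "x (s - 1) = x r" "s \<le> r" "r \<le> t" by auto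
    then show False using arm_inj[of "s - 1" r] assms by (cases s) auto
  qed
  show "x s \<in> N (x (s - 1))"
    using arm_N[of s] assms N_sym[of "x s" "x (s - 1)"] arm_V[of s] by auto
qed (use assms arm_V[of "s - 1"] arm_exit[of _ s] in auto)

lemma arm_g_less:
  assumes "z \<notin> x ` {1..t}" "0 < s" "s \<le> t"
  shows "g (x (s - 1)) < g (x s)"
  using arm_bridge[OF assms] marks_V[OF arm_V[of s]] marks_V[OF arm_V[of "s - 1"]] assms by simp

text \<open>The resistances in series telescope because the marks drop by \<open>d\<close>:
  \<open>1 / (a * (a + d))\<close> is \<open>(1 / a - 1 / (a + d)) / d\<close>. With
  \<open>m p = (t + 1) * d\<close> the result depends, for fixed \<open>p\<close>, on the length
  \<open>t\<close> only, so equally resistant tips lie on arms of equal length.\<close>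

lemma arm_g:
  assumes "z \<notin> x ` {1..t}"
  shows "g (x t) = g p + real t * real (t + 1) / (real (m p))\<^sup>2"
proof -
  have "g (x s) = g p + 1 / real d * (1 / (real (t + 1 - s) * d) - 1 / real (m p))" if "s \<le> t" for s
    using that
  proof (induction s)
    case 0 then show ?case using arm_0 arm_d by (simp add: arm_mp field_simps)
  next
    case (Suc s)
    define q where "q = real (t - s)"
    have q: "q > 0" using Suc.prems by (simp add: q_def)
    have d: "real d > 0" using arm_d by simp
    have m1: "real (m (x (Suc s))) = q * d" "real (m (x s)) = (q + 1) * d"
    proof -
      have *: "m (x r) = (t + 1 - r) * d" if "r \<le> t" for r
        using arm_marks[OF that] by (simp add: arm_mp diff_mult_distrib)
      have "real (t + 1 - s) = q + 1" "real (t + 1 - Suc s) = q"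
        using Suc.prems by (auto simp: q_def of_nat_diff)
      then show "real (m (x (Suc s))) = q * d" "real (m (x s)) = (q + 1) * d"
        using *[of "Suc s"] *[of s] Suc.prems by (metis Suc_leD of_nat_mult)+
    qed
    have e: "real (t + 1 - Suc s) = q" "real (t + 1 - s) = q + 1"
      using Suc.prems by (auto simp: q_def of_nat_diff)
    have "1 / (q * d * ((q + 1) * d)) = 1 / d * (1 / (q * d)) - 1 / d * (1 / ((q + 1) * d))"
    proof -
      have "1 / d * (1 / (q * d)) - 1 / d * (1 / (p * d)) = (p - q) / (q * d * (p * d))"
        if "p > 0" for p :: real using that q d by (simp add: field_simps)
      from this[of "q + 1"] show ?thesis using q by simp
    qed
    moreover have "g (x (Suc s)) = g p + 1 / d * (1 / ((q + 1) * d) - 1 / real (m p)) + 1 / (q * d * ((q + 1) * d))"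
      using arm_bridge[OF assms, of "Suc s"] Suc m1 e by simp
    ultimately show ?case unfolding e by (simp add: algebra_simps)
  qed
  from this[of t] have "g (x t) = g p + 1 / real d * (1 / real d - 1 / real (m p))" by simp
  also have "\<dots> = g p + real t * real (t + 1) / (real (m p))\<^sup>2"
  proof -
    have "1 / D * (1 / D - 1 / (P * D)) = (P - 1) * P / (P * D)\<^sup>2" if "D > 0" "P > 0" for D P :: real
      using that by (simp add: field_simps power2_eq_square)
    from this[of "real d" "real (t + 1)"] show ?thesis
      using arm_d unfolding arm_mp of_nat_mult by simp
  qed
  finally show ?thesis .
qed

end

text \<open>The arm \<open>x\<close> can be entered only from \<open>p\<close> through
  \<open>x 1\<close>, and \<open>y\<close> never returns to \<open>p\<close>.\<close>

lemma arms_disjoint: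
  assumes a: "arm p x t d" "arm p y r e" and ne: "x 1 \<noteq> y 1"
  shows "x ` {1..t} \<inter> y ` {1..r} = {}"
proof -
  have "y s \<notin> x ` {1..t}" if "1 \<le> s" "s \<le> r" for s
    using that
  proof (induction s)
    case (Suc s)
    show ?case
    proof
      assume *: "y (Suc s) \<in> x ` {1..t}"
      show False
      proof (cases "s = 0")
        case True
        obtain k where k: "y 1 = x k" "1 \<le> k" "k \<le> t" using * True by auto
        have "p \<in> N (y 1)" using arm_enter[OF a(2), of 1] arm_t[OF a(2)] by simp
        then have "k = 1" using arm_enter[OF a(1), of k] k by auto
        then show False using k ne by simp
      next
        case False
        have "y s \<in> N (y (Suc s))" using arm_N[OF a(2), of "Suc s"] Suc.prems by auto
        moreover have "y s \<noteq> p" using arm_inj[OF a(2), of 0 s] arm_0[OF a(2)] False Suc.prems by auto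
        moreover have "y s \<notin> x ` {1..t}" using Suc False by auto
        ultimately show False using arm_exit[OF a(1), OF *] arm_0[OF a(1)] by auto
      qed
    qed
  qed simp
  then have "y ` {1..r} \<subseteq> - x ` {1..t}" by (intro image_subsetI) simp
  then show ?thesis by blast
qed

text \<open>Length and drop agree, so nodes of equal mark on the two arms are equally far from
  \<open>p\<close>. Exchanging them and fixing everything else, in particular \<open>p\<close>,
  preserves adjacency. As \<open>z\<close> lies on neither arm, \<open>K\<close> is mapped to
  itself.\<close>

lemma arm_swap:
  assumes a: "arm p x t d" "arm p y t d" and ne: "x 1 \<noteq> y 1"
    and z: "z \<notin> x ` {1..t}" "z \<notin> y ` {1..t}"
  shows "exchangeable (x t) (y t)"
proof -
  define \<sigma> where "\<sigma> u = (if u \<in> x ` {1..t} then y ((m p - m u) div d)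
    else if u \<in> y ` {1..t} then x ((m p - m u) div d) else u)" for u
  note disj = arms_disjoint[OF a ne]
  note t = arm_t[OF a(1)]
  have sx: "\<sigma> (x s) = y s" if "1 \<le> s" "s \<le> t" for s
    using that arm_index[OF a(1)] by (auto simp: \<sigma>_def)
  have sy: "\<sigma> (y s) = x s" if "1 \<le> s" "s \<le> t" for s
  proof -
    have "y s \<in> y ` {1..t}" using that by auto
    then have "y s \<notin> x ` {1..t}" using disj by blast
    then show ?thesis using that arm_index[OF a(2)] by (auto simp: \<sigma>_def)
  qed
  have so: "\<sigma> u = u" if "u \<notin> x ` {1..t}" "u \<notin> y ` {1..t}" for u
    using that by (auto simp: \<sigma>_def)
  have sp: "\<sigma> p = p" using so arm_p_notin a by metis
  have cases: "(\<exists>s. 1 \<le> s \<and> s \<le> t \<and> u = x s) \<or> (\<exists>s. 1 \<le> s \<and> s \<le> t \<and> u = y s)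
      \<or> (u \<notin> x ` {1..t} \<and> u \<notin> y ` {1..t})" for u by auto
  show ?thesis
  proof (rule exchangeableI[of \<sigma>])
    fix u assume u: "u \<in> K"
    from cases[of u] show "\<sigma> u \<in> K"
    proof (elim disjE exE conjE)
      fix s assume s: "1 \<le> s" "s \<le> t" "u = x s"
      then have "y s \<noteq> z" using z by auto
      then show ?thesis using s sx arm_V[OF a(2)] V_cases by auto
    next
      fix s assume s: "1 \<le> s" "s \<le> t" "u = y s"
      then have "x s \<noteq> z" using z by auto
      then show ?thesis using s sy arm_V[OF a(1)] V_cases by auto
    qed (use so u in auto)
    from cases[of u] show "\<sigma> (\<sigma> u) = u" by (auto simp: sx sy so)
  next
    have adjx: "\<sigma> w \<in> N (y s)" if s: "1 \<le> s" "s \<le> t" and w: "w \<in> N (x s)" for w s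
    proof -
      have "w = x (s - 1) \<or> s < t \<and> w = x (s + 1)"
        using arm_N[OF a(1), of s] s w by (auto split: if_splits)
      then have "\<sigma> w = y (s - 1) \<or> s < t \<and> \<sigma> w = y (s + 1)"
      proof (cases "s = 1")
        case True
        then show ?thesis using sx[of 2] sp arm_0[OF a(1)] arm_0[OF a(2)] \<open>w = _ \<or> _\<close>
          by (auto simp: numeral_2_eq_2)
      next
        case False
        then have "1 \<le> s - 1" "s - 1 \<le> t" using s by auto
        then show ?thesis using sx[of "s - 1"] sx[of "s + 1"] s \<open>w = _ \<or> _\<close> by auto
      qed
      then show ?thesis using arm_N[OF a(2), of s] s by auto
    qed
    have adjy: "\<sigma> w \<in> N (x s)" if s: "1 \<le> s" "s \<le> t" and w: "w \<in> N (y s)" for w s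
    proof -
      have "w = y (s - 1) \<or> s < t \<and> w = y (s + 1)"
        using arm_N[OF a(2), of s] s w by (auto split: if_splits)
      then have "\<sigma> w = x (s - 1) \<or> s < t \<and> \<sigma> w = x (s + 1)"
      proof (cases "s = 1")
        case True
        then show ?thesis using sy[of 2] sp arm_0[OF a(1)] arm_0[OF a(2)] \<open>w = _ \<or> _\<close>
          by (auto simp: numeral_2_eq_2)
      next
        case False
        then have "1 \<le> s - 1" "s - 1 \<le> t" using s by auto
        then show ?thesis using sy[of "s - 1"] sy[of "s + 1"] s \<open>w = _ \<or> _\<close> by auto
      qed
      then show ?thesis using arm_N[OF a(1), of s] s by auto
    qed
    fix u v assume uv: "u \<in> K" "v \<in> K" "v \<in> N u"
    have uv': "u \<in> N v" using N_sym uv K_subset by auto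
    have V: "u \<in> V" "v \<in> V" using uv K_subset by auto
    from cases[of u] show "\<sigma> v \<in> N (\<sigma> u)"
    proof (elim disjE exE conjE)
      assume u: "u \<notin> x ` {1..t}" "u \<notin> y ` {1..t}"
      from cases[of v] show ?thesis
      proof (elim disjE exE conjE)
        fix s assume s: "1 \<le> s" "s \<le> t" "v = x s"
        then have "\<sigma> u \<in> N (\<sigma> v)" using adjx[OF s(1,2), of u] uv' sx by simp
        then show ?thesis using N_sym arm_V[OF a(2)] s sx by simp
      next
        fix s assume s: "1 \<le> s" "s \<le> t" "v = y s"
        then have "\<sigma> u \<in> N (\<sigma> v)" using adjy[OF s(1,2), of u] uv' sy by simp
        then show ?thesis using N_sym arm_V[OF a(1)] s sy by simp
      qed (use so u uv in auto)
    next
      fix s assume "1 \<le> s" "s \<le> t" "u = x s"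
      then show ?thesis using adjx[of s v] sx[of s] uv(3) by simp
    next
      fix s assume "1 \<le> s" "s \<le> t" "u = y s"
      then show ?thesis using adjy[of s v] sy[of s] uv(3) by simp
    qed
  qed (use sx t in auto)
qed

end

section \<open>Stars\<close>

lemma sum_eq_1_singleton:
  fixes f :: "'b \<Rightarrow> nat"
  assumes "finite Y" "\<And>y. y \<in> Y \<Longrightarrow> 0 < f y" "sum f Y = 1"
  obtains y where "Y = {y}" "f y = 1"
proof -
  have "Y \<noteq> {}" using assms(3) by auto
  then obtain y where y: "y \<in> Y" by blast
  have *: "f y + sum f (Y - {y}) = 1" using sum.remove[OF assms(1) y, of f] assms(3) by simp
  then have f: "f y = 1" "sum f (Y - {y}) = 0" using assms(2)[OF y] by auto
  then have "Y - {y} = {}" using assms(1,2) by (metis Diff_subset all_not_in_conv finite_Diff less_irrefl subsetD sum_eq_0_iff)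
  then show ?thesis using that y f by blast
qed

lemma sum_eq_2_cases:
  fixes f :: "'b \<Rightarrow> nat"
  assumes "finite Y" "\<And>y. y \<in> Y \<Longrightarrow> 0 < f y" "sum f Y = 2"
  obtains (one) y where "Y = {y}" "f y = 2" | (two) y y' where "y \<noteq> y'" "Y = {y, y'}" "f y = 1" "f y' = 1"
proof -
  have "Y \<noteq> {}" using assms(3) by auto
  then obtain y where y: "y \<in> Y" by blast
  have *: "f y + sum f (Y - {y}) = 2" using sum.remove[OF assms(1) y, of f] assms(3) by simp
  then consider "f y = 2" "sum f (Y - {y}) = 0" | "f y = 1" "sum f (Y - {y}) = 1"
    using assms(2)[OF y] by linarith
  then show ?thesis
  proof cases
    case 1
    then have "Y - {y} = {}" using assms(1,2) by (metis Diff_subset all_not_in_conv finite_Diff less_irrefl subsetD sum_eq_0_iff)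
    then show ?thesis using one y 1 by blast
  next
    case 2
    obtain y' where y': "Y - {y} = {y'}" "f y' = 1"
      using sum_eq_1_singleton[of "Y - {y}" f] assms 2 by auto
    then have "Y = {y, y'}" "y \<noteq> y'" using y by auto
    then show ?thesis using two 2 y' by blast
  qed
qed

context marked_diagram
begin

lemma harmonic_remove:
  assumes "v \<in> V" "u \<in> N v"
  shows "2 * m v = m u + (\<Sum>w\<in>N v - {u}. m w)"
  unfolding harmonic[OF assms(1)] by (rule sum.remove[OF finite_N assms(2)])

text \<open>\<open>p\<close> alone exhausts the neighbour sum \<open>2 * m y\<close>, and marks are
  positive.\<close>

lemma leaf:
  assumes "y \<in> V" "p \<in> N y" "2 * m y = m p"
  shows "N y = {p}"
proof -
  have "(\<Sum>w\<in>N y - {p}. m w) = 0" using harmonic_remove[OF assms(1,2)] assms(3) by simp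
  then have "\<forall>w\<in>N y - {p}. m w = 0" using finite_N by (subst (asm) sum_eq_0_iff) auto
  moreover have "0 < m w" if "w \<in> N y" for w using that N_subset marks_V by blast
  ultimately show ?thesis using assms(2) by force
qed

lemma N_pos: "y \<in> N v \<Longrightarrow> 0 < m y" "y \<in> N v \<Longrightarrow> y \<in> V"
  using N_subset marks_V by blast+

lemma g_mono_chain:
  assumes "\<And>j. j < k \<Longrightarrow> g (v j) \<le> g (v (Suc j))" "i \<le> k"
  shows "g (v i) \<le> g (v k)"
  using assms(2,1) by (induction k rule: dec_induct) (auto intro: order_trans)

section \<open>The walk from the affine node to the first branching node\<close>

definition rising :: "nat \<Rightarrow> (nat \<Rightarrow> 'a) \<Rightarrow> bool" where
  "rising k v \<longleftrightarrow> 0 < k \<and> v 0 = z \<and> N z = {v 1} \<and> (\<forall>j\<le>k. v j \<in> V \<and> m (v j) = j + 1)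
    \<and> (\<forall>j. 0 < j \<longrightarrow> j < k \<longrightarrow> N (v j) = {v (j - 1), v (j + 1)})"

context
  fixes k v assumes rising: "rising k v"
begin

lemma rising_V: "j \<le> k \<Longrightarrow> v j \<in> V" and rising_m: "j \<le> k \<Longrightarrow> m (v j) = j + 1"
  and rising_0: "v 0 = z" and rising_k: "0 < k"
  and rising_N0: "N (v 0) = {v 1}" and rising_N: "0 < j \<Longrightarrow> j < k \<Longrightarrow> N (v j) = {v (j - 1), v (j + 1)}"
  using rising unfolding rising_def by auto

lemma rising_inj: "i \<le> k \<Longrightarrow> j \<le> k \<Longrightarrow> v i = v j \<longleftrightarrow> i = j"
  using rising_m by (metis add_right_cancel)

lemma rising_Suc: "j < k \<Longrightarrow> v (Suc j) \<in> N (v j)"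
  using rising_N0 rising_N[of j] by (cases "j = 0") auto

lemma rising_pred: "v (k - 1) \<in> N (v k)"
  using rising_Suc[of "k - 1"] rising_k N_sym[OF rising_V[of "k - 1"]] by simp

lemma rising_N_less: "j < k \<Longrightarrow> N (v j) \<subseteq> v ` {..Suc j}"
  using rising_N0 rising_N[of j] by (cases "j = 0") auto

lemma rising_exit:
  assumes "i \<le> j" "j < k" "u \<in> N (v i)" "u \<notin> v ` {..j}"
  shows "u = v (Suc j) \<and> i = j"
proof -
  have "u \<in> v ` {..Suc i}" using rising_N_less[of i] assms by auto
  then obtain r where r: "u = v r" "r \<le> Suc i" by auto
  then have "\<not> r \<le> j" using assms(4) by auto
  then have "r = Suc j" "i = j" using r assms(1) by auto
  then show ?thesis using r by simp
qed

lemma rising_g: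
  assumes "j < k"
  shows "g (v j) < g (v (Suc j))"
proof -
  have "g (v (Suc j)) = g (v j) + 1 / (real (m (v (Suc j))) * real (m (v j)))"
  \<comment> \<open>Everything beyond \<open>v j\<close> is attached to the walk by the edge from
    \<open>v j\<close> to \<open>v (Suc j)\<close> alone.\<close>
  proof (rule bridge[of "V - v ` {..j}"])
    show "V - v ` {..j} \<subseteq> K" using rising_0 by (auto simp: V_def)
    have "v (Suc j) \<noteq> v r" if "r \<le> j" for r using rising_inj[of "Suc j" r] that assms by simp
    then have "v (Suc j) \<notin> v ` {..j}" by (metis atMost_iff imageE)
    then show "v (Suc j) \<in> V - v ` {..j}" using rising_V[of "Suc j"] assms by simp
    show "v j \<in> V" "v (Suc j) \<in> N (v j)" using rising_V rising_Suc assms by auto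
    show "v j \<notin> V - v ` {..j}" by auto
    fix u w assume u: "u \<in> V - v ` {..j}" and w: "w \<in> N u" "w \<notin> V - v ` {..j}"
    then obtain i where i: "w = v i" "i \<le> j" using N_subset by blast
    moreover have "u \<in> N w" using N_sym u w by blast
    ultimately show "u = v (Suc j) \<and> w = v j" using rising_exit[of i j u] u assms by auto
  qed
  moreover have "0 < m (v (Suc j))" "0 < m (v j)" using marks_V rising_V assms by auto
  ultimately show ?thesis by simp
qed

text \<open>The walk from \<open>z\<close> can leave the arm only through \<open>v k\<close>. If
  \<open>z\<close> lay on the arm, so would \<open>v (k - 1)\<close>, and being adjacent to
  \<open>v k\<close> it would be \<open>x 1\<close>.\<close>

lemma rising_arm:
  assumes a: "arm (v k) x t d" and ne: "x 1 \<noteq> v (k - 1)"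
  shows "z \<notin> x ` {1..t}"
proof
  assume z: "z \<in> x ` {1..t}"
  have "v j \<in> x ` {1..t}" if "j < k" for j
    using that
  proof (induction j)
    case 0 then show ?case using z rising_0 by simp
  next
    case (Suc j)
    then have "v j \<in> x ` {1..t}" by simp
    moreover have "v (Suc j) \<in> N (v j)" using rising_Suc Suc by simp
    moreover have "v (Suc j) \<noteq> x 0" using arm_0[OF a] rising_inj[of "Suc j" k] Suc.prems by simp
    ultimately show ?case using arm_exit[OF a, of "v j" 1 "v (Suc j)"] by auto
  qed
  then have "v (k - 1) \<in> x ` {1..t}" using rising_k by simp
  then obtain s where s: "v (k - 1) = x s" "1 \<le> s" "s \<le> t" by auto
  have "v k \<in> N (v (k - 1))" using rising_Suc[of "k - 1"] rising_k by simp
  then have "s = 1" using arm_enter[OF a, of s] s by simp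
  then show False using ne s by simp
qed

end

text \<open>Take the longest such walk; its distinct marks bound its length by
  \<open>card V\<close>. At its end the remaining neighbours have total mark
  \<open>2 * (k + 1) - k = k + 2\<close>, and a single one would prolong the walk.\<close>

lemma rising_maximal:
  assumes "N z = {y}" "m y = 2"
  obtains k v X where "rising k v" "N (v k) = insert (v (k - 1)) X" "v (k - 1) \<notin> X"
    "finite X" "X \<noteq> {}" "(\<Sum>x\<in>X. m x) = k + 2" "card X \<noteq> 1"
proof -
  have "rising 1 (\<lambda>j. if j = 0 then z else y)"
    using assms z_in_V mark_z N_subset[of z] by (auto simp: rising_def le_Suc_eq)
  then have ex: "\<exists>v. rising 1 v" by blast
  have bd: "k \<le> card V" if "\<exists>v. rising k v" for k
  proof -
    obtain v where v: "rising k v" using \<open>\<exists>v. rising k v\<close> by blast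
    have "inj_on v {..k}" "v ` {..k} \<subseteq> V" using rising_inj[OF v] rising_V[OF v] by (auto simp: inj_on_def)
    then have "card {..k} \<le> card V" using card_inj_on_le finite_V by blast
    then show ?thesis by simp
  qed
  obtain k where k: "\<exists>v. rising k v" "\<And>k'. \<exists>v. rising k' v \<Longrightarrow> k' \<le> k"
    using GreatestI_nat[of "\<lambda>k. \<exists>v. rising k v", OF ex bd] Greatest_le_nat[of "\<lambda>k. \<exists>v. rising k v", OF _ bd]
    by blast
  then obtain v where v: "rising k v" by blast
  define X where "X = N (v k) - {v (k - 1)}"
  have N: "N (v k) = insert (v (k - 1)) X" using rising_pred[OF v] by (auto simp: X_def)
  have sum: "(\<Sum>x\<in>X. m x) = k + 2"
    using harmonic_remove[OF rising_V[OF v, of k] rising_pred[OF v]] rising_m[OF v, of k]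
      rising_m[OF v, of "k - 1"] rising_k[OF v] by (simp add: X_def)
  have "X \<noteq> {x}" for x
  proof
    assume X: "X = {x}"
    then have "m x = k + 2" using sum by simp
    moreover have "x \<in> V" using X N N_subset by blast
    ultimately have "rising (k + 1) (v(k + 1 := x))"
      using v N X unfolding rising_def by (auto simp: le_Suc_eq less_Suc_eq)
    then show False using k(2)[of "k + 1"] by auto
  qed
  then have "card X \<noteq> 1" by (metis card_1_singletonE)
  moreover have "X \<noteq> {}" using sum by auto
  moreover have "v (k - 1) \<notin> X" "finite X" using finite_N by (auto simp: X_def)
  ultimately show ?thesis using that[OF v N _ _ _ sum] by blast
qed

text \<open>Every further neighbour of \<open>v k\<close> has a smaller mark and starts an arm, and
  by \<open>connected\<close> the walk and the arms make up the whole diagram. \<open>g\<close>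
  increases along the walk and outwards on the arms, so its maxima are tips. Equal values at two
  tips force equal lengths by \<open>arm_g\<close>, hence equal drops, and \<open>arm_swap\<close>
  applies.\<close>

lemma maximal_exchangeable_star:
  assumes v: "rising k v" and N: "N (v k) = insert (v (k - 1)) X" "v (k - 1) \<notin> X" and X: "X \<noteq> {}"
    and small: "\<And>x. x \<in> X \<Longrightarrow> m x < m (v k)"
    and i: "i \<in> K" "i' \<in> K" "\<And>j. j \<in> K \<Longrightarrow> g j \<le> g i" "g i' = g i"
  shows "exchangeable i i'"
proof -
  let ?b = "v k"
  have bV: "?b \<in> V" using rising_V[OF v] by simp
  have "\<forall>y. \<exists>x t d. y \<in> X \<longrightarrow> arm ?b x t d \<and> x 1 = y"
    using arm_exists[OF bV] N small by blast
  then obtain A T D where A: "\<And>y. y \<in> X \<Longrightarrow> arm ?b (A y) (T y) (D y)" "\<And>y. y \<in> X \<Longrightarrow> A y 1 = y"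
    by metis
  have zA: "z \<notin> A y ` {1..T y}" if "y \<in> X" for y
    using rising_arm[OF v A(1)[OF that]] A(2)[OF that] N that by auto
  define W where "W = v ` {..k} \<union> (\<Union>y\<in>X. A y ` {1..T y})"
  have "W = V"
  proof (rule connected)
    show "W \<subseteq> V" using rising_V[OF v] arm_V[OF A(1)] by (auto simp: W_def)
    show "W \<noteq> {}" by (auto simp: W_def)
    fix w assume "w \<in> W"
    then consider j where "j < k" "w = v j" | "w = v k" | y where "y \<in> X" "w \<in> A y ` {1..T y}"
      unfolding W_def by (auto simp: le_less)
    then show "N w \<subseteq> W"
    proof cases
      case (1 j)
      then have "N w \<subseteq> v ` {..Suc j}" using rising_N_less[OF v] by simp
      also have "\<dots> \<subseteq> v ` {..k}" using 1 by (intro image_mono) auto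
      finally show ?thesis by (auto simp: W_def)
    next
      case 2
      have "y \<in> W" if "y \<in> X" for y
      proof -
        have "A y 1 \<in> A y ` {1..T y}" using arm_t[OF A(1)[OF that]] by (intro imageI) auto
        then show ?thesis using A(2)[OF that] that by (auto simp: W_def)
      qed
      moreover have "v (k - 1) \<in> W" by (auto simp: W_def)
      ultimately show ?thesis unfolding 2 N by auto
    next
      case (3 y)
      show ?thesis
      proof
        fix u assume u: "u \<in> N w"
        show "u \<in> W"
        proof (cases "u \<in> A y ` {1..T y}")
          case False
          then have "u = A y 0" using arm_exit[OF A(1)[OF 3(1)] 3(2) u] by simp
          then have "u = v k" using arm_0[OF A(1)[OF 3(1)]] by simp
          then show ?thesis by (auto simp: W_def)
        qed (use 3 in \<open>auto simp: W_def\<close>)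
      qed
    qed
  qed
  have tip: "\<exists>y\<in>X. j = A y (T y)" if j: "j \<in> K" "\<And>l. l \<in> K \<Longrightarrow> g l \<le> g j" for j
  proof -
    have nz: "j \<noteq> z" using j z_notin_K by auto
    have mx: "g l \<le> g j" if "l \<in> V" "l \<noteq> z" for l using j V_cases that by simp
    have "j \<in> W" using \<open>W = V\<close> j K_subset by auto
    then consider r where "r \<le> k" "j = v r" | y s where "y \<in> X" "1 \<le> s" "s \<le> T y" "j = A y s"
      unfolding W_def by auto
    then consider r where "r < k" "j = v r" | "j = v k" | y s where "y \<in> X" "1 \<le> s" "s \<le> T y" "j = A y s"
      by (metis le_less)
    then show ?thesis
    proof cases
      case (1 r)
      have "v (Suc r) \<noteq> z" using rising_inj[OF v, of "Suc r" 0] rising_0[OF v] 1 by auto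
      then show ?thesis using mx[of "v (Suc r)"] rising_V[OF v, of "Suc r"] rising_g[OF v, of r] 1 by simp
    next
      case 2
      obtain y where y: "y \<in> X" using X by blast
      have t: "1 \<le> T y" using arm_t[OF A(1)[OF y]] by simp
      have "A y 1 \<in> A y ` {1..T y}" using t by auto
      then have "A y 1 \<noteq> z" using zA[OF y] by metis
      moreover have "g (v k) < g (A y 1)" using arm_g_less[OF A(1)[OF y] zA[OF y], of 1] t arm_0[OF A(1)[OF y]] by simp
      ultimately show ?thesis using mx[of "A y 1"] arm_V[OF A(1)[OF y], of 1] t 2 by simp
    next
      case (3 y s)
      show ?thesis
      proof (cases "s = T y")
        case False
        then have s: "Suc s \<le> T y" using 3 by simp
        then have "A y (Suc s) \<in> A y ` {1..T y}" by auto
        then have "A y (Suc s) \<noteq> z" using zA[OF 3(1)] by metis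
        moreover have "g (A y s) < g (A y (Suc s))"
          using arm_g_less[OF A(1)[OF 3(1)] zA[OF 3(1)], of "Suc s"] s by simp
        ultimately show ?thesis using mx[of "A y (Suc s)"] arm_V[OF A(1)[OF 3(1)], of "Suc s"] s 3 by simp
      qed (use 3 in auto)
    qed
  qed
  obtain y where y: "y \<in> X" "i = A y (T y)" using tip[of i] i by auto
  obtain y' where y': "y' \<in> X" "i' = A y' (T y')" using tip[of i'] i by auto
  note a = A(1)[OF y(1)] and a' = A(1)[OF y'(1)]
  show ?thesis
  proof (cases "y = y'")
    case True then show ?thesis using y y' exchangeable_refl by simp
  next
    case False
    have pos: "0 < real (m ?b)" using marks_V bV by simp
    have "g i = g i'" using i by simp
    then have "real (T y) * real (T y + 1) = real (T y') * real (T y' + 1)"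
      using arm_g[OF a zA[OF y(1)]] arm_g[OF a' zA[OF y'(1)]] y y' pos by simp
    then have "T y * (T y + 1) = T y' * (T y' + 1)" by (metis of_nat_eq_iff of_nat_mult)
    then have T: "T y = T y'"
    proof -
      have "a * (a + 1) < b * (b + 1)" if "a < b" for a b :: nat
        using that by (intro mult_strict_mono) auto
      then show ?thesis using \<open>T y * (T y + 1) = _\<close> by (metis less_irrefl linorder_neqE_nat)
    qed
    have "(T y + 1) * D y = (T y + 1) * D y'" using arm_mp[OF a] arm_mp[OF a'] T by simp
    then have "D y = D y'" by (metis add_is_0 mult_cancel1 one_neq_zero)
    then have "arm ?b (A y') (T y) (D y)" using a' T by simp
    moreover have "A y 1 \<noteq> A y' 1" using A(2) y y' False by simp
    ultimately show ?thesis
      using arm_swap[OF a, of "A y'"] zA[OF y(1)] zA[OF y'(1)] T y y' by simp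
  qed
qed

end

section \<open>Chains with forked ends and cycles\<close>

context marked_diagram
begin

lemma leaf_arm:
  assumes "p \<in> V" "y \<in> V" "N y = {p}" "m p = 2" "m y = 1"
  shows "arm p (\<lambda>s. if s = 0 then p else y) 1 1"
  using assms by (auto simp: arm_def le_Suc_eq)

lemma leaf_g:
  assumes "p \<in> V" "y \<in> V" "N y = {p}" "m p = 2" "m y = 1" "y \<noteq> z"
  shows "g y = g p + 1 / 2"
  using arm_bridge[OF leaf_arm[OF assms(1-5)], of 1] assms by simp

text \<open>Injectivity is demanded explicitly: with constant marks, unlike on a rising walk, the
  marks do not distinguish the nodes. The same holds for \<open>cyc\<close>.\<close>

definition flat :: "'a \<Rightarrow> 'a \<Rightarrow> nat \<Rightarrow> (nat \<Rightarrow> 'a) \<Rightarrow> bool" where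
  "flat p x l w \<longleftrightarrow> 0 < l \<and> w 0 = p \<and> w 1 = x \<and> (\<forall>j\<le>l. w j \<in> V \<and> m (w j) = 2) \<and> inj_on w {..l}
    \<and> (\<forall>j. 0 < j \<longrightarrow> j < l \<longrightarrow> N (w j) = {w (j - 1), w (j + 1)})"

text \<open>A node of mark 2 entered from a node of mark 2 has 2 left for its other neighbours: one
  node of mark 2 prolongs the chain, two of mark 1 end it. A prolonging node is new because the
  neighbours of all earlier nodes are already known.\<close>

lemma flat_maximal:
  assumes p: "p \<in> V" "m p = 2" "N p = {z, y', x}" "x \<noteq> z" "m x = 2" "m y' = 1"
  obtains l w y1 y2 where "flat p x l w" "N (w l) = {w (l - 1), y1, y2}" "y1 \<noteq> y2" "m y1 = 1" "m y2 = 1"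
proof -
  have xN: "x \<in> N p" and xV: "x \<in> V" using p N_subset by auto
  have px: "p \<noteq> x" using xN N_irrefl p by auto
  have "flat p x 1 (\<lambda>j. if j = 0 then p else x)"
    using p xV px by (auto simp: flat_def le_Suc_eq inj_on_def)
  then have ex: "\<exists>w. flat p x 1 w" by blast
  have bd: "k \<le> card V" if "\<exists>w. flat p x k w" for k
  proof -
    obtain w where w: "flat p x k w" using \<open>\<exists>v. flat p x k v\<close> by blast
    have "inj_on w {..k}" "w ` {..k} \<subseteq> V" using w by (auto simp: flat_def)
    then have "card {..k} \<le> card V" using card_inj_on_le finite_V by blast
    then show ?thesis by simp
  qed
  obtain l where l: "\<exists>w. flat p x l w" "\<And>k'. \<exists>w. flat p x k' w \<Longrightarrow> k' \<le> l"
    using GreatestI_nat[of "\<lambda>k. \<exists>v. flat p x k v", OF ex bd] Greatest_le_nat[of "\<lambda>k. \<exists>v. flat p x k v", OF _ bd]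
    by blast
  then obtain w where w: "flat p x l w" by blast
  have w0: "0 < l" "w 0 = p" "w 1 = x" and wV: "\<And>j. j \<le> l \<Longrightarrow> w j \<in> V" "\<And>j. j \<le> l \<Longrightarrow> m (w j) = 2"
    and inj: "inj_on w {..l}" and wN: "\<And>j. 0 < j \<Longrightarrow> j < l \<Longrightarrow> N (w j) = {w (j - 1), w (j + 1)}"
    using w unfolding flat_def by auto
  have Suc: "w (Suc j) \<in> N (w j)" if "j < l" for j
    using wN[of j] w0 xN that by (cases "j = 0") auto
  have pred: "w (l - 1) \<in> N (w l)"
    using Suc[of "l - 1"] w0 N_sym[OF wV(1)[of "l - 1"]] by simp
  define Y where "Y = N (w l) - {w (l - 1)}"
  have N: "N (w l) = insert (w (l - 1)) Y" using pred by (auto simp: Y_def)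
  have fin: "finite Y" "\<And>y. y \<in> Y \<Longrightarrow> 0 < m y" using finite_N N_pos by (auto simp: Y_def)
  have "2 * m (w l) = m (w (l - 1)) + (\<Sum>y\<in>Y. m y)"
    using harmonic_remove[OF wV(1)[of l] pred] by (simp add: Y_def)
  then have sum: "(\<Sum>y\<in>Y. m y) = 2" using wV(2)[of l] wV(2)[of "l - 1"] by simp
  consider (one) y where "Y = {y}" "m y = 2"
    | (two) y1 y2 where "y1 \<noteq> y2" "Y = {y1, y2}" "m y1 = 1" "m y2 = 1"
    using sum_eq_2_cases[of Y m] fin sum by metis
  then show ?thesis
  proof cases
    case (two y1 y2)
    then show ?thesis using that[OF w] N by auto
  next
    case (one y)
    have yN: "y \<in> N (w l)" and yV: "y \<in> V" using N one N_subset by auto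
    have "y \<notin> w ` {..l}"
    proof
      assume "y \<in> w ` {..l}"
      then obtain j where j: "y = w j" "j \<le> l" by auto
      have ne: "w a = w b \<longleftrightarrow> a = b" if "a \<le> l" "b \<le> l" for a b using inj that by (auto simp: inj_on_def)
      have lN: "w l \<in> N y" using N_sym[OF wV(1)[of l] yN] by simp
      have "y \<in> Y" using one by simp
      then have "j \<noteq> l - 1" using j by (auto simp: Y_def)
      moreover have "j \<noteq> l" using yN N_irrefl yV j by auto
      ultimately have jl: "j < l - 1" using j by linarith
      show False
      proof (cases "j = 0")
        case True
        then have "w l \<in> {z, y', x}" using lN j w0 p by auto
        moreover have "w l \<noteq> z" using wV(2)[of l] mark_z by auto
        moreover have "w l \<noteq> y'" using wV(2)[of l] p by auto
        ultimately have "w l = w 1" using w0 by simp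
        then show False using ne[of l 1] w0 jl by simp
      next
        case False
        then have "w l = w (j - 1) \<or> w l = w (j + 1)" using wN[of j] jl lN j by auto
        then show False using ne[of l "j - 1"] ne[of l "j + 1"] jl by auto
      qed
    qed
    moreover have "inj_on (w(l + 1 := y)) {..l}" using inj by (auto simp: inj_on_def)
    ultimately have "inj_on (w(l + 1 := y)) {..l + 1}" by (auto simp: atMost_Suc)
    then have "flat p x (l + 1) (w(l + 1 := y))"
      using w N one yV unfolding flat_def by (auto simp: le_Suc_eq less_Suc_eq)
    then show ?thesis using l(2)[of "l + 1"] by auto
  qed
qed

text \<open>The resistances add up along the chain: 1/2 up to \<open>p\<close>, 1/4 for each chain
  edge and 1/2 for each leaf. The near leaf \<open>y'\<close> has resistance 1 and the two far
  leaves at least 5/4, so the maxima are the far leaves, which are arms of length one at the same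
  node.\<close>

lemma maximal_exchangeable_flat:
  assumes p: "p \<in> V" "m p = 2" "N p = {z, y', x}" "x \<noteq> z" "y' \<noteq> z" "m x = 2" "m y' = 1" "N z = {p}"
    and i: "i \<in> K" "i' \<in> K" "\<And>j. j \<in> K \<Longrightarrow> g j \<le> g i" "g i' = g i"
  shows "exchangeable i i'"
proof -
  obtain l w y1 y2 where w: "flat p x l w" and wl: "N (w l) = {w (l - 1), y1, y2}" "y1 \<noteq> y2" "m y1 = 1" "m y2 = 1"
    using flat_maximal[OF p(1-4,6,7)] by blast
  have w0: "0 < l" "w 0 = p" "w 1 = x" and wV: "\<And>j. j \<le> l \<Longrightarrow> w j \<in> V" "\<And>j. j \<le> l \<Longrightarrow> m (w j) = 2"
    and inj: "inj_on w {..l}" and wN: "\<And>j. 0 < j \<Longrightarrow> j < l \<Longrightarrow> N (w j) = {w (j - 1), w (j + 1)}"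
    using w unfolding flat_def by auto
  have ne: "w a = w b \<longleftrightarrow> a = b" if "a \<le> l" "b \<le> l" for a b using inj that by (auto simp: inj_on_def)
  have Suc: "w (Suc j) \<in> N (w j)" if "j < l" for j
    using wN[of j] w0 p that by (cases "j = 0") auto
  have y': "y' \<in> V" "N y' = {p}"
    using p leaf[of y' p] N_sym[of p y'] N_subset[of p] by auto
  have yy: "y1 \<in> V" "y2 \<in> V" using wl N_subset by blast+
  have yN: "N y1 = {w l}" "N y2 = {w l}"
    using leaf[of y1 "w l"] leaf[of y2 "w l"] yy N_sym[OF wV(1)[of l]] wl wV(2)[of l] by auto
  have yz: "y \<noteq> z \<and> y \<noteq> y'" if "N y = {w l}" for y
  proof -
    have "w l \<noteq> p" using ne[of l 0] w0 by auto
    then show ?thesis using that p y' by auto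
  qed
  define W where "W = {z, y', y1, y2} \<union> w ` {..l}"
  have "W = V"
  proof (rule connected)
    show "W \<subseteq> V" using z_in_V y' yy wV by (auto simp: W_def)
    show "W \<noteq> {}" by (auto simp: W_def)
    fix u assume "u \<in> W"
    then consider "u = z \<or> u = y'" | "u = y1 \<or> u = y2" | "u = w 0" | "u = w l" | j where "0 < j" "j < l" "u = w j"
    proof -
      from \<open>u \<in> W\<close> consider "u = z \<or> u = y'" | "u = y1 \<or> u = y2" | j where "j \<le> l" "u = w j"
        unfolding W_def by auto
      then show thesis using that by cases (metis le_less neq0_conv)+
    qed
    then show "N u \<subseteq> W"
    proof cases
      case 1 then have "N u = {w 0}" using p y' w0 by auto
      then show ?thesis by (auto simp: W_def)
    next
      case 2 then have "N u = {w l}" using yN by auto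
      then show ?thesis by (auto simp: W_def)
    next
      case 3 then have "N u = {z, y', w 1}" using p w0 by auto
      then show ?thesis using w0 by (auto simp: W_def)
    next
      case 4 then have "N u = {w (l - 1), y1, y2}" using wl by auto
      then show ?thesis by (auto simp: W_def)
    next
      case (5 j)
      then have "N u = {w (j - 1), w (j + 1)}" "j - 1 \<le> l" "j + 1 \<le> l" using wN by auto
      then show ?thesis by (auto simp: W_def)
    qed
  qed
  have gp: "g p = 1 / 2"
  proof -
    have "g p = g z + 1 / (real (m p) * real (m z))"
    proof (rule bridge[of K])
      show "p \<in> K" using p V_cases mark_z by force
      fix u v assume u: "u \<in> K" "v \<in> N u" "v \<notin> K"
      then have "v = z" using N_subset V_cases by blast
      moreover have "u \<in> N v" using N_sym u K_subset by blast
      ultimately show "u = p \<and> v = z" using p by simp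
    qed (use p z_in_V z_notin_K in auto)
    then show ?thesis using p mark_z g_z by simp
  qed
  have gw: "g (w (Suc j)) = g (w j) + 1 / 4" if j: "j < l" for j
  proof -
    have "g (w (Suc j)) = g (w j) + 1 / (real (m (w (Suc j))) * real (m (w j)))"
    proof (rule bridge[of "V - ({z, y'} \<union> w ` {..j})"])
      show "V - ({z, y'} \<union> w ` {..j}) \<subseteq> K" using V_cases by blast
      have "w (Suc j) \<noteq> w r" if "r \<le> j" for r using ne[of "Suc j" r] that j by simp
      then have "w (Suc j) \<notin> w ` {..j}" by (metis atMost_iff imageE)
      moreover have "w (Suc j) \<noteq> z" "w (Suc j) \<noteq> y'" using wV(2)[of "Suc j"] j p mark_z by auto
      ultimately show "w (Suc j) \<in> V - ({z, y'} \<union> w ` {..j})" using wV(1)[of "Suc j"] j by simp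
      show "w j \<in> V" "w (Suc j) \<in> N (w j)" using wV Suc j by auto
      show "w j \<notin> V - ({z, y'} \<union> w ` {..j})" by simp
      fix u v assume u: "u \<in> V - ({z, y'} \<union> w ` {..j})" and v: "v \<in> N u" "v \<notin> V - ({z, y'} \<union> w ` {..j})"
      have uN: "u \<in> N v" using N_sym u v by blast
      have uw: "u \<noteq> w r" if "r \<le> j" for r using u that by auto
      have "v \<noteq> z" using uN p w0 uw[of 0] by auto
      moreover have "v \<noteq> y'" using uN y' w0 uw[of 0] by auto
      moreover have "v \<in> V" using v N_subset by blast
      ultimately obtain r where r: "v = w r" "r \<le> j" using v by auto
      show "u = w (Suc j) \<and> v = w j"
      proof (cases "r = 0")
        case True
        then have "u = w 1" using uN p r w0 u by auto
        then have "j = 0" using uw[of 1] by (cases j) auto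
        then show ?thesis using \<open>u = w 1\<close> r True by simp
      next
        case False
        then have *: "u = w (r - 1) \<or> u = w (Suc r)" using wN[of r] uN r j by auto
        then have "u = w (Suc r)" using uw[of "r - 1"] r by auto
        moreover then have "r = j" using uw[of "Suc r"] r by (cases "r = j") auto
        ultimately show ?thesis using r by simp
      qed
    qed
    then show ?thesis using wV(2)[of j] wV(2)[of "Suc j"] j by simp
  qed
  have gw': "g (w j) \<le> g (w l)" if "j \<le> l" for j
    by (rule g_mono_chain[OF _ that]) (simp add: gw)
  have gwl: "g (w l) \<ge> 3 / 4"
    using gw'[of 1] gw[of 0] w0 gp by simp
  have gy1: "g y1 = g (w l) + 1 / 2" using leaf_g[of "w l" y1] wV[of l] yy yN yz wl by simp
  have gy': "g y' = 1" using leaf_g[of p y'] p y' gp by simp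
  have tip: "j = y1 \<or> j = y2" if "j \<in> K" "\<And>r. r \<in> K \<Longrightarrow> g r \<le> g j" for j
  proof -
    have "y1 \<in> K" using yz yN yy V_cases by blast
    then have *: "g y1 \<le> g j" using that by simp
    have "j \<in> W" "j \<noteq> z" using that \<open>W = V\<close> K_subset z_notin_K by auto
    moreover have "j \<noteq> y'" using * gy' gy1 gwl by auto
    moreover have "j \<noteq> w r" if "r \<le> l" for r using * gw'[OF that] gy1 by auto
    ultimately show ?thesis by (auto simp: W_def)
  qed
  have arms: "arm (w l) (\<lambda>s. if s = 0 then w l else y1) 1 1" "arm (w l) (\<lambda>s. if s = 0 then w l else y2) 1 1"
    using leaf_arm[of "w l"] wV[of l] yy yN wl by auto
  have "exchangeable y1 y2" using arm_swap[OF arms] wl yz yN by auto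
  moreover have "exchangeable y2 y1" using arm_swap[OF arms(2,1)] wl yz yN by auto
  ultimately show ?thesis
    using tip[of i] tip[of i'] i exchangeable_refl by auto
qed

section \<open>Cycles\<close>

definition cyc :: "nat \<Rightarrow> (nat \<Rightarrow> 'a) \<Rightarrow> bool" where
  "cyc k v \<longleftrightarrow> 0 < k \<and> v 0 = z \<and> v 1 \<in> N z \<and> (\<forall>j\<le>k. v j \<in> V \<and> m (v j) = 1) \<and> inj_on v {..k}
    \<and> (\<forall>j. 0 < j \<longrightarrow> j < k \<longrightarrow> N (v j) = {v (j - 1), v (j + 1)})"

text \<open>A node of mark 1 entered from a node of mark 1 has exactly one further neighbour, again
  of mark 1. At maximal length this neighbour is an earlier node, and among these only
  \<open>z\<close> has a neighbour unaccounted for.\<close>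

lemma cyc_exists:
  assumes Nz: "N z = {y, y'}" "y \<noteq> y'" "m y = 1" "m y' = 1"
  obtains k v where "cyc k v" "N (v k) = {v (k - 1), z}" "N z = {v 1, v k}" "2 \<le> k"
proof -
  have yN: "y \<in> N z" and yV: "y \<in> V" using Nz N_subset by auto
  have "y \<noteq> z" using yN N_irrefl z_in_V by auto
  then have "cyc 1 (\<lambda>j. if j = 0 then z else y)"
    using yN yV z_in_V mark_z Nz by (auto simp: cyc_def le_Suc_eq inj_on_def)
  then have ex: "\<exists>w. cyc 1 w" by blast
  have bd: "k \<le> card V" if "\<exists>w. cyc k w" for k
  proof -
    obtain w where w: "cyc k w" using \<open>\<exists>v. cyc k v\<close> by blast
    have "inj_on w {..k}" "w ` {..k} \<subseteq> V" using w by (auto simp: cyc_def)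
    then have "card {..k} \<le> card V" using card_inj_on_le finite_V by blast
    then show ?thesis by simp
  qed
  obtain l where l: "\<exists>w. cyc l w" "\<And>k'. \<exists>w. cyc k' w \<Longrightarrow> k' \<le> l"
    using GreatestI_nat[of "\<lambda>k. \<exists>v. cyc k v", OF ex bd] Greatest_le_nat[of "\<lambda>k. \<exists>v. cyc k v", OF _ bd]
    by blast
  then obtain w where w: "cyc l w" by blast
  have w0: "0 < l" "w 0 = z" "w 1 \<in> N z" and wV: "\<And>j. j \<le> l \<Longrightarrow> w j \<in> V" "\<And>j. j \<le> l \<Longrightarrow> m (w j) = 1"
    and inj: "inj_on w {..l}" and wN: "\<And>j. 0 < j \<Longrightarrow> j < l \<Longrightarrow> N (w j) = {w (j - 1), w (j + 1)}"
    using w unfolding cyc_def by auto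
  have ne: "w a = w b \<longleftrightarrow> a = b" if "a \<le> l" "b \<le> l" for a b using inj that by (auto simp: inj_on_def)
  have Suc: "w (Suc j) \<in> N (w j)" if "j < l" for j
    using wN[of j] w0 that by (cases "j = 0") auto
  have pred: "w (l - 1) \<in> N (w l)"
    using Suc[of "l - 1"] w0 N_sym[OF wV(1)[of "l - 1"]] by simp
  define Y where "Y = N (w l) - {w (l - 1)}"
  have N: "N (w l) = insert (w (l - 1)) Y" using pred by (auto simp: Y_def)
  have fin: "finite Y" "\<And>y. y \<in> Y \<Longrightarrow> 0 < m y" using finite_N N_pos by (auto simp: Y_def)
  have "2 * m (w l) = m (w (l - 1)) + (\<Sum>y\<in>Y. m y)"
    using harmonic_remove[OF wV(1)[of l] pred] by (simp add: Y_def)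
  then have sum: "(\<Sum>y\<in>Y. m y) = 1" using wV(2)[of l] wV(2)[of "l - 1"] by simp
  obtain u where u: "Y = {u}" "m u = 1" using sum_eq_1_singleton[of Y m] fin sum by blast
  have uN: "u \<in> N (w l)" and uV: "u \<in> V" using N u N_subset by auto
  have lN: "w l \<in> N u" using N_sym[OF wV(1)[of l] uN] by simp
  have "u \<in> w ` {..l}"
  proof (rule ccontr)
    assume "u \<notin> w ` {..l}"
    moreover have "inj_on (w(l + 1 := u)) {..l}" using inj by (auto simp: inj_on_def)
    ultimately have "inj_on (w(l + 1 := u)) {..l + 1}" by (auto simp: atMost_Suc)
    then have "cyc (l + 1) (w(l + 1 := u))"
      using w N u uV unfolding cyc_def by (auto simp: le_Suc_eq less_Suc_eq)
    then show False using l(2)[of "l + 1"] by auto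
  qed
  then obtain j where j: "u = w j" "j \<le> l" by auto
  have "u \<in> Y" using u by simp
  then have "j \<noteq> l - 1" using j by (auto simp: Y_def)
  moreover have "j \<noteq> l" using uN N_irrefl uV j by auto
  ultimately have jl: "j < l - 1" using j by linarith
  have "j = 0"
  proof (rule ccontr)
    assume "j \<noteq> 0"
    then have "w l = w (j - 1) \<or> w l = w (j + 1)" using wN[of j] jl lN j by auto
    then show False using ne[of l "j - 1"] ne[of l "j + 1"] jl by auto
  qed
  then have uz: "u = z" using j w0 by simp
  have "w 1 \<noteq> w l" using ne[of 1 l] jl by auto
  then have "N z = {w 1, w l}" using w0 lN uz Nz by auto
  then show ?thesis using that[OF w] N u uz jl by auto
qed

text \<open>No edge of a cycle is a bridge, so the resistance is computed directly. The value is
  that of paths of \<open>j\<close> and \<open>k + 1 - j\<close> unit edges in parallel.\<close>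

lemma cyc_g:
  assumes v: "cyc k v" and NK: "N (v k) = {v (k - 1), z}" and j: "1 \<le> j" "j \<le> k" and K: "K = v ` {1..k}"
  shows "g (v j) = real j - (real j)\<^sup>2 / (real k + 1)"
proof -
  \<comment> \<open>The Green function with pole \<open>j\<close> of the negative second difference
    on \<open>1..k\<close>. It vanishes at 0 and at \<open>k + 1\<close>, both of which stand for
    \<open>z\<close>.\<close>
  define A where "A l = min (real l) (real j) - real j * real l / (real k + 1)" for l
  define w where "w = (\<Sum>l\<in>{1..k}. A l *\<^sub>R v l)"
  have ne: "v a = v b \<longleftrightarrow> a = b" if "a \<le> k" "b \<le> k" for a b
    using v that by (auto simp: cyc_def inj_on_def)
  have vK: "v l \<in> K" if "1 \<le> l" "l \<le> k" for l using K that by auto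
  have z0: "v 0 = z" using v by (simp add: cyc_def)
  have ip: "v l \<bullet> v q = (if l = q then 2 else 0) - (if l = q - 1 then 1 else 0) - (if l = q + 1 then 1 else 0)"
    if "1 \<le> l" "l \<le> k" "1 \<le> q" "q \<le> k" for l q
  proof -
    have "v l \<in> N (v q) \<longleftrightarrow> l = q - 1 \<or> l = q + 1"
    proof (cases "q = k")
      case True
      then show ?thesis using NK ne[of l "k - 1"] ne[of l 0] z0 that by auto
    next
      case False
      then have "N (v q) = {v (q - 1), v (q + 1)}" using v that by (auto simp: cyc_def)
      then show ?thesis using ne[of l "q - 1"] ne[of l "q + 1"] that False by auto
    qed
    then show ?thesis using inner_V[of "v l" "v q"] vK K_subset ne[of l q] that by (auto simp: subset_iff)
  qed
  have A0: "A 0 = 0" by (simp add: A_def)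
  have "real j * (real k + 1) / (real k + 1) = real j" by simp
  then have Ak: "A (k + 1) = 0" using j by (simp add: A_def add.commute)
  have lap: "2 * A q - A (q - 1) - A (q + 1) = (if q = j then 1 else 0)" if "1 \<le> q" "q \<le> k" for q
  proof -
    have "2 * (a * r / D) - a * (r - 1) / D - a * (r + 1) / D = 0" for a r D :: real
      by (simp add: algebra_simps add_divide_distrib diff_divide_distrib)
    moreover have "real (q - 1) = real q - 1" using that by simp
    ultimately have lin: "2 * (real j * real q / (real k + 1)) - real j * real (q - 1) / (real k + 1)
        - real j * real (q + 1) / (real k + 1) = 0"
      by (metis of_nat_1 of_nat_add)
    have "2 * min (real q) (real j) - min (real (q - 1)) (real j) - min (real (q + 1)) (real j)
        = (if q = j then 1 else 0)"
      using that by (auto simp: min_def)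
    moreover have "2 * (a - x) - (b - y) - (d - u) = (2 * a - b - d) - (2 * x - y - u)"
      for a b d x y u :: real by simp
    ultimately show ?thesis using lin unfolding A_def by (simp only:)
  qed
  have wq: "w \<bullet> v q = (if q = j then 1 else 0)" if q: "1 \<le> q" "q \<le> k" for q
  proof -
    have "w \<bullet> v q = (\<Sum>l\<in>{1..k}. (if l = q then 2 * A l else 0) - (if l = q - 1 then A l else 0) - (if l = q + 1 then A l else 0))"
      unfolding w_def inner_sum_left using ip q by (intro sum.cong refl) auto
    also have "\<dots> = 2 * A q - (if q - 1 \<in> {1..k} then A (q - 1) else 0) - (if q + 1 \<in> {1..k} then A (q + 1) else 0)"
      using q by (simp add: sum_subtractf)
    also have "\<dots> = 2 * A q - A (q - 1) - A (q + 1)"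
    proof -
      have "q - 1 \<notin> {1..k} \<Longrightarrow> A (q - 1) = 0" using q A0 by (cases "q = 1") auto
      moreover have "q + 1 \<notin> {1..k} \<Longrightarrow> A (q + 1) = 0" using q Ak by (cases "q = k") auto
      ultimately show ?thesis by auto
    qed
    finally show ?thesis using lap[OF q] by simp
  qed
  have jK: "v j \<in> K" and m1: "m (v j) = 1" using vK j v by (auto simp: cyc_def)
  have cq: "c (v j) \<bullet> v q = (if q = j then 1 else 0)" if "1 \<le> q" "q \<le> k" for q
    using c_dual[OF jK vK[OF that]] m1 ne[of j q] j that by auto
  have "c (v j) - w = 0"
  proof (rule span_orthogonal_zero)
    show "c (v j) - w \<in> span K" unfolding w_def
      using c_span[OF jK] vK by (intro span_diff span_sum span_scale) (auto intro: span_base)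
    show "(c (v j) - w) \<bullet> a = 0" if a: "a \<in> K" for a
    proof -
      obtain q where "a = v q" "1 \<le> q" "q \<le> k" using a K by auto
      then show ?thesis using wq cq by (simp add: inner_diff_left)
    qed
  qed
  then have "g (v j) = c (v j) \<bullet> w" by (simp add: g_def)
  also have "\<dots> = (\<Sum>l\<in>{1..k}. if l = j then A l else 0)"
    unfolding w_def inner_sum_right using cq by (intro sum.cong refl) auto
  also have "\<dots> = A j" using j by simp
  finally show ?thesis by (simp add: A_def power2_eq_square)
qed

text \<open>The parabola of \<open>cyc_g\<close> takes equal values at distinct positions only if
  they add up to \<open>k + 1\<close>, and these are exchanged by the reflection of the cycle
  through \<open>z\<close>.\<close>

lemma maximal_exchangeable_cyc:
  assumes v: "cyc k v" and NK: "N (v k) = {v (k - 1), z}" "N z = {v 1, v k}"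
    and i: "i \<in> K" "i' \<in> K" "g i' = g i"
  shows "exchangeable i i'"
proof -
  have w0: "0 < k" "v 0 = z" and vV: "\<And>j. j \<le> k \<Longrightarrow> v j \<in> V"
    and inj: "inj_on v {..k}" and vN: "\<And>j. 0 < j \<Longrightarrow> j < k \<Longrightarrow> N (v j) = {v (j - 1), v (j + 1)}"
    using v unfolding cyc_def by auto
  have ne: "v a = v b \<longleftrightarrow> a = b" if "a \<le> k" "b \<le> k" for a b using inj that by (auto simp: inj_on_def)
  have V: "v ` {..k} = V"
  proof (rule connected)
    show "v ` {..k} \<subseteq> V" using vV by auto
    fix u assume "u \<in> v ` {..k}"
    then obtain j where j: "u = v j" "j \<le> k" by auto
    then consider "j = 0" | "j = k" | "0 < j" "j < k" by linarith
    then show "N u \<subseteq> v ` {..k}"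
    proof cases
      case 1 then have "N u = {v 1, v k}" using j w0 NK by simp
      then show ?thesis using w0 by auto
    next
      case 2 then have "N u = {v (k - 1), v 0}" using j w0 NK by simp
      then show ?thesis by auto
    next
      case 3 then have "N u = {v (j - 1), v (j + 1)}" using j vN by simp
      then show ?thesis using 3 by auto
    qed
  qed simp
  have "v ` {..k} = insert (v 0) (v ` {1..k})"
  proof -
    have "{..k} = insert 0 {1..k}" by auto
    then show ?thesis by (metis image_insert)
  qed
  moreover have "v 0 \<notin> v ` {1..k}"
  proof
    assume "v 0 \<in> v ` {1..k}"
    then obtain j where "v 0 = v j" "1 \<le> j" "j \<le> k" by auto
    then show False using ne[of 0 j] by simp
  qed
  ultimately have K: "K = v ` {1..k}"
    using V w0(2) z_notin_K unfolding V_def by (metis insert_ident)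
  obtain p q where p: "i = v p" "1 \<le> p" "p \<le> k" and q: "i' = v q" "1 \<le> q" "q \<le> k"
    using i unfolding K by auto
  show ?thesis
  proof (cases "p = q")
    case True then show ?thesis using p q exchangeable_refl by simp
  next
    case False
    have "real q - (real q)\<^sup>2 / (real k + 1) = real p - (real p)\<^sup>2 / (real k + 1)"
      using cyc_g[OF v NK(1) p(2,3) K] cyc_g[OF v NK(1) q(2,3) K] i p q by simp
    then have "(real p - real q) * (real k + 1 - (real p + real q)) = 0"
      by (simp add: field_simps power2_eq_square)
    then have "real k + 1 = real p + real q" using False by simp
    then have pq: "q = k + 1 - p" by linarith
    define \<sigma> where "\<sigma> u = v (k + 1 - the_inv_into {..k} v u)" for u
    have \<sigma>: "\<sigma> (v l) = v (k + 1 - l)" if "l \<le> k" for l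
      using the_inv_into_f_f[OF inj, of l] that by (simp add: \<sigma>_def)
    show ?thesis
    proof (rule exchangeableI[of \<sigma>])
      show "\<sigma> i = i'" using \<sigma>[of p] p q pq by simp
    next
      fix u assume "u \<in> K"
      then obtain l where l: "u = v l" "1 \<le> l" "l \<le> k" using K by auto
      then have "k + 1 - l \<in> {1..k}" by auto
      then show "\<sigma> u \<in> K" using \<sigma>[of l] l K by simp
      show "\<sigma> (\<sigma> u) = u" using \<sigma>[of l] \<sigma>[of "k + 1 - l"] l by auto
    next
      fix u w assume uw: "u \<in> K" "w \<in> K" "w \<in> N u"
      obtain l r where l: "u = v l" "1 \<le> l" "l \<le> k" and r: "w = v r" "1 \<le> r" "r \<le> k" using uw K by auto
      have step: "v b \<in> N (v a)" if "1 \<le> a" "a \<le> k" "1 \<le> b" "b \<le> k" "a = b + 1 \<or> b = a + 1" for a b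
        using vN[of a] NK that by (cases "a = k") auto
      have "r = l + 1 \<or> l = r + 1"
      proof (cases "l = k")
        case True
        then have "v r = v (k - 1) \<or> v r = v 0" using uw l r NK w0 by auto
        then show ?thesis using ne[of r "k - 1"] ne[of r 0] r True l by auto
      next
        case False
        then have "v r = v (l - 1) \<or> v r = v (l + 1)" using uw l r vN[of l] by auto
        then show ?thesis using ne[of r "l - 1"] ne[of r "l + 1"] r l False by auto
      qed
      then have "v (k + 1 - r) \<in> N (v (k + 1 - l))" using l r by (intro step) auto
      then show "\<sigma> w \<in> N (\<sigma> u)" using \<sigma>[of l] \<sigma>[of r] l r by simp
    qed
  qed
qed

section \<open>Case distinction at the affine node\<close>

text \<open>The neighbours of \<open>z\<close> have total mark 2. Two of mark 1 give a cycle; one of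
  mark 2 starts a walk ending in at least two further neighbours of total mark \<open>k + 2\<close>.
  Either all of these are below \<open>k + 1\<close>, which gives a star, or they have marks
  \<open>k + 1\<close> and 1. In the latter case \<open>mark_le\<close> forces \<open>k = 1\<close>,
  the forked chain.\<close>

theorem maximal_exchangeable:
  assumes i: "i \<in> K" "i' \<in> K" "\<And>j. j \<in> K \<Longrightarrow> g j \<le> g i" "g i' = g i"
  shows "exchangeable i i'"
proof -
  have sum: "(\<Sum>y\<in>N z. m y) = 2" using harmonic[OF z_in_V] mark_z by simp
  have pos: "\<And>y. y \<in> N z \<Longrightarrow> 0 < m y" using N_pos by blast
  show ?thesis
  proof (rule sum_eq_2_cases[OF finite_N pos sum])
    fix y y' assume y: "y \<noteq> y'" "N z = {y, y'}" "m y = 1" "m y' = 1"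
    obtain k v where v: "cyc k v" "N (v k) = {v (k - 1), z}" "N z = {v 1, v k}" "2 \<le> k"
      by (rule cyc_exists[OF y(2,1,3,4)])
    show ?thesis by (rule maximal_exchangeable_cyc[OF v(1-3) i(1,2,4)])
  next
    fix y assume one: "N z = {y}" "m y = 2"
    obtain k v X where v: "rising k v" and N: "N (v k) = insert (v (k - 1)) X" "v (k - 1) \<notin> X"
      and X: "finite X" "X \<noteq> {}" "(\<Sum>x\<in>X. m x) = k + 2" "card X \<noteq> 1"
      by (rule rising_maximal[OF one])
    have mk: "m (v k) = k + 1" and vV: "v k \<in> V" using rising_m[OF v] rising_V[OF v] by auto
    show ?thesis
    proof (cases "\<forall>x\<in>X. m x < m (v k)")
      case True
      then show ?thesis using maximal_exchangeable_star[OF v N X(2) _ i] by blast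
    next
      case False
      then obtain x where x: "x \<in> X" "k + 1 \<le> m x" using mk by (auto simp: not_less)
      have pos: "0 < m y" if "y \<in> X" for y using that N N_pos by blast
      have eq: "m x + (\<Sum>y\<in>X - {x}. m y) = k + 2" using sum.remove[OF X(1) x(1), of m] X(3) by simp
      have "X - {x} \<noteq> {}"
      proof
        assume "X - {x} = {}"
        then have "X = {x}" using x by blast
        then show False using X(4) by simp
      qed
      then have "0 < (\<Sum>y\<in>X - {x}. m y)" using X(1) pos by (intro sum_pos) auto
      then have "(\<Sum>y\<in>X - {x}. m y) = 1" and mx: "m x = k + 1" using eq x by auto
      then obtain y' where y': "X - {x} = {y'}" "m y' = 1"
        using sum_eq_1_singleton[of "X - {x}" m] X(1) pos by auto
      then have Xe: "X = {x, y'}" using x by auto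
      have "m (v k) \<le> 2 * m y'" using mark_le[OF vV, of y'] N Xe by simp
      then have k: "k = 1" using mk y' rising_k[OF v] by simp
      have p: "v 1 \<in> V" "m (v 1) = 2" "N (v 1) = {z, y', x}" using vV mk N Xe k rising_0[OF v] by auto
      have "x \<noteq> z" "y' \<noteq> z" using N(2) k rising_0[OF v] Xe by auto
      moreover have "N z = {v 1}" using rising_N0[OF v] rising_0[OF v] by simp
      ultimately show ?thesis using maximal_exchangeable_flat[OF p] i y' mx k by simp
    qed
  qed
qed

end

section \<open>Gaussian sums near deep holes\<close>

lemma summable_on_exp_abs_int:
  fixes b :: real assumes "0 < b"
  shows "(\<lambda>k::int. exp (- b * \<bar>real_of_int k\<bar>)) summable_on UNIV"
proof -
  let ?f = "\<lambda>k::int. exp (- b * \<bar>real_of_int k\<bar>)"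
  have "summable (\<lambda>n. exp (- b) ^ n)" using assms by (intro summable_geometric) simp
  then have geo: "(\<lambda>n::nat. exp (- b) ^ n) summable_on UNIV"
    by (intro norm_summable_imp_summable_on) simp
  have e: "exp (- b) ^ n = exp (- b * real n)" for n by (metis exp_of_nat_mult mult.commute)
  have "?f summable_on (range int)"
    by (subst summable_on_reindex) (use geo in \<open>auto simp: o_def e inj_on_def\<close>)
  moreover have "?f summable_on (range (\<lambda>n. - int n))"
    by (subst summable_on_reindex) (use geo in \<open>auto simp: o_def e inj_on_def\<close>)
  ultimately have "?f summable_on (range int \<union> range (\<lambda>n. - int n))" by (rule summable_on_union)
  moreover have "range int \<union> range (\<lambda>n. - int n) = UNIV"
  proof -
    have "k \<in> range int \<union> range (\<lambda>n. - int n)" for k by (cases k rule: int_cases2) auto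
    then show ?thesis by blast
  qed
  ultimately show ?thesis by simp
qed

text \<open>Rounding the coordinates to multiples of \<open>1 / n\<close>, with \<open>n\<close> the
  dimension, is injective on \<open>L\<close>: points of the same cell have l1 distance below 1.
  This compares the sum with a product of one-dimensional geometric series.\<close>

lemma gaussian_summable_separated:
  fixes L :: "'a::euclidean_space set"
  assumes sep: "\<And>x y. x \<in> L \<Longrightarrow> y \<in> L \<Longrightarrow> x \<noteq> y \<Longrightarrow> 1 \<le> dist x y" and \<alpha>: "0 < \<alpha>"
  shows "(\<lambda>x. exp (- \<alpha> * (norm (x - z))\<^sup>2)) summable_on L"
proof -
  define n where "n = real DIM('a)"
  have n: "n > 0" by (simp add: n_def)
  define k where "k x = (\<lambda>b\<in>Basis. \<lfloor>n * (x \<bullet> b)\<rfloor>)" for x :: 'a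
  \<comment> \<open>The constants come from \<open>\<alpha> * s^2 >= s - 1 / (4 * \<alpha>)\<close>
    (complete the square), the rounding error \<open>1 / n\<close> and the shift by
    \<open>z\<close>.\<close>
  define \<psi> where "\<psi> b j = exp (1 / (4 * \<alpha>) + 1 / n + \<bar>z \<bullet> b\<bar>) * exp (- (1 / n) * \<bar>real_of_int j\<bar>)" for b :: 'a and j
  have inj: "inj_on k L"
  proof (rule inj_onI, rule ccontr)
    fix x y assume xy: "x \<in> L" "y \<in> L" "k x = k y" "x \<noteq> y"
    have "\<bar>(x - y) \<bullet> b\<bar> < 1 / n" if "b \<in> Basis" for b
    proof -
      have "\<lfloor>n * (x \<bullet> b)\<rfloor> = \<lfloor>n * (y \<bullet> b)\<rfloor>" using fun_cong[OF xy(3), of b] that by (simp add: k_def)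
      then have "\<bar>n * (x \<bullet> b) - n * (y \<bullet> b)\<bar> < 1" by linarith
      then have "n * \<bar>(x - y) \<bullet> b\<bar> < 1"
        using n by (simp add: inner_diff_left abs_mult flip: right_diff_distrib)
      then show ?thesis using n by (simp add: field_simps)
    qed
    then have "(\<Sum>b\<in>Basis. \<bar>(x - y) \<bullet> b\<bar>) < (\<Sum>b\<in>(Basis::'a set). 1 / n)"
      by (intro sum_strict_mono) auto
    also have "\<dots> = 1" by (simp add: n_def)
    finally have "norm (x - y) < 1" using norm_le_l1[of "x - y"] by linarith
    then show False using sep[OF xy(1,2,4)] by (simp add: dist_norm)
  qed
  have "(\<lambda>j. \<psi> b j) summable_on UNIV" for b
    unfolding \<psi>_def using summable_on_exp_abs_int[of "1 / n"] n by (intro summable_on_cmult_right) simp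
  then have "Infinite_Set_Sum.abs_summable_on (\<lambda>j. \<psi> b j) UNIV" for b
    unfolding abs_summable_equivalent[symmetric] by (simp add: \<psi>_def)
  then have "Infinite_Set_Sum.abs_summable_on (\<lambda>g. \<Prod>b\<in>Basis. \<psi> b (g b)) (PiE Basis (\<lambda>_. UNIV))"
    by (intro abs_summable_on_prod_PiE) auto
  then have "(\<lambda>g. \<Prod>b\<in>Basis. \<psi> b (g b)) summable_on (PiE Basis (\<lambda>_. UNIV))"
    unfolding abs_summable_equivalent[symmetric] by (rule abs_summable_summable)
  then have "(\<lambda>g. \<Prod>b\<in>Basis. \<psi> b (g b)) summable_on (k ` L)"
    by (rule summable_on_subset) (auto simp: k_def)
  then have "(\<lambda>x. \<Prod>b\<in>Basis. \<psi> b (k x b)) summable_on L"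
    by (subst (asm) summable_on_reindex[OF inj]) (simp add: o_def)
  then show ?thesis
  proof (rule summable_on_comparison_test)
    fix x
    have "exp (- \<alpha> * (norm (x - z))\<^sup>2) = (\<Prod>b\<in>Basis. exp (- \<alpha> * ((x - z) \<bullet> b)\<^sup>2))"
    proof -
      have "(norm (x - z))\<^sup>2 = (\<Sum>b\<in>Basis. ((x - z) \<bullet> b)\<^sup>2)"
        unfolding power2_norm_eq_inner by (subst euclidean_inner) (simp add: power2_eq_square)
      then show ?thesis by (simp add: sum_distrib_left exp_sum sum_negf flip: exp_sum)
    qed
    also have "\<dots> \<le> (\<Prod>b\<in>Basis. \<psi> b (k x b))"
    proof (intro prod_mono conjI)
      fix b :: 'a assume b: "b \<in> Basis"
      define s where "s = \<bar>(x - z) \<bullet> b\<bar>"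
      have "0 \<le> \<alpha> * (s - 1 / (2 * \<alpha>))\<^sup>2" using \<alpha> by simp
      also have "\<dots> = \<alpha> * s\<^sup>2 - s + 1 / (4 * \<alpha>)" using \<alpha> by (simp add: field_simps power2_eq_square)
      finally have 1: "- \<alpha> * s\<^sup>2 \<le> 1 / (4 * \<alpha>) - s" by simp
      have "\<bar>real_of_int (k x b)\<bar> \<le> n * \<bar>x \<bullet> b\<bar> + 1"
      proof -
        have "k x b = \<lfloor>n * (x \<bullet> b)\<rfloor>" using b by (simp add: k_def)
        then have "\<bar>real_of_int (k x b)\<bar> \<le> \<bar>n * (x \<bullet> b)\<bar> + 1" by linarith
        then show ?thesis using n by (simp add: abs_mult)
      qed
      then have "1 / n * \<bar>real_of_int (k x b)\<bar> \<le> \<bar>x \<bullet> b\<bar> + 1 / n" using n by (simp add: field_simps)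
      moreover have "\<bar>x \<bullet> b\<bar> \<le> s + \<bar>z \<bullet> b\<bar>" by (simp add: s_def inner_diff_left)
      ultimately have "- \<alpha> * s\<^sup>2 \<le> 1 / (4 * \<alpha>) + 1 / n + \<bar>z \<bullet> b\<bar> + - (1 / n) * \<bar>real_of_int (k x b)\<bar>"
        using 1 by simp
      then show "exp (- \<alpha> * ((x - z) \<bullet> b)\<^sup>2) \<le> \<psi> b (k x b)"
        unfolding \<psi>_def exp_add[symmetric] by (simp add: s_def)
    qed simp
    finally show "exp (- \<alpha> * (norm (x - z))\<^sup>2) \<le> (\<Prod>b\<in>Basis. \<psi> b (k x b))" .
  qed simp
qed

text \<open>The factor \<open>exp (t / 2)\<close> is kept to absorb \<open>exp u\<close> in
  \<open>local_minimum\<close>, where a plain quadratic bound would be too weak for large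
  \<open>\<alpha>\<close>. Writing \<open>E = exp (t / 2)\<close>, use
  \<open>E * E >= E * (1 + t / 2) + E * t^2 / 8\<close> and
  \<open>E * (1 + t / 2) >= (1 + t / 2)^2 >= 1 + t\<close>.\<close>

lemma exp_minus_linear_ge:
  fixes t :: real assumes "0 \<le> t"
  shows "exp (t / 2) * t\<^sup>2 / 8 \<le> exp t - 1 - t"
proof -
  have E: "1 + t / 2 + t\<^sup>2 / 8 \<le> exp (t / 2)"
    using exp_lower_Taylor_quadratic[of "t / 2"] assms by (simp add: power_divide)
  have "exp (t / 2) * (1 + t / 2 + t\<^sup>2 / 8) \<le> exp (t / 2) * exp (t / 2)"
    using E by (intro mult_left_mono) auto
  moreover have "(1 + t / 2) * (1 + t / 2) \<le> exp (t / 2) * (1 + t / 2)"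
  proof (rule mult_right_mono)
    have "0 \<le> t\<^sup>2 / 8" by simp
    then show "1 + t / 2 \<le> exp (t / 2)" using E by linarith
  qed (use assms in auto)
  moreover have "(1 + t / 2) * (1 + t / 2) \<ge> 1 + t" by (simp add: algebra_simps)
  moreover have "exp (t / 2) * exp (t / 2) = exp t" by (simp flip: exp_add)
  moreover have "exp (t / 2) * (1 + t / 2 + t\<^sup>2 / 8) = exp (t / 2) * (1 + t / 2) + exp (t / 2) * t\<^sup>2 / 8"
    by (simp add: algebra_simps)
  ultimately show ?thesis by linarith
qed

lemma exp_minus_one_le: "exp u - 1 \<le> u * exp u" for u :: real
proof -
  have "(1 + - u) * exp u \<le> exp (- u) * exp u"
    using exp_ge_add_one_self[of "- u"] by (intro mult_right_mono) auto
  then show ?thesis by (simp add: algebra_simps flip: exp_add)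
qed

section \<open>Root lattices of full rank\<close>

locale full_root_lattice =
  fixes L :: "'a::euclidean_space set"
  assumes zero_in: "0 \<in> L" and diff_in: "x \<in> L \<Longrightarrow> y \<in> L \<Longrightarrow> x - y \<in> L"
    and integral: "x \<in> L \<Longrightarrow> y \<in> L \<Longrightarrow> x \<bullet> y \<in> \<int>"
    and generated: "L = group_closure {v \<in> L. v \<bullet> v = 2}"
    and span_L: "span L = UNIV"
begin

definition \<Phi> where "\<Phi> = {v \<in> L. v \<bullet> v = 2}"

lemma uminus_in: "x \<in> L \<Longrightarrow> - x \<in> L"
  using diff_in[OF zero_in] by simp

lemma add_in: "x \<in> L \<Longrightarrow> y \<in> L \<Longrightarrow> x + y \<in> L"
  using diff_in[of x "- y"] uminus_in by simp

lemma int_scale_in: "x \<in> L \<Longrightarrow> real_of_int k *\<^sub>R x \<in> L"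
proof (induction k rule: int_induct[where k = 0])
  case base then show ?case using zero_in by simp
next
  case (step1 i) then show ?case using add_in by (simp add: algebra_simps)
next
  case (step2 i) then show ?case using diff_in by (simp add: algebra_simps)
qed

lemma root_in: "r \<in> \<Phi> \<Longrightarrow> r \<in> L" and root_norm: "r \<in> \<Phi> \<Longrightarrow> r \<bullet> r = 2"
  by (auto simp: \<Phi>_def)

lemma root_uminus: "r \<in> \<Phi> \<Longrightarrow> - r \<in> \<Phi>"
  using uminus_in by (auto simp: \<Phi>_def)

text \<open>Negatives of roots are roots, so differences become sums. Lists allow the repeated
  replacement of entries in \<open>sum_list_roots_norm\<close>.\<close>

lemma sum_list_roots: "x \<in> L \<Longrightarrow> \<exists>rs. set rs \<subseteq> \<Phi> \<and> sum_list rs = x"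
proof -
  assume "x \<in> L"
  then have "x \<in> group_closure \<Phi>" using generated by (simp add: \<Phi>_def)
  then show ?thesis
  proof induction
    case (base s)
    then show ?case by (cases "s = 0") (auto intro: exI[of _ "[]"] exI[of _ "[s]"])
  next
    case (diff s t)
    then obtain rs ts where *: "set rs \<subseteq> \<Phi>" "sum_list rs = s" "set ts \<subseteq> \<Phi>" "sum_list ts = t" by blast
    have "sum_list (map uminus ts) = - t" unfolding *(4)[symmetric] by (induction ts) simp_all
    then have "set (rs @ map uminus ts) \<subseteq> \<Phi>" "sum_list (rs @ map uminus ts) = s - t"
      using * root_uminus by auto
    then show ?case by blast
  qed
qed

lemma span_roots: "span \<Phi> = UNIV"
proof -
  have "x \<in> span \<Phi>" if "x \<in> L" for x
  proof -
    obtain rs where rs: "set rs \<subseteq> \<Phi>" "sum_list rs = x" using sum_list_roots \<open>x \<in> L\<close> by blast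
    have "set rs \<subseteq> \<Phi> \<Longrightarrow> sum_list rs \<in> span \<Phi>" for rs
      by (induction rs) (auto intro: span_add span_base span_0)
    then show ?thesis using rs by blast
  qed
  then have "span L \<subseteq> span \<Phi>" by (intro span_minimal) auto
  then show ?thesis using span_L by auto
qed

text \<open>A positive integral squared norm is at least 1.\<close>

lemma separated: "x \<in> L \<Longrightarrow> y \<in> L \<Longrightarrow> x \<noteq> y \<Longrightarrow> 1 \<le> dist x y"
proof -
  assume *: "x \<in> L" "y \<in> L" "x \<noteq> y"
  have "(x - y) \<bullet> (x - y) \<in> \<int>" using * integral diff_in by blast
  moreover have "0 < (x - y) \<bullet> (x - y)" using * by simp
  ultimately have "1 \<le> (x - y) \<bullet> (x - y)" by (metis Ints_cases of_int_0_less_iff of_int_1_le_iff int_one_le_iff_zero_less)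
  then show ?thesis by (simp add: dist_norm norm_eq_sqrt_inner)
qed

lemma finite_bounded: "bounded B \<Longrightarrow> finite (L \<inter> B)"
proof -
  assume B: "bounded B"
  have "uniform_discrete (L \<inter> B)"
    unfolding uniform_discrete_def using separated by (intro exI[of _ 1]) force
  moreover have "bounded (L \<inter> B)" using B bounded_Int by blast
  ultimately show ?thesis using uniform_discrete_finite_iff by blast
qed

lemma finite_roots: "finite \<Phi>"
proof -
  have "\<Phi> \<subseteq> L \<inter> cball 0 2"
    by (auto simp: \<Phi>_def norm_eq_sqrt_inner intro!: real_le_lsqrt)
  then show ?thesis using finite_bounded[of "cball 0 2"] finite_subset by blast
qed

text \<open>The squared norms of \<open>r - s\<close> and \<open>r + s\<close> are
  \<open>4 - 2 * (r \<bullet> s)\<close> and \<open>4 + 2 * (r \<bullet> s)\<close>, positive unless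
  the vector is zero.\<close>

lemma root_inner_cases:
  assumes "r \<in> \<Phi>" "s \<in> \<Phi>"
  shows "r = s \<or> r = - s \<or> r \<bullet> s \<in> {-1, 0, 1}"
proof -
  have "r \<bullet> s \<in> \<int>" using assms integral root_in by blast
  then obtain k where k: "r \<bullet> s = real_of_int k" by (auto elim: Ints_cases)
  have "(r - s) \<bullet> (r - s) = 4 - 2 * k" "(r + s) \<bullet> (r + s) = 4 + 2 * k"
    using assms k root_norm by (auto simp: inner_diff_left inner_diff_right inner_add_left inner_add_right inner_commute[of s r])
  moreover have "0 \<le> (r - s) \<bullet> (r - s)" "0 \<le> (r + s) \<bullet> (r + s)" by auto
  moreover have "r \<noteq> s \<Longrightarrow> 0 < (r - s) \<bullet> (r - s)" "r \<noteq> - s \<Longrightarrow> 0 < (r + s) \<bullet> (r + s)"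
    by (auto simp: add_eq_0_iff)
  ultimately have "r \<noteq> s \<Longrightarrow> r \<noteq> - s \<Longrightarrow> k < 2 \<and> - 2 < k" by linarith
  then have "r \<noteq> s \<Longrightarrow> r \<noteq> - s \<Longrightarrow> k = -1 \<or> k = 0 \<or> k = 1" by linarith
  then show ?thesis using k by auto
qed

lemma root_add: "r \<in> \<Phi> \<Longrightarrow> s \<in> \<Phi> \<Longrightarrow> r \<bullet> s = -1 \<Longrightarrow> r + s \<in> \<Phi>"
  using add_in by (auto simp: \<Phi>_def inner_add_left inner_add_right inner_commute)

lemma root_diff: "r \<in> \<Phi> \<Longrightarrow> s \<in> \<Phi> \<Longrightarrow> r \<bullet> s = 1 \<Longrightarrow> r - s \<in> \<Phi>"
  using diff_in by (auto simp: \<Phi>_def inner_diff_left inner_diff_right inner_commute)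

section \<open>The Voronoi cell of the origin\<close>

definition P where "P = {z. \<forall>r\<in>\<Phi>. r \<bullet> z \<le> 1}"

text \<open>Two roots with negative inner product add up to a root or to zero, so a sum of roots can be
  shortened until all inner products are nonnegative.\<close>

lemma sum_list_roots_norm:
  assumes z: "z \<in> P" and "set rs \<subseteq> \<Phi>"
  shows "2 * (sum_list rs \<bullet> z) \<le> sum_list rs \<bullet> sum_list rs"
  using assms(2)
proof (induction "length rs" arbitrary: rs rule: less_induct)
  case less
  show ?case
  proof (cases rs)
    case (Cons r ts)
    have r: "r \<in> \<Phi>" and ts: "set ts \<subseteq> \<Phi>" using less.prems Cons by auto
    show ?thesis
    proof (cases "\<forall>s\<in>set ts. 0 \<le> r \<bullet> s")
      \<comment> \<open>Adding \<open>r\<close> raises the left-hand side by at most 2, since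
        \<open>r \<bullet> z \<le> 1\<close>, and the right-hand side by at least
        \<open>r \<bullet> r = 2\<close>.\<close>
      case True
      have "0 \<le> r \<bullet> sum_list ts" using True by (induction ts) (auto simp: inner_add_right)
      moreover have "2 * (sum_list ts \<bullet> z) \<le> sum_list ts \<bullet> sum_list ts" using less.hyps[of ts] Cons ts by simp
      moreover have "r \<bullet> z \<le> 1" using z r by (auto simp: P_def)
      ultimately show ?thesis using root_norm[OF r] Cons
        by (simp add: inner_add_left inner_add_right inner_commute)
    next
      case False
      then obtain s where s: "s \<in> set ts" "r \<bullet> s < 0" by auto
      then obtain as bs where ab: "ts = as @ s # bs" by (auto simp: in_set_conv_decomp)
      have "s \<in> \<Phi>" using s ts by auto
      then consider "r = - s" | "r \<bullet> s = -1" using root_inner_cases[OF r, of s] s root_norm[OF r] by force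
      then show ?thesis
      proof cases
        case 1
        then have "sum_list rs = sum_list (as @ bs)" using Cons ab by simp
        moreover have "2 * (sum_list (as @ bs) \<bullet> z) \<le> sum_list (as @ bs) \<bullet> sum_list (as @ bs)"
          using less.hyps[of "as @ bs"] Cons ab ts by auto
        ultimately show ?thesis by simp
      next
        case 2
        then have rs: "r + s \<in> \<Phi>" using root_add r \<open>s \<in> \<Phi>\<close> by blast
        have "sum_list rs = sum_list ((r + s) # as @ bs)" using Cons ab by simp
        moreover have "2 * (sum_list ((r + s) # as @ bs) \<bullet> z) \<le> sum_list ((r + s) # as @ bs) \<bullet> sum_list ((r + s) # as @ bs)"
          using less.hyps[of "(r + s) # as @ bs"] Cons ab ts rs by auto
        ultimately show ?thesis by simp
      qed
    qed
  qed simp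
qed

lemma P_iff: "z \<in> P \<longleftrightarrow> (\<forall>x\<in>L. norm z \<le> norm (x - z))"
proof -
  have eq: "norm z \<le> norm (x - z) \<longleftrightarrow> 2 * (x \<bullet> z) \<le> x \<bullet> x" for x
    by (simp add: norm_le inner_diff_left inner_diff_right inner_commute)
  show ?thesis
  proof
    assume "z \<in> P"
    then show "\<forall>x\<in>L. norm z \<le> norm (x - z)" using sum_list_roots_norm sum_list_roots eq by blast
  next
    assume *: "\<forall>x\<in>L. norm z \<le> norm (x - z)"
    have "r \<bullet> z \<le> 1" if "r \<in> \<Phi>" for r
    proof -
      have "2 * (r \<bullet> z) \<le> r \<bullet> r" using * eq root_in[OF that] by blast
      then show ?thesis using root_norm[OF that] by simp
    qed
    then show "z \<in> P" by (simp add: P_def)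
  qed
qed

lemma infdist_P: "z \<in> P \<Longrightarrow> infdist z L = norm z"
proof (rule antisym)
  assume z: "z \<in> P"
  show "infdist z L \<le> norm z" using infdist_le[OF zero_in, of z] by simp
  show "norm z \<le> infdist z L"
    unfolding infdist_def using z zero_in
    by (auto intro!: cINF_greatest simp: P_iff dist_norm norm_minus_commute)
qed

lemma nearest:
  obtains x where "x \<in> L" "z - x \<in> P" "infdist z L = norm (z - x)"
proof -
  have "uniform_discrete L"
    unfolding uniform_discrete_def using separated by (intro exI[of _ 1]) force
  then have "closed L" by (rule uniform_discrete_imp_closed)
  then obtain x where x: "x \<in> L" "infdist z L = dist z x"
    using infdist_attains_inf[of L z] zero_in by blast
  have "norm (z - x) \<le> norm (y - (z - x))" if "y \<in> L" for y
    using infdist_le[OF add_in[OF that x(1)], of z] x(2)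
    by (simp add: dist_norm norm_minus_commute algebra_simps)
  then show ?thesis using that x by (auto simp: P_iff dist_norm)
qed

section \<open>Deep holes and their active roots\<close>

definition holes where "holes = {c \<in> P. \<forall>z\<in>P. norm z \<le> norm c}"

lemma deep_hole_translate:
  assumes "deep_hole L c"
  obtains x where "x \<in> L" "c - x \<in> holes"
proof -
  obtain x where x: "x \<in> L" "c - x \<in> P" "infdist c L = norm (c - x)" by (rule nearest)
  have "norm z \<le> norm (c - x)" if "z \<in> P" for z
    using assms infdist_P[OF that] x unfolding deep_hole_def by metis
  then show ?thesis using that x by (auto simp: holes_def)
qed

lemma summable: "0 < \<alpha> \<Longrightarrow> (\<lambda>x. exp (- \<alpha> * (norm (x - z))\<^sup>2)) summable_on L"
  by (rule gaussian_summable_separated[OF separated])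

lemma gaussian_sum_translate:
  assumes "x \<in> L" shows "gaussian_sum L \<alpha> (z - x) = gaussian_sum L \<alpha> z"
proof -
  have bij: "bij_betw (\<lambda>y. y + x) L L"
    by (rule bij_betw_byWitness[of _ "\<lambda>y. y - x"]) (use assms add_in diff_in in auto)
  show ?thesis unfolding gaussian_sum_def
    by (subst infsum_reindex_bij_betw[OF bij, symmetric]) (simp add: algebra_simps)
qed

lemma gaussian_sum_isometry:
  assumes T: "linear T" "\<And>v. norm (T v) = norm v" "bij_betw T L L"
  shows "gaussian_sum L \<alpha> (T z) = gaussian_sum L \<alpha> z"
  unfolding gaussian_sum_def
  by (subst infsum_reindex_bij_betw[OF T(3), symmetric]) (simp add: T(2) flip: linear_diff[OF T(1)])

text \<open>Moving \<open>c\<close> by small multiples of \<open>h\<close> in both directions keeps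
  the active constraints, and the finitely many others are strict, so both points stay in
  \<open>P\<close>. By the parallelogram law one of them would have larger norm than
  \<open>c\<close>.\<close>

lemma hole_nonorthogonal:
  assumes c: "c \<in> holes" and h: "\<And>r. r \<in> \<Phi> \<Longrightarrow> r \<bullet> c = 1 \<Longrightarrow> r \<bullet> h = 0"
  shows "h = 0"
proof (rule ccontr)
  assume "h \<noteq> 0"
  have "\<forall>\<^sub>F e in at (0::real). \<forall>r\<in>\<Phi>. r \<bullet> (c + e *\<^sub>R h) \<le> 1"
  proof (intro eventually_ball_finite finite_roots ballI)
    fix r assume r: "r \<in> \<Phi>"
    show "\<forall>\<^sub>F e in at (0::real). r \<bullet> (c + e *\<^sub>R h) \<le> 1"
    proof (cases "r \<bullet> c = 1")
      case True
      then show ?thesis using h[OF r] by (simp add: inner_add_right)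
    next
      case False
      then have "r \<bullet> c < 1" using c r by (force simp: holes_def P_def)
      moreover have "((\<lambda>e. r \<bullet> (c + e *\<^sub>R h)) \<longlongrightarrow> r \<bullet> (c + 0 *\<^sub>R h)) (at 0)" by (intro tendsto_intros)
      ultimately have "\<forall>\<^sub>F e in at (0::real). r \<bullet> (c + e *\<^sub>R h) < 1" by (intro order_tendstoD) auto
      then show ?thesis by eventually_elim simp
    qed
  qed
  then obtain d where d: "0 < d" "\<And>e. e \<noteq> 0 \<Longrightarrow> \<bar>e\<bar> < d \<Longrightarrow> c + e *\<^sub>R h \<in> P"
    unfolding eventually_at P_def by auto
  define k where "k = (d / 2) *\<^sub>R h"
  have "c + k \<in> P" "c - k \<in> P" using d(2)[of "d / 2"] d(2)[of "- d / 2"] d(1) by (auto simp: k_def)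
  then have "norm (c + k) \<le> norm c" "norm (c - k) \<le> norm c" using c by (auto simp: holes_def)
  then have "(c + k) \<bullet> (c + k) \<le> c \<bullet> c" "(c - k) \<bullet> (c - k) \<le> c \<bullet> c" by (simp_all add: norm_le)
  then have "k \<bullet> k \<le> 0" by (simp add: inner_add_left inner_add_right inner_diff_left inner_diff_right inner_commute)
  then have "k = 0" by (metis inner_eq_zero_iff inner_ge_zero order_antisym)
  then show False using \<open>h \<noteq> 0\<close> d by (simp add: k_def)
qed

text \<open>A hole is determined by its set of active roots: the difference of two holes with the
  same set is orthogonal to it.\<close>

lemma finite_holes: "finite holes"
proof -
  have "inj_on (\<lambda>c. {r \<in> \<Phi>. r \<bullet> c = 1}) holes"
  proof (rule inj_onI)
    fix c d assume cd: "c \<in> holes" "d \<in> holes" "{r \<in> \<Phi>. r \<bullet> c = 1} = {r \<in> \<Phi>. r \<bullet> d = 1}"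
    have "r \<bullet> (c - d) = 0" if "r \<in> \<Phi>" "r \<bullet> c = 1" for r
      using cd(3) that by (auto simp: inner_diff_right)
    then show "c = d" using hole_nonorthogonal[OF cd(1), of "c - d"] by auto
  qed
  moreover have "(\<lambda>c. {r \<in> \<Phi>. r \<bullet> c = 1}) ` holes \<subseteq> Pow \<Phi>" by auto
  ultimately show ?thesis using finite_roots by (meson finite_Pow_iff finite_imageD finite_subset)
qed

section \<open>Affine reflections and the nearest lattice points\<close>

text \<open>For a root \<open>r\<close>, where \<open>r \<bullet> r = 2\<close>, this is the
  reflection in the hyperplane \<open>x \<bullet> r = 1\<close>, which contains \<open>c\<close>
  exactly when \<open>r\<close> is active at \<open>c\<close>.\<close>

definition reflection :: "'a \<Rightarrow> 'a \<Rightarrow> 'a" where "reflection r x = x - (x \<bullet> r - 1) *\<^sub>R r"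

lemma reflection:
  assumes r: "r \<in> \<Phi>" "r \<bullet> c = 1"
  shows "bij_betw (reflection r) L L" "norm (reflection r x - c) = norm (x - c)" "(reflection r x - c) \<bullet> r = - ((x - c) \<bullet> r)"
    "reflection r (reflection r x) = x"
proof -
  have rr: "r \<bullet> r = 2" using root_norm r by blast
  have cr: "c \<bullet> r = 1" using r by (simp add: inner_commute)
  show inv: "reflection r (reflection r x) = x" for x
    by (simp add: reflection_def rr inner_diff_left algebra_simps)
  have "reflection r x \<in> L" if x: "x \<in> L" for x
  proof -
    have "x \<bullet> r \<in> \<int>" using integral x root_in r by blast
    then obtain k where "x \<bullet> r = real_of_int k" by (auto elim: Ints_cases)
    then have "reflection r x = x - real_of_int (k - 1) *\<^sub>R r" by (simp add: reflection_def)
    then show ?thesis using diff_in[OF x int_scale_in[OF root_in[OF r(1)], of "k - 1"]] by simp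
  qed
  then show "bij_betw (reflection r) L L"
    by (intro bij_betw_byWitness[of _ "reflection r"]) (auto simp: inv)
  have eq: "reflection r x - c = (x - c) - ((x - c) \<bullet> r) *\<^sub>R r"
    by (simp add: reflection_def inner_diff_left cr)
  have gen: "(v - (v \<bullet> r) *\<^sub>R r) \<bullet> r = - (v \<bullet> r)"
    "(v - (v \<bullet> r) *\<^sub>R r) \<bullet> (v - (v \<bullet> r) *\<^sub>R r) = v \<bullet> v" for v
    by (simp_all add: inner_diff_left inner_diff_right rr inner_commute)
  show "(reflection r x - c) \<bullet> r = - ((x - c) \<bullet> r)" unfolding eq by (rule gen)
  have "(reflection r x - c) \<bullet> (reflection r x - c) = (x - c) \<bullet> (x - c)" unfolding eq by (rule gen)
  then show "norm (reflection r x - c) = norm (x - c)" by (simp add: norm_eq_sqrt_inner)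
qed

lemma hole_span:
  assumes c: "c \<in> holes"
  shows "span {r \<in> \<Phi>. r \<bullet> c = 1} = UNIV"
proof (rule ccontr)
  assume "\<not> ?thesis"
  then have "dim {r \<in> \<Phi>. r \<bullet> c = 1} < DIM('a)"
    using dim_eq_full dim_subset_UNIV le_neq_implies_less by blast
  then obtain h where "h \<noteq> 0" "\<And>y. y \<in> span {r \<in> \<Phi>. r \<bullet> c = 1} \<Longrightarrow> orthogonal h y"
    using orthogonal_to_subspace_exists by blast
  then show False using hole_nonorthogonal[OF c, of h] span_base[of _ "{r \<in> \<Phi>. r \<bullet> c = 1}"]
    by (auto simp: orthogonal_def inner_commute)
qed

text \<open>By the reflections the vectors from \<open>c\<close> to its nearest lattice points sum
  to zero. So some such vector has positive inner product with \<open>h\<close>, unless all inner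
  products vanish; but 0 and the active roots are among the nearest points, which would make
  \<open>h\<close> orthogonal to every active root. Compactness of the sphere makes the bound
  uniform.\<close>

lemma near_direction:
  assumes c: "c \<in> holes"
  obtains m where "0 < m" "\<And>h. \<exists>x\<in>L. norm (x - c) = norm c \<and> m * norm h \<le> (x - c) \<bullet> h"
proof -
  define A where "A = {x \<in> L. norm (x - c) = norm c}"
  have "A \<subseteq> L \<inter> cball c (norm c)" by (auto simp: A_def dist_norm norm_minus_commute)
  then have fin: "finite A" using finite_bounded[of "cball c (norm c)"] finite_subset by blast
  have A0: "0 \<in> A" using zero_in by (simp add: A_def)
  have Ar: "r \<in> A" if "r \<in> \<Phi>" "r \<bullet> c = 1" for r
    using that root_in root_norm
    by (auto simp: A_def norm_eq_sqrt_inner inner_diff_left inner_diff_right inner_commute)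
  define G where "G = (\<Sum>x\<in>A. x - c)"
  have "G = 0"
  proof (rule hole_nonorthogonal[OF c])
    fix r assume r: "r \<in> \<Phi>" "r \<bullet> c = 1"
    have img: "reflection r x \<in> A" if "x \<in> A" for x
      using that reflection(2)[OF r, of x] bij_betwE[OF reflection(1)[OF r]] by (auto simp: A_def)
    have bij: "bij_betw (reflection r) A A"
      by (rule bij_betw_byWitness[of _ "reflection r"]) (use img reflection(4)[OF r] in auto)
    have "G \<bullet> r = (\<Sum>x\<in>A. (reflection r x - c) \<bullet> r)"
      unfolding G_def inner_sum_left by (rule sum.reindex_bij_betw[OF bij, symmetric])
    also have "\<dots> = - (G \<bullet> r)"
      unfolding G_def inner_sum_left reflection(3)[OF r] sum_negf by simp
    finally show "r \<bullet> G = 0" by (simp add: inner_commute)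
  qed
  define \<phi> where "\<phi> h = (\<Sum>x\<in>A. max 0 ((x - c) \<bullet> h))" for h
  have pos: "0 < \<phi> h" if "h \<noteq> 0" for h
  proof (rule ccontr)
    assume "\<not> 0 < \<phi> h"
    moreover have "0 \<le> \<phi> h" unfolding \<phi>_def by (intro sum_nonneg) auto
    ultimately have "\<phi> h = 0" by simp
    then have "\<forall>x\<in>A. max 0 ((x - c) \<bullet> h) = 0"
      unfolding \<phi>_def using fin by (subst (asm) sum_nonneg_eq_0_iff) auto
    then have le: "\<forall>x\<in>A. 0 \<le> - ((x - c) \<bullet> h)" by (auto simp: max_def split: if_splits)
    have "(\<Sum>x\<in>A. - ((x - c) \<bullet> h)) = 0"
      using \<open>G = 0\<close> by (simp add: G_def sum_negf flip: inner_sum_left)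
    then have eq: "\<forall>x\<in>A. (x - c) \<bullet> h = 0" using fin le by (subst (asm) sum_nonneg_eq_0_iff) auto
    have "r \<bullet> h = 0" if "r \<in> \<Phi>" "r \<bullet> c = 1" for r
      using eq Ar[OF that] A0 by (auto simp: inner_diff_left)
    then show False using hole_nonorthogonal[OF c, of h] that by auto
  qed
  have "continuous_on (sphere 0 1) \<phi>" unfolding \<phi>_def by (intro continuous_intros)
  moreover have "sphere (0::'a) 1 \<noteq> {}" using nonempty_Basis norm_Basis by auto
  ultimately obtain u where u: "u \<in> sphere 0 1" "\<And>h. h \<in> sphere 0 1 \<Longrightarrow> \<phi> u \<le> \<phi> h"
    using continuous_attains_inf[of "sphere 0 1" \<phi>] by auto
  \<comment> \<open>Some nearest point reaches at least the average share, over \<open>A\<close>, of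
    the minimum \<open>\<phi> u\<close> on the unit sphere.\<close>
  have cA: "0 < real (card A)" using A0 fin by (auto simp: card_gt_0_iff)
  define m where "m = \<phi> u / real (card A)"
  have "u \<noteq> 0" using u by auto
  then have m: "0 < m" using pos cA by (simp add: m_def)
  have "\<exists>x\<in>L. norm (x - c) = norm c \<and> m * norm h \<le> (x - c) \<bullet> h" for h
  proof (cases "h = 0")
    case True then show ?thesis using A0 by (auto simp: A_def intro!: bexI[of _ 0])
  next
    case False
    define e where "e = h /\<^sub>R norm h"
    have "e \<in> sphere 0 1" using False by (simp add: e_def)
    then have "\<phi> u \<le> \<phi> e" using u by blast
    have "\<exists>x\<in>A. m \<le> max 0 ((x - c) \<bullet> e)"
    proof (rule ccontr)
      assume "\<not> ?thesis"
      then have "\<phi> e < (\<Sum>x\<in>A. m)" unfolding \<phi>_def using fin A0 by (intro sum_strict_mono) auto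
      also have "\<dots> = \<phi> u" using cA by (simp add: m_def)
      finally show False using \<open>\<phi> u \<le> \<phi> e\<close> by simp
    qed
    then obtain x where x: "x \<in> A" "m \<le> (x - c) \<bullet> e" using m by (auto simp: max_def split: if_splits)
    have "m * norm h \<le> ((x - c) \<bullet> e) * norm h" using x by (intro mult_right_mono) auto
    also have "\<dots> = (x - c) \<bullet> h" using False by (simp add: e_def)
    finally show ?thesis using x by (auto simp: A_def)
  qed
  then show ?thesis using that m by blast
qed

section \<open>A hole is a critical point and a local minimum\<close>

text \<open>The linear factor is bounded by \<open>|t| <= exp t + exp (- t)\<close>, and a Gaussian
  times the exponential of a linear form is a constant times a shifted Gaussian.\<close>

lemma summable_linear:
  assumes "0 < \<alpha>"
  shows "(\<lambda>x. exp (- \<alpha> * (norm (x - c))\<^sup>2) * ((x - c) \<bullet> h)) summable_on L"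
proof -
  have s: "(\<lambda>x. exp (- \<alpha> * (norm (x - c))\<^sup>2) * exp ((x - c) \<bullet> h)) summable_on L" for h
  proof -
    have "exp (- \<alpha> * (norm (x - c))\<^sup>2) * exp ((x - c) \<bullet> h)
        = exp (- \<alpha> * (norm (x - (c + h /\<^sub>R (2 * \<alpha>))))\<^sup>2) * exp ((norm h)\<^sup>2 / (4 * \<alpha>))" for x
    proof -
      have "(norm (x - (c + h /\<^sub>R (2 * \<alpha>))))\<^sup>2
          = (norm (x - c))\<^sup>2 - 2 * ((x - c) \<bullet> h) / (2 * \<alpha>) + (norm h)\<^sup>2 / (2 * \<alpha>)\<^sup>2"
        unfolding power2_norm_eq_inner diff_diff_eq[symmetric] inner_diff_left[of "x - c"] inner_diff_right[of _ "x - c"]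
        using assms by (simp add: inner_commute field_simps power2_eq_square)
      then have "- \<alpha> * (norm (x - (c + h /\<^sub>R (2 * \<alpha>))))\<^sup>2 + (norm h)\<^sup>2 / (4 * \<alpha>)
          = - \<alpha> * (norm (x - c))\<^sup>2 + (x - c) \<bullet> h"
        using assms by (simp add: field_simps power2_eq_square)
      then show ?thesis by (simp flip: exp_add)
    qed
    then show ?thesis using summable_on_cmult_left[OF summable[OF assms]] by simp
  qed
  have "(\<lambda>x. exp (- \<alpha> * (norm (x - c))\<^sup>2) * \<bar>(x - c) \<bullet> h\<bar>) summable_on L"
  proof (rule summable_on_comparison_test[OF summable_on_add[OF s[of h] s[of "- h"]]])
    fix x
    have "\<bar>(x - c) \<bullet> h\<bar> \<le> exp ((x - c) \<bullet> h) + exp ((x - c) \<bullet> (- h))"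
      using exp_ge_add_one_self[of "(x - c) \<bullet> h"] exp_ge_add_one_self[of "- ((x - c) \<bullet> h)"]
        exp_gt_zero[of "(x - c) \<bullet> h"] exp_gt_zero[of "- ((x - c) \<bullet> h)"]
      unfolding inner_minus_right by linarith
    then have "exp (- \<alpha> * (norm (x - c))\<^sup>2) * \<bar>(x - c) \<bullet> h\<bar>
        \<le> exp (- \<alpha> * (norm (x - c))\<^sup>2) * (exp ((x - c) \<bullet> h) + exp ((x - c) \<bullet> (- h)))"
      by (intro mult_left_mono) auto
    then show "exp (- \<alpha> * (norm (x - c))\<^sup>2) * \<bar>(x - c) \<bullet> h\<bar>
      \<le> exp (- \<alpha> * (norm (x - c))\<^sup>2) * exp ((x - c) \<bullet> h) + exp (- \<alpha> * (norm (x - c))\<^sup>2) * exp ((x - c) \<bullet> (- h))"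
      by (simp add: distrib_left)
  qed simp
  then have "(\<lambda>x. norm (exp (- \<alpha> * (norm (x - c))\<^sup>2) * ((x - c) \<bullet> h))) summable_on L"
    by (simp add: abs_mult)
  then show ?thesis by (rule abs_summable_summable)
qed

text \<open>The sum is linear in \<open>h\<close>. For an active root \<open>h = r\<close> the
  reflection permutes \<open>L\<close>, keeps distances to \<open>c\<close> and changes the sign of
  the factor, so the sum is its own negative. The active roots span the space.\<close>

lemma critical:
  assumes c: "c \<in> holes" and "0 < \<alpha>"
  shows "(\<Sum>\<^sub>\<infinity>x\<in>L. exp (- \<alpha> * (norm (x - c))\<^sup>2) * ((x - c) \<bullet> h)) = 0"
proof -
  define H where "H h = (\<Sum>\<^sub>\<infinity>x\<in>L. exp (- \<alpha> * (norm (x - c))\<^sup>2) * ((x - c) \<bullet> h))" for h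
  have add: "H (x + y) = H x + H y" for x y
    unfolding H_def inner_add_right distrib_left
    by (rule infsum_add; rule summable_linear[OF assms(2)])
  have scale: "H (a *\<^sub>R x) = a * H x" for a x
  proof -
    have "a * H x = (\<Sum>\<^sub>\<infinity>y\<in>L. a * (exp (- \<alpha> * (norm (y - c))\<^sup>2) * ((y - c) \<bullet> x)))"
      unfolding H_def by (rule infsum_cmult_right[symmetric]) (rule summable_linear[OF assms(2)])
    then show ?thesis unfolding H_def by (simp add: mult_ac)
  qed
  have sub: "subspace {h. H h = 0}"
    unfolding subspace_def using add scale scale[of 0 0] by auto
  have "{r \<in> \<Phi>. r \<bullet> c = 1} \<subseteq> {h. H h = 0}"
  proof
    fix r assume "r \<in> {r \<in> \<Phi>. r \<bullet> c = 1}"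
    then have r: "r \<in> \<Phi>" "r \<bullet> c = 1" by auto
    have "H r = (\<Sum>\<^sub>\<infinity>x\<in>L. exp (- \<alpha> * (norm (reflection r x - c))\<^sup>2) * ((reflection r x - c) \<bullet> r))"
      unfolding H_def by (subst infsum_reindex_bij_betw[OF reflection(1)[OF r], symmetric]) simp
    also have "\<dots> = - H r"
      unfolding reflection(2,3)[OF r] H_def by (simp add: infsum_uminus)
    finally show "r \<in> {h. H h = 0}" by simp
  qed
  then have "span {r \<in> \<Phi>. r \<bullet> c = 1} \<subseteq> {h. H h = 0}" using sub by (rule span_minimal)
  then show ?thesis using hole_span[OF c] by (auto simp: H_def)
qed

text \<open>All lattice points have distance at least \<open>norm c\<close> from \<open>c\<close>,
  so \<open>\<alpha> - 1\<close> of the exponent can be spent on \<open>norm c\<close> and the rest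
  is the sum at parameter 1. The constant does not depend on \<open>\<alpha>\<close>.\<close>

lemma gaussian_sum_hole_le:
  assumes c: "c \<in> holes" and "1 \<le> \<alpha>"
  shows "gaussian_sum L \<alpha> c \<le> exp ((norm c)\<^sup>2) * gaussian_sum L 1 c * exp (- \<alpha> * (norm c)\<^sup>2)"
proof -
  let ?R = "(norm c)\<^sup>2"
  have "gaussian_sum L \<alpha> c \<le> (\<Sum>\<^sub>\<infinity>x\<in>L. exp ?R * exp (- \<alpha> * ?R) * exp (- 1 * (norm (x - c))\<^sup>2))"
    unfolding gaussian_sum_def
  proof (rule infsum_mono)
    show "(\<lambda>x. exp (- \<alpha> * (norm (x - c))\<^sup>2)) summable_on L" using summable assms by simp
    show "(\<lambda>x. exp ?R * exp (- \<alpha> * ?R) * exp (- 1 * (norm (x - c))\<^sup>2)) summable_on L"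
      by (intro summable_on_cmult_right summable) simp
    fix x assume "x \<in> L"
    then have "norm c \<le> norm (x - c)" using c P_iff by (auto simp: holes_def)
    then have "?R \<le> (norm (x - c))\<^sup>2" by (intro power_mono) auto
    then have "(\<alpha> - 1) * ?R \<le> (\<alpha> - 1) * (norm (x - c))\<^sup>2" using assms by (intro mult_left_mono) auto
    then have "- \<alpha> * (norm (x - c))\<^sup>2 \<le> ?R + (- \<alpha> * ?R) + (- 1 * (norm (x - c))\<^sup>2)"
      by (simp add: algebra_simps)
    then show "exp (- \<alpha> * (norm (x - c))\<^sup>2) \<le> exp ?R * exp (- \<alpha> * ?R) * exp (- 1 * (norm (x - c))\<^sup>2)"
      unfolding exp_add[symmetric] by (subst exp_le_cancel_iff)
  qed
  also have "\<dots> = exp ?R * exp (- \<alpha> * ?R) * gaussian_sum L 1 c"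
    unfolding gaussian_sum_def by (intro infsum_cmult_right summable) simp
  finally show ?thesis by (simp add: mult_ac)
qed

lemma gaussian_sum_nonneg: "0 \<le> gaussian_sum L \<alpha> z"
  unfolding gaussian_sum_def by (intro infsum_nonneg) simp

text \<open>\<open>exp u\<close> times the sum at \<open>c + h\<close> is the sum of
  \<open>a x * exp (s x)\<close>, whose linear part vanishes by \<open>critical\<close>. The
  convexity remainder \<open>D\<close> is nonnegative, so it suffices that its term at one nearest
  lattice point, chosen in the direction of \<open>h\<close>, covers the loss
  \<open>(exp u - 1) * gaussian_sum L \<alpha> c\<close>.\<close>

lemma local_minimum:
  assumes c: "c \<in> holes" and m: "0 < m" "\<And>h. \<exists>x\<in>L. norm (x - c) = norm c \<and> m * norm h \<le> (x - c) \<bullet> h"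
    and h: "norm h \<le> m" and \<alpha>: "1 \<le> \<alpha>" "2 * (exp ((norm c)\<^sup>2) * gaussian_sum L 1 c) / m\<^sup>2 \<le> \<alpha>"
  shows "gaussian_sum L \<alpha> c \<le> gaussian_sum L \<alpha> (c + h)"
proof -
  define C where "C = exp ((norm c)\<^sup>2) * gaussian_sum L 1 c"
  define a where "a x = exp (- \<alpha> * (norm (x - c))\<^sup>2)" for x
  define s where "s x = 2 * \<alpha> * ((x - c) \<bullet> h)" for x
  define u where "u = \<alpha> * (norm h)\<^sup>2"
  let ?F = "gaussian_sum L \<alpha>"
  have \<alpha>0: "0 < \<alpha>" using \<alpha> by simp
  have C0: "0 \<le> C" using gaussian_sum_nonneg by (simp add: C_def)
  have suma: "a summable_on L" and sumF: "(\<Sum>\<^sub>\<infinity>x\<in>L. a x) = ?F c"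
    using summable[OF \<alpha>0] by (auto simp: a_def[abs_def] gaussian_sum_def)
  have sums: "(\<lambda>x. 2 * \<alpha> * (a x * ((x - c) \<bullet> h))) summable_on L"
    and inf0: "(\<Sum>\<^sub>\<infinity>x\<in>L. 2 * \<alpha> * (a x * ((x - c) \<bullet> h))) = 0"
    using summable_linear[OF \<alpha>0, of c h] critical[OF c \<alpha>0, of h]
    by (auto simp: a_def intro!: summable_on_cmult_right) (subst infsum_cmult_right; simp)
  have B: "a x * exp (s x) = exp u * exp (- \<alpha> * (norm (x - (c + h)))\<^sup>2)" for x
  proof -
    have "(norm (x - (c + h)))\<^sup>2 = (norm (x - c))\<^sup>2 - 2 * ((x - c) \<bullet> h) + (norm h)\<^sup>2"
      unfolding power2_norm_eq_inner diff_diff_eq[symmetric] inner_diff_left[of "x - c"] inner_diff_right[of _ "x - c"]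
      by (simp add: inner_commute)
    then have "- \<alpha> * (norm (x - c))\<^sup>2 + 2 * \<alpha> * ((x - c) \<bullet> h)
        = \<alpha> * (norm h)\<^sup>2 + - \<alpha> * (norm (x - (c + h)))\<^sup>2"
      by (simp only:) (simp add: algebra_simps)
    then show ?thesis unfolding a_def s_def u_def exp_add[symmetric] by simp
  qed
  have sumB: "(\<lambda>x. a x * exp (s x)) summable_on L" and infB: "(\<Sum>\<^sub>\<infinity>x\<in>L. a x * exp (s x)) = exp u * ?F (c + h)"
    unfolding B using summable[OF \<alpha>0, of "c + h"]
    by (auto intro!: summable_on_cmult_right simp: gaussian_sum_def infsum_cmult_right)
  define D where "D x = a x * exp (s x) - a x - 2 * \<alpha> * (a x * ((x - c) \<bullet> h))" for x
  have D: "D x = a x * (exp (s x) - 1 - s x)" for x by (simp add: D_def s_def algebra_simps)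
  have D0: "0 \<le> D x" for x
  proof -
    have "0 \<le> exp (s x) - 1 - s x" using exp_ge_add_one_self[of "s x"] by linarith
    then show ?thesis unfolding D by (intro mult_nonneg_nonneg) (auto simp: a_def)
  qed
  have "((\<lambda>x. a x + 2 * \<alpha> * (a x * ((x - c) \<bullet> h))) has_sum (?F c + 0)) L"
    using has_sum_add[OF has_sum_infsum[OF suma] has_sum_infsum[OF sums]] unfolding sumF inf0 .
  then have "((\<lambda>x. - (a x + 2 * \<alpha> * (a x * ((x - c) \<bullet> h)))) has_sum - (?F c + 0)) L"
    by (subst has_sum_uminus) simp
  from has_sum_add[OF has_sum_infsum[OF sumB] this]
  have "(D has_sum (exp u * ?F (c + h) - ?F c)) L"
    unfolding infB by (simp add: D_def[abs_def] algebra_simps)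
  then have sumD: "D summable_on L" and infD: "infsum D L = exp u * ?F (c + h) - ?F c"
    by (auto simp: summable_on_def infsumI)
  obtain x where x: "x \<in> L" "norm (x - c) = norm c" "m * norm h \<le> (x - c) \<bullet> h" using m(2) by blast
  have "sum D {x} \<le> infsum D L" using x D0 sumD by (intro finite_sum_le_infsum) auto
  then have Dx: "?F c + D x \<le> exp u * ?F (c + h)" using infD by simp
  have t: "2 * \<alpha> * (m * norm h) \<le> s x" unfolding s_def using x \<alpha>0 by (intro mult_left_mono) auto
  have t0: "0 \<le> 2 * \<alpha> * (m * norm h)" using \<alpha>0 m by simp
  \<comment> \<open>Here the constants are fixed. Since
    \<open>s x >= 2 * \<alpha> * m * norm h\<close>, the condition \<open>norm h \<le> m\<close>
    gives \<open>u \<le> s x / 2\<close>, and \<open>\<alpha> >= 2 * C / m^2\<close> gives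
    \<open>u * C \<le> (s x)^2 / 8\<close>.\<close>
  have "exp u * (u * C) \<le> exp (s x / 2) * ((s x)\<^sup>2 / 8)"
  proof (rule mult_mono)
    have "u \<le> \<alpha> * (m * norm h)"
      unfolding u_def power2_eq_square using h \<alpha>0 by (intro mult_left_mono mult_right_mono) auto
    then show "exp u \<le> exp (s x / 2)" using t by simp
    have "C \<le> \<alpha> * m\<^sup>2 / 2" using \<alpha>(2) m unfolding C_def[symmetric] by (simp add: field_simps)
    then have "u * C \<le> u * (\<alpha> * m\<^sup>2 / 2)" using \<alpha>0 by (intro mult_left_mono) (auto simp: u_def)
    also have "\<dots> = (2 * \<alpha> * (m * norm h))\<^sup>2 / 8" by (simp add: u_def power2_eq_square)
    also have "\<dots> \<le> (s x)\<^sup>2 / 8" using t t0 by (intro divide_right_mono power_mono) auto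
    finally show "u * C \<le> (s x)\<^sup>2 / 8" .
  qed (use C0 \<alpha>0 in \<open>auto simp: u_def\<close>)
  also have "\<dots> \<le> exp (s x) - 1 - s x" using exp_minus_linear_ge[of "s x"] t t0 by simp
  finally have "exp u * (u * C) * exp (- \<alpha> * (norm c)\<^sup>2) \<le> (exp (s x) - 1 - s x) * exp (- \<alpha> * (norm c)\<^sup>2)"
    by (intro mult_right_mono) auto
  also have "\<dots> = D x" unfolding D a_def x(2) by simp
  finally have lower: "exp u * (u * C) * exp (- \<alpha> * (norm c)\<^sup>2) \<le> D x" .
  have "(exp u - 1) * ?F c \<le> (u * exp u) * (C * exp (- \<alpha> * (norm c)\<^sup>2))"
    using exp_minus_one_le[of u] gaussian_sum_hole_le[OF c \<alpha>(1)] gaussian_sum_nonneg \<alpha>0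
    by (intro mult_mono) (auto simp: C_def u_def)
  also have "\<dots> \<le> D x" using lower by (simp add: mult_ac)
  finally have "(exp u - 1) * ?F c \<le> D x" .
  moreover have "(exp u - 1) * ?F c = exp u * ?F c - ?F c" by (simp add: algebra_simps)
  ultimately have "exp u * ?F c \<le> exp u * ?F (c + h)" using Dx by linarith
  then show ?thesis by simp
qed

section \<open>From local to global minimum\<close>

lemma P_closed: "closed P"
proof -
  have "P = (\<Inter>r\<in>\<Phi>. {z. r \<bullet> z \<le> 1})" by (auto simp: P_def)
  then show ?thesis by (auto intro: closed_halfspace_le)
qed

theorem stable_cold_spot_hole:
  assumes c: "c \<in> holes" and eq: "\<And>d \<alpha>. d \<in> holes \<Longrightarrow> gaussian_sum L \<alpha> d = gaussian_sum L \<alpha> c"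
  shows "stable_cold_spot L c"
proof -
  define R where "R = norm c"
  have nR: "norm d = R" if "d \<in> holes" for d using that c unfolding holes_def R_def by force
  define C where "C = exp (R\<^sup>2) * gaussian_sum L 1 c"
  have "\<forall>d. \<exists>m. d \<in> holes \<longrightarrow> 0 < m \<and> (\<forall>h. \<exists>x\<in>L. norm (x - d) = norm d \<and> m * norm h \<le> (x - d) \<bullet> h)"
    using near_direction by metis
  then obtain m where m: "\<And>d. d \<in> holes \<Longrightarrow> 0 < m d"
    "\<And>d h. d \<in> holes \<Longrightarrow> \<exists>x\<in>L. norm (x - d) = norm d \<and> m d * norm h \<le> (x - d) \<bullet> h" by metis
  define A where "A = P - (\<Union>d\<in>holes. ball d (m d))"
  have "bounded P" using c by (auto simp: holes_def bounded_iff)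
  then have "compact P" using P_closed by (simp add: compact_eq_bounded_closed)
  then have "compact A" unfolding A_def by (intro compact_diff open_UN ballI open_ball)
  \<comment> \<open>Outside the balls the norm stays strictly below \<open>R\<close>: a point of
    \<open>P\<close> with norm \<open>R\<close> would be a hole, hence the centre of one of the
    balls.\<close>
  obtain \<rho> where \<rho>: "0 \<le> \<rho>" "\<rho> < R \<or> A = {}" "\<And>z. z \<in> A \<Longrightarrow> norm z \<le> \<rho>"
  proof (cases "A = {}")
    case True then show ?thesis using that[of 0] by auto
  next
    case False
    then obtain w where w: "w \<in> A" "\<And>z. z \<in> A \<Longrightarrow> norm z \<le> norm w"
      using continuous_attains_sup[OF \<open>compact A\<close> False, of norm] by (auto intro: continuous_intros)
    have "norm w \<noteq> R"
    proof
      assume "norm w = R"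
      then have "w \<in> holes" using w(1) c by (auto simp: A_def holes_def R_def)
      then show False using w(1) m(1) by (auto simp: A_def)
    qed
    moreover have "norm w \<le> R" using w(1) c by (auto simp: A_def holes_def R_def)
    ultimately show ?thesis using that[of "norm w"] w by auto
  qed
  \<comment> \<open>1 serves \<open>gaussian_sum_hole_le\<close> and the last set serves
    \<open>local_minimum\<close> at each hole. The quotient gives
    \<open>C \<le> \<alpha> * (R^2 - \<rho>^2)\<close>, so on \<open>A\<close> the term of the
    origin alone beats the bound \<open>C * exp (- \<alpha> * R^2)\<close> for the sum at
    \<open>c\<close>.\<close>
  define \<alpha>\<^sub>0 where "\<alpha>\<^sub>0 = Max (insert 1 (insert (C / (R\<^sup>2 - \<rho>\<^sup>2)) ((\<lambda>d. 2 * C / (m d)\<^sup>2) ` holes)))"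
  have fin: "finite (insert 1 (insert (C / (R\<^sup>2 - \<rho>\<^sup>2)) ((\<lambda>d. 2 * C / (m d)\<^sup>2) ` holes)))" using finite_holes by simp
  have \<alpha>\<^sub>0: "1 \<le> \<alpha>\<^sub>0" "C / (R\<^sup>2 - \<rho>\<^sup>2) \<le> \<alpha>\<^sub>0" "\<And>d. d \<in> holes \<Longrightarrow> 2 * C / (m d)\<^sup>2 \<le> \<alpha>\<^sub>0"
    unfolding \<alpha>\<^sub>0_def by (auto intro!: Max_ge fin)
  have "gaussian_sum L \<alpha> c \<le> gaussian_sum L \<alpha> z" if \<alpha>: "\<alpha>\<^sub>0 \<le> \<alpha>" for \<alpha> z
  proof -
    obtain x where x: "x \<in> L" "z - x \<in> P" by (rule nearest)
    define w where "w = z - x"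
    have "gaussian_sum L \<alpha> c \<le> gaussian_sum L \<alpha> w"
    proof (cases "w \<in> A")
      case False
      then obtain d where d: "d \<in> holes" "dist d w < m d" using x by (auto simp: A_def w_def)
      have "gaussian_sum L \<alpha> d \<le> gaussian_sum L \<alpha> (d + (w - d))"
      proof (rule local_minimum[OF d(1) m(1)[OF d(1)] m(2)[OF d(1)]])
        show "norm (w - d) \<le> m d" using d by (simp add: dist_norm norm_minus_commute)
        show "1 \<le> \<alpha>" using \<alpha> \<alpha>\<^sub>0 by simp
        show "2 * (exp ((norm d)\<^sup>2) * gaussian_sum L 1 d) / (m d)\<^sup>2 \<le> \<alpha>"
          using \<alpha> \<alpha>\<^sub>0(3)[OF d(1)] eq[OF d(1)] nR[OF d(1)] by (simp add: C_def)
      qed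
      then show ?thesis using eq[OF d(1)] by simp
    next
      case True
      then have \<rho>R: "\<rho> < R" "norm w \<le> \<rho>" using \<rho> by auto
      then have "\<rho>\<^sup>2 < R\<^sup>2" using \<rho>(1) by (intro power_strict_mono) auto
      moreover have "C / (R\<^sup>2 - \<rho>\<^sup>2) \<le> \<alpha>" using \<alpha> \<alpha>\<^sub>0 by simp
      ultimately have "C \<le> \<alpha> * (R\<^sup>2 - \<rho>\<^sup>2)" by (simp add: field_simps)
      then have C: "C \<le> exp (\<alpha> * (R\<^sup>2 - \<rho>\<^sup>2))" using exp_ge_add_one_self[of "\<alpha> * (R\<^sup>2 - \<rho>\<^sup>2)"] by linarith
      have \<alpha>1: "1 \<le> \<alpha>" using \<alpha> \<alpha>\<^sub>0 by simp
      have "gaussian_sum L \<alpha> c \<le> C * exp (- \<alpha> * R\<^sup>2)"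
        using gaussian_sum_hole_le[OF c \<alpha>1] by (simp add: C_def R_def)
      also have "\<dots> \<le> exp (\<alpha> * (R\<^sup>2 - \<rho>\<^sup>2)) * exp (- \<alpha> * R\<^sup>2)" using C by (intro mult_right_mono) auto
      also have "\<dots> = exp (- \<alpha> * \<rho>\<^sup>2)" by (simp add: algebra_simps flip: exp_add)
      also have "\<dots> \<le> exp (- \<alpha> * (norm w)\<^sup>2)"
        using power_mono[OF \<rho>R(2), of 2] \<alpha>1 by simp
      also have "\<dots> = (\<Sum>x\<in>{0}. exp (- \<alpha> * (norm (x - w))\<^sup>2))" by simp
      also have "\<dots> \<le> gaussian_sum L \<alpha> w"
        unfolding gaussian_sum_def using summable[of \<alpha>] \<alpha>1 zero_in by (intro finite_sum_le_infsum) auto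
      finally show ?thesis .
    qed
    then show ?thesis using gaussian_sum_translate[OF x(1)] by (simp add: w_def)
  qed
  then show ?thesis unfolding stable_cold_spot_def by blast
qed

end

section \<open>Simple systems and the alcove\<close>

lemma exists_generic:
  fixes F :: "'a::euclidean_space set"
  assumes "finite F" "0 \<notin> F"
  obtains \<rho> where "\<And>r. r \<in> F \<Longrightarrow> r \<bullet> \<rho> \<noteq> 0"
proof -
  have "negligible (\<Union>r\<in>F. {x. r \<bullet> x = 0})"
    using assms by (intro negligible_Union) (auto intro!: negligible_hyperplane)
  then have "(\<Union>r\<in>F. {x. r \<bullet> x = 0}) \<noteq> UNIV" using non_negligible_UNIV by metis
  then show ?thesis using that by blast
qed

lemma finite_maximizer:
  fixes f :: "'b \<Rightarrow> real"
  assumes "finite A" "A \<noteq> {}"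
  shows "\<exists>x\<in>A. \<forall>y\<in>A. f y \<le> f x"
proof -
  have "Max (f ` A) \<in> f ` A" using assms by (intro Max_in) auto
  then obtain x where "x \<in> A" "f x = Max (f ` A)" by auto
  then show ?thesis using assms by (intro bexI[of _ x]) simp_all
qed

context full_root_lattice
begin

text \<open>Adding a root \<open>r\<close> to \<open>x\<close> changes the squared norm by
  \<open>2 + 2 * (r \<bullet> x)\<close>, an even integer.\<close>

lemma even_norm: "x \<in> L \<Longrightarrow> \<exists>k::int. x \<bullet> x = 2 * real_of_int k"
proof -
  have "set rs \<subseteq> \<Phi> \<Longrightarrow> sum_list rs \<in> L \<and> (\<exists>k::int. sum_list rs \<bullet> sum_list rs = 2 * real_of_int k)" for rs
  proof (induction rs)
    case Nil then show ?case using zero_in by (auto intro: exI[of _ 0])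
  next
    case (Cons r rs)
    then obtain k :: int where k: "sum_list rs \<bullet> sum_list rs = 2 * real_of_int k" and L: "sum_list rs \<in> L" by auto
    have r: "r \<in> \<Phi>" using Cons by simp
    obtain l where l: "r \<bullet> sum_list rs = real_of_int l" using integral[OF root_in[OF r] L] by (auto elim: Ints_cases)
    have "sum_list (r # rs) \<bullet> sum_list (r # rs) = 2 * real_of_int (1 + l + k)"
      using k l root_norm[OF r] by (simp add: inner_add_left inner_add_right inner_commute[of "sum_list rs" r])
    then show ?case using add_in[OF root_in[OF r] L] by (metis sum_list.Cons)
  qed
  then show "x \<in> L \<Longrightarrow> \<exists>k::int. x \<bullet> x = 2 * real_of_int k" using sum_list_roots by blast
qed

lemma norm_ge_2: "x \<in> L \<Longrightarrow> x \<noteq> 0 \<Longrightarrow> 2 \<le> x \<bullet> x"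
proof -
  assume x: "x \<in> L" "x \<noteq> 0"
  obtain k :: int where k: "x \<bullet> x = 2 * real_of_int k" using even_norm x by blast
  have "0 < x \<bullet> x" using x by simp
  then have "1 \<le> k" using k by simp
  then show ?thesis using k by simp
qed

lemma isometry_holes:
  assumes T: "linear T" "\<And>v. norm (T v) = norm v" "bij_betw T L L" and c: "c \<in> holes"
  shows "T c \<in> holes"
proof -
  have "norm (T c) \<le> norm (x - T c)" if "x \<in> L" for x
  proof -
    obtain y where y: "y \<in> L" "x = T y" using bij_betw_imp_surj_on[OF T(3)] \<open>x \<in> L\<close> by blast
    then have "x - T c = T (y - c)" using T(1) by (simp add: linear_diff)
    then show ?thesis using c y T(2) by (simp add: holes_def P_iff)
  qed
  then have "T c \<in> P" by (simp add: P_iff)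
  then show ?thesis using c T(2) by (simp add: holes_def)
qed

end

section \<open>Positive and simple roots of a generic vector\<close>

locale generic_root_lattice = full_root_lattice +
  fixes \<rho> assumes generic: "r \<in> \<Phi> \<Longrightarrow> r \<bullet> \<rho> \<noteq> 0"
begin

definition Pos where "Pos = {r \<in> \<Phi>. 0 < r \<bullet> \<rho>}"

definition \<Delta> where "\<Delta> = {r \<in> Pos. \<forall>s\<in>Pos. \<forall>t\<in>Pos. r \<noteq> s + t}"

lemma Pos_root: "r \<in> Pos \<Longrightarrow> r \<in> \<Phi>" and Pos_pos: "r \<in> Pos \<Longrightarrow> 0 < r \<bullet> \<rho>"
  and finite_Pos: "finite Pos" and simple_Pos: "\<alpha> \<in> \<Delta> \<Longrightarrow> \<alpha> \<in> Pos" and finite_\<Delta>: "finite \<Delta>"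
  using finite_roots by (auto simp: Pos_def \<Delta>_def)

lemma root_cases: "r \<in> \<Phi> \<Longrightarrow> r \<in> Pos \<or> - r \<in> Pos"
  using generic[of r] root_uminus[of r] by (auto simp: Pos_def)

lemma uminus_Pos: "r \<in> Pos \<Longrightarrow> - r \<notin> Pos"
  by (auto simp: Pos_def)

text \<open>A decomposable positive root splits into two of smaller height
  \<open>r \<bullet> \<rho>\<close>. The height is real, so the induction counts the positive roots
  below.\<close>

lemma Pos_combination: "r \<in> Pos \<Longrightarrow> \<exists>n::'a \<Rightarrow> nat. r = (\<Sum>\<alpha>\<in>\<Delta>. real (n \<alpha>) *\<^sub>R \<alpha>)"
proof (induction "card {s \<in> Pos. s \<bullet> \<rho> < r \<bullet> \<rho>}" arbitrary: r rule: less_induct)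
  case less
  show ?case
  proof (cases "r \<in> \<Delta>")
    case True
    have "r = (\<Sum>\<alpha>\<in>\<Delta>. real (if \<alpha> = r then 1 else 0) *\<^sub>R \<alpha>)"
      using True finite_\<Delta> by (simp add: if_distrib[of "\<lambda>x. x *\<^sub>R _"] if_distrib[of real] cong: if_cong)
    then show ?thesis by (intro exI[of _ "\<lambda>\<alpha>. if \<alpha> = r then 1 else 0"])
  next
    case False
    then obtain s t where st: "s \<in> Pos" "t \<in> Pos" "r = s + t" using less.prems by (auto simp: \<Delta>_def)
    have dec: "\<exists>n::'a \<Rightarrow> nat. u = (\<Sum>\<alpha>\<in>\<Delta>. real (n \<alpha>) *\<^sub>R \<alpha>)" if u: "u \<in> Pos" "u \<bullet> \<rho> < r \<bullet> \<rho>" for u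
    proof (rule less.hyps[OF _ u(1)])
      have "u \<in> {s \<in> Pos. s \<bullet> \<rho> < r \<bullet> \<rho>} - {s \<in> Pos. s \<bullet> \<rho> < u \<bullet> \<rho>}" using u by simp
      moreover have "{s \<in> Pos. s \<bullet> \<rho> < u \<bullet> \<rho>} \<subseteq> {s \<in> Pos. s \<bullet> \<rho> < r \<bullet> \<rho>}" using u by auto
      ultimately have "{s \<in> Pos. s \<bullet> \<rho> < u \<bullet> \<rho>} \<subset> {s \<in> Pos. s \<bullet> \<rho> < r \<bullet> \<rho>}" by blast
      then show "card {s \<in> Pos. s \<bullet> \<rho> < u \<bullet> \<rho>} < card {s \<in> Pos. s \<bullet> \<rho> < r \<bullet> \<rho>}"
        using finite_Pos by (intro psubset_card_mono) auto
    qed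
    have "s \<bullet> \<rho> < r \<bullet> \<rho>" "t \<bullet> \<rho> < r \<bullet> \<rho>" using st Pos_pos[of s] Pos_pos[of t] by (auto simp: inner_add_left)
    then obtain n k :: "'a \<Rightarrow> nat" where "s = (\<Sum>\<alpha>\<in>\<Delta>. real (n \<alpha>) *\<^sub>R \<alpha>)" "t = (\<Sum>\<alpha>\<in>\<Delta>. real (k \<alpha>) *\<^sub>R \<alpha>)"
      using dec st by metis
    then have "r = (\<Sum>\<alpha>\<in>\<Delta>. real (n \<alpha> + k \<alpha>) *\<^sub>R \<alpha>)" using st by (simp add: sum.distrib scaleR_add_left)
    then show ?thesis by (intro exI[of _ "\<lambda>\<alpha>. n \<alpha> + k \<alpha>"])
  qed
qed

text \<open>An inner product 1 would make the difference a root, and one of the two simple roots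
  would be the other plus a positive root.\<close>

lemma simple_inner:
  assumes "\<alpha> \<in> \<Delta>" "\<beta> \<in> \<Delta>" "\<alpha> \<noteq> \<beta>"
  shows "\<alpha> \<bullet> \<beta> = 0 \<or> \<alpha> \<bullet> \<beta> = -1"
proof -
  have r: "\<alpha> \<in> Pos" "\<beta> \<in> Pos" "\<alpha> \<in> \<Phi>" "\<beta> \<in> \<Phi>" using assms simple_Pos Pos_root by auto
  have "\<alpha> \<noteq> - \<beta>" using uminus_Pos[of \<beta>] r by auto
  moreover have "\<alpha> \<bullet> \<beta> \<noteq> 1"
  proof
    assume "\<alpha> \<bullet> \<beta> = 1"
    then have "\<alpha> - \<beta> \<in> \<Phi>" using root_diff r by blast
    then consider "\<alpha> - \<beta> \<in> Pos" | "\<beta> - \<alpha> \<in> Pos" using root_cases[of "\<alpha> - \<beta>"] by auto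
    then show False
    proof cases
      case 1
      then have "\<alpha> \<noteq> \<beta> + (\<alpha> - \<beta>)" using assms(1) r(2) unfolding \<Delta>_def by blast
      then show False by simp
    next
      case 2
      then have "\<beta> \<noteq> \<alpha> + (\<beta> - \<alpha>)" using assms(2) r(1) unfolding \<Delta>_def by blast
      then show False by simp
    qed
  qed
  ultimately show ?thesis using root_inner_cases[OF r(3,4)] assms(3) by auto
qed

lemma simple_inner_le: "\<alpha> \<in> \<Delta> \<Longrightarrow> \<beta> \<in> \<Delta> \<Longrightarrow> \<alpha> \<noteq> \<beta> \<Longrightarrow> \<alpha> \<bullet> \<beta> \<le> 0"
  using simple_inner by fastforce

text \<open>Separate a relation by the sign of its coefficients into two equal vectors. Their inner
  product is nonpositive as distinct simple roots make nonacute angles, so both vanish; pairing with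
  \<open>\<rho>\<close>, which is positive on simple roots, makes every coefficient zero.\<close>

lemma independent_\<Delta>: "independent \<Delta>"
proof
  assume "dependent \<Delta>"
  then obtain u where u: "\<exists>v\<in>\<Delta>. u v \<noteq> 0" "(\<Sum>v\<in>\<Delta>. u v *\<^sub>R v) = 0"
    using dependent_finite[OF finite_\<Delta>] by auto
  define A where "A = {v \<in> \<Delta>. 0 < u v}"
  define B where "B = \<Delta> - A"
  have A: "A \<subseteq> \<Delta>" "finite A" and B: "B \<subseteq> \<Delta>" "finite B" using finite_\<Delta> by (auto simp: A_def B_def)
  define z where "z = (\<Sum>v\<in>A. u v *\<^sub>R v)"
  have "(\<Sum>v\<in>\<Delta>. u v *\<^sub>R v) = z + (\<Sum>v\<in>B. u v *\<^sub>R v)"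
    unfolding z_def B_def using sum.subset_diff[OF A(1) finite_\<Delta>] by (simp add: add.commute)
  then have zB: "z = (\<Sum>v\<in>B. (- u v) *\<^sub>R v)" using u by (simp add: sum_negf eq_neg_iff_add_eq_0)
  have "z \<bullet> z = (\<Sum>v\<in>A. \<Sum>w\<in>B. (u v *\<^sub>R v) \<bullet> ((- u w) *\<^sub>R w))"
  proof -
    have "z \<bullet> z = z \<bullet> (\<Sum>w\<in>B. (- u w) *\<^sub>R w)" by (subst (2) zB) (rule refl)
    also have "\<dots> = (\<Sum>v\<in>A. (u v *\<^sub>R v) \<bullet> (\<Sum>w\<in>B. (- u w) *\<^sub>R w))" unfolding z_def by (rule inner_sum_left)
    finally show ?thesis by (simp only: inner_sum_right)
  qed
  also have "\<dots> \<le> 0"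
  proof (intro sum_nonpos)
    fix v w assume vw: "v \<in> A" "w \<in> B"
    then have "v \<bullet> w \<le> 0" using simple_inner_le[of v w] by (auto simp: A_def B_def)
    moreover have "0 \<le> u v * (- u w)" using vw by (intro mult_nonneg_nonneg) (auto simp: A_def B_def)
    ultimately have "(u v * (- u w)) * (v \<bullet> w) \<le> 0" by (rule mult_nonneg_nonpos[rotated])
    then show "(u v *\<^sub>R v) \<bullet> ((- u w) *\<^sub>R w) \<le> 0" by (simp add: mult_ac)
  qed
  finally have "z = 0" by (metis inner_eq_zero_iff inner_ge_zero order_antisym)
  have pos: "0 < v \<bullet> \<rho>" if "v \<in> \<Delta>" for v using that simple_Pos Pos_pos by blast
  have "A = {}"
  proof (rule ccontr)
    assume "A \<noteq> {}"
    then have "0 < (\<Sum>v\<in>A. u v * (v \<bullet> \<rho>))" using A pos by (intro sum_pos) (auto simp: A_def)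
    also have "\<dots> = z \<bullet> \<rho>" by (simp add: z_def inner_sum_left)
    finally show False using \<open>z = 0\<close> by simp
  qed
  moreover have "\<forall>v\<in>B. (- u v) * (v \<bullet> \<rho>) = 0"
  proof -
    have "(\<Sum>v\<in>B. (- u v) * (v \<bullet> \<rho>)) = z \<bullet> \<rho>" by (subst zB) (simp add: inner_sum_left sum_negf)
    also have "\<dots> = 0" using \<open>z = 0\<close> by simp
    finally have sum: "(\<Sum>v\<in>B. (- u v) * (v \<bullet> \<rho>)) = 0" .
    have "0 \<le> (- u v) * (v \<bullet> \<rho>)" if "v \<in> B" for v
      using that B pos[of v] by (intro mult_nonneg_nonneg) (auto simp: A_def B_def)
    with sum show ?thesis using sum_nonneg_eq_0_iff[OF B(2), of "\<lambda>v. (- u v) * (v \<bullet> \<rho>)"] by blast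
  qed
  ultimately have "u v = 0" if "v \<in> \<Delta>" for v using that pos[OF that] by (auto simp: B_def)
  then show False using u by blast
qed

lemma span_\<Delta>: "span \<Delta> = UNIV"
proof -
  have P: "r \<in> span \<Delta>" if r: "r \<in> Pos" for r
  proof -
    obtain n :: "'a \<Rightarrow> nat" where n: "r = (\<Sum>\<alpha>\<in>\<Delta>. real (n \<alpha>) *\<^sub>R \<alpha>)" using Pos_combination[OF r] by blast
    show ?thesis unfolding n by (intro span_sum span_scale span_base)
  qed
  have "r \<in> span \<Delta>" if "r \<in> \<Phi>" for r
    using root_cases[OF that] P[of r] P[of "- r"] span_neg[of "- r" \<Delta>] by auto
  then have "span \<Phi> \<subseteq> span \<Delta>" by (intro span_minimal) auto
  then show ?thesis using span_roots by auto
qed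

lemma orthogonal_\<Delta>_zero: "(\<And>\<alpha>. \<alpha> \<in> \<Delta> \<Longrightarrow> x \<bullet> \<alpha> = 0) \<Longrightarrow> x = 0"
proof -
  assume "\<And>\<alpha>. \<alpha> \<in> \<Delta> \<Longrightarrow> x \<bullet> \<alpha> = 0"
  then have "orthogonal x y" if "y \<in> span \<Delta>" for y
    using that by (intro orthogonal_to_span[of y \<Delta> x]) (auto simp: orthogonal_def)
  then show ?thesis using span_\<Delta> by (metis UNIV_I orthogonal_self)
qed

section \<open>Fundamental weights and coordinates\<close>

text \<open>The fundamental weights, dual to the simple roots. For \<open>\<alpha>\<close> outside
  \<open>\<Delta>\<close> all prescribed pairings are 0, so the value is the zero vector.\<close>

definition \<omega> where "\<omega> \<alpha> = (SOME w. \<forall>\<beta>\<in>\<Delta>. w \<bullet> \<beta> = (if \<beta> = \<alpha> then 1 else 0))"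

lemma \<omega>_inner: "\<beta> \<in> \<Delta> \<Longrightarrow> \<omega> \<alpha> \<bullet> \<beta> = (if \<beta> = \<alpha> then 1 else 0)"
proof -
  obtain g :: "'a \<Rightarrow> real" where g: "linear g" "\<forall>\<beta>\<in>\<Delta>. g \<beta> = (if \<beta> = \<alpha> then 1 else 0)"
    using linear_independent_extend[OF independent_\<Delta>, of "\<lambda>\<beta>. if \<beta> = \<alpha> then 1 else 0"] by blast
  \<comment> \<open>\<open>g\<close> is a linear functional, and \<open>adjoint g 1\<close> is the
    vector representing it.\<close>
  have "\<forall>\<beta>\<in>\<Delta>. adjoint g 1 \<bullet> \<beta> = (if \<beta> = \<alpha> then 1 else 0)"
    using g adjoint_works[OF g(1), of _ 1] by (simp add: inner_commute)
  then have "\<forall>\<beta>\<in>\<Delta>. \<omega> \<alpha> \<bullet> \<beta> = (if \<beta> = \<alpha> then 1 else 0)"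
    unfolding \<omega>_def by (rule someI)
  then show "\<beta> \<in> \<Delta> \<Longrightarrow> \<omega> \<alpha> \<bullet> \<beta> = (if \<beta> = \<alpha> then 1 else 0)" by blast
qed

lemma inner_\<omega>: "\<beta> \<in> \<Delta> \<Longrightarrow> \<beta> \<bullet> \<omega> \<alpha> = (if \<beta> = \<alpha> then 1 else 0)"
  using \<omega>_inner by (simp add: inner_commute)

lemma dual_expansion: "x = (\<Sum>\<alpha>\<in>\<Delta>. (x \<bullet> \<alpha>) *\<^sub>R \<omega> \<alpha>)"
proof -
  have "x - (\<Sum>\<alpha>\<in>\<Delta>. (x \<bullet> \<alpha>) *\<^sub>R \<omega> \<alpha>) = 0"
    using finite_\<Delta> by (intro orthogonal_\<Delta>_zero)
      (simp add: inner_diff_left inner_sum_left \<omega>_inner if_distrib[of "\<lambda>y. _ * y"] cong: if_cong)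
  then show ?thesis by simp
qed

lemma sum_inner_\<omega>: "X \<subseteq> \<Delta> \<Longrightarrow> (\<Sum>\<alpha>\<in>X. f \<alpha> *\<^sub>R \<alpha>) \<bullet> \<omega> \<beta> = (if \<beta> \<in> X then f \<beta> else 0)"
proof -
  assume X: "X \<subseteq> \<Delta>"
  have "(\<Sum>\<alpha>\<in>X. f \<alpha> *\<^sub>R \<alpha>) \<bullet> \<omega> \<beta> = (\<Sum>\<alpha>\<in>X. if \<alpha> = \<beta> then f \<alpha> else 0)"
    unfolding inner_sum_left using X by (intro sum.cong) (auto simp: inner_\<omega>)
  moreover have "finite X" using X finite_\<Delta> finite_subset by blast
  ultimately show ?thesis by simp
qed

lemma expansion: "x = (\<Sum>\<alpha>\<in>\<Delta>. (x \<bullet> \<omega> \<alpha>) *\<^sub>R \<alpha>)"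
proof -
  define y where "y = x - (\<Sum>\<alpha>\<in>\<Delta>. (x \<bullet> \<omega> \<alpha>) *\<^sub>R \<alpha>)"
  have y: "y \<bullet> \<omega> \<beta> = 0" if "\<beta> \<in> \<Delta>" for \<beta>
    using that by (simp add: y_def inner_diff_left sum_inner_\<omega>)
  have "y \<bullet> y = y \<bullet> (\<Sum>\<alpha>\<in>\<Delta>. (y \<bullet> \<alpha>) *\<^sub>R \<omega> \<alpha>)" using dual_expansion[of y] by simp
  also have "\<dots> = 0" unfolding inner_sum_right by (intro sum.neutral) (simp add: y)
  finally show ?thesis by (simp add: y_def)
qed

lemma expansion_inner: "x \<bullet> y = (\<Sum>\<alpha>\<in>\<Delta>. (x \<bullet> \<omega> \<alpha>) * (\<alpha> \<bullet> y))"
  by (subst expansion[of x]) (simp add: inner_sum_left)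

lemma coeff_Pos: "r \<in> Pos \<Longrightarrow> \<exists>n::nat. r \<bullet> \<omega> \<alpha> = real n"
proof -
  assume "r \<in> Pos"
  then obtain n :: "'a \<Rightarrow> nat" where n: "r = (\<Sum>\<alpha>\<in>\<Delta>. real (n \<alpha>) *\<^sub>R \<alpha>)" using Pos_combination by blast
  have "r \<bullet> \<omega> \<alpha> = (if \<alpha> \<in> \<Delta> then real (n \<alpha>) else 0)" unfolding n by (rule sum_inner_\<omega>) simp
  then show ?thesis by (intro exI[of _ "if \<alpha> \<in> \<Delta> then n \<alpha> else 0"]) simp
qed

lemma coeff_nonneg: "r \<in> Pos \<Longrightarrow> 0 \<le> r \<bullet> \<omega> \<alpha>"
  using coeff_Pos[of r \<alpha>] by auto

lemma coeff_L: "x \<in> L \<Longrightarrow> x \<bullet> \<omega> \<alpha> \<in> \<int>"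
proof -
  have Pos: "r \<bullet> \<omega> \<alpha> \<in> \<int>" if "r \<in> Pos" for r using coeff_Pos[OF that, of \<alpha>] by auto
  have "r \<bullet> \<omega> \<alpha> \<in> \<int>" if "r \<in> \<Phi>" for r
    using root_cases[OF that] Pos[of r] Pos[of "- r"] by auto
  then have "set rs \<subseteq> \<Phi> \<Longrightarrow> sum_list rs \<bullet> \<omega> \<alpha> \<in> \<int>" for rs
    by (induction rs) (auto simp: inner_add_left)
  then show "x \<in> L \<Longrightarrow> x \<bullet> \<omega> \<alpha> \<in> \<int>" using sum_list_roots by blast
qed

section \<open>Dominant roots and irreducible components\<close>

text \<open>The dominant roots turn out to be the highest roots of the irreducible components. Their
  supports are connected, mutually orthogonal and cover \<open>\<Delta>\<close>, so they serve as
  the components themselves.\<close>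

definition \<Theta> where "\<Theta> = {\<theta> \<in> Pos. \<forall>\<alpha>\<in>\<Delta>. 0 \<le> \<theta> \<bullet> \<alpha>}"

definition supp where "supp \<theta> = {\<alpha> \<in> \<Delta>. 0 < \<theta> \<bullet> \<omega> \<alpha>}"

lemma supp_subset: "supp \<theta> \<subseteq> \<Delta>" and finite_supp: "finite (supp \<theta>)"
  using finite_\<Delta> by (auto simp: supp_def)

lemma \<Theta>_Pos: "\<theta> \<in> \<Theta> \<Longrightarrow> \<theta> \<in> Pos" and \<Theta>_dom: "\<theta> \<in> \<Theta> \<Longrightarrow> \<alpha> \<in> \<Delta> \<Longrightarrow> 0 \<le> \<theta> \<bullet> \<alpha>"
  by (auto simp: \<Theta>_def)

lemma \<Theta>_Pos_inner: "\<theta> \<in> \<Theta> \<Longrightarrow> r \<in> Pos \<Longrightarrow> 0 \<le> r \<bullet> \<theta>"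
  unfolding expansion_inner[of r \<theta>]
  by (intro sum_nonneg mult_nonneg_nonneg coeff_nonneg) (auto simp: inner_commute[of _ \<theta>] \<Theta>_dom)

lemma supp_sum: "\<theta> \<in> \<Theta> \<Longrightarrow> (\<Sum>\<alpha>\<in>supp \<theta>. (\<theta> \<bullet> \<omega> \<alpha>) *\<^sub>R \<alpha>) = \<theta>"
proof -
  assume t: "\<theta> \<in> \<Theta>"
  have "\<theta> \<bullet> \<omega> \<alpha> = 0" if "\<alpha> \<in> \<Delta> - supp \<theta>" for \<alpha>
    using that coeff_nonneg[OF \<Theta>_Pos[OF t], of \<alpha>] by (auto simp: supp_def)
  then have "(\<Sum>\<alpha>\<in>supp \<theta>. (\<theta> \<bullet> \<omega> \<alpha>) *\<^sub>R \<alpha>) = (\<Sum>\<alpha>\<in>\<Delta>. (\<theta> \<bullet> \<omega> \<alpha>) *\<^sub>R \<alpha>)"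
    by (intro sum.mono_neutral_left finite_\<Delta> supp_subset) auto
  also have "\<dots> = \<theta>" by (rule expansion[symmetric])
  finally show ?thesis .
qed

lemma supp_expansion: "\<theta> \<in> \<Theta> \<Longrightarrow> \<theta> \<bullet> y = (\<Sum>\<alpha>\<in>supp \<theta>. (\<theta> \<bullet> \<omega> \<alpha>) * (\<alpha> \<bullet> y))"
  using supp_sum[of \<theta>] inner_sum_left[of "\<lambda>\<alpha>. (\<theta> \<bullet> \<omega> \<alpha>) *\<^sub>R \<alpha>" "supp \<theta>" y] by simp

text \<open>Take a root of greatest height among those coefficientwise above \<open>r\<close>. A
  negative inner product with a simple root would allow adding that root.\<close>

lemma below_dominant:
  assumes r: "r \<in> Pos"
  obtains \<theta> where "\<theta> \<in> \<Theta>" "\<And>\<alpha>. \<alpha> \<in> \<Delta> \<Longrightarrow> r \<bullet> \<omega> \<alpha> \<le> \<theta> \<bullet> \<omega> \<alpha>"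
proof -
  define A where "A = {s \<in> Pos. \<forall>\<alpha>\<in>\<Delta>. r \<bullet> \<omega> \<alpha> \<le> s \<bullet> \<omega> \<alpha>}"
  have "finite A" "A \<noteq> {}" using finite_Pos r by (auto simp: A_def)
  then obtain \<theta> where \<theta>: "\<theta> \<in> A" "\<And>s. s \<in> A \<Longrightarrow> s \<bullet> \<rho> \<le> \<theta> \<bullet> \<rho>"
    using finite_maximizer[of A "\<lambda>s. s \<bullet> \<rho>"] by blast
  have "0 \<le> \<theta> \<bullet> \<alpha>" if a: "\<alpha> \<in> \<Delta>" for \<alpha>
  proof (rule ccontr)
    assume neg: "\<not> 0 \<le> \<theta> \<bullet> \<alpha>"
    have p: "\<theta> \<in> Pos" "\<alpha> \<in> Pos" using \<theta> a simple_Pos by (auto simp: A_def)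
    then have R: "\<theta> \<in> \<Phi>" "\<alpha> \<in> \<Phi>" using Pos_root by auto
    have "\<theta> \<noteq> - \<alpha>" using uminus_Pos[of \<alpha>] p by auto
    moreover have "\<theta> \<noteq> \<alpha>" using neg root_norm[OF R(2)] by auto
    ultimately have "\<theta> \<bullet> \<alpha> = -1" using root_inner_cases[OF R] neg by auto
    then have "\<theta> + \<alpha> \<in> \<Phi>" using root_add R by blast
    moreover have "0 < (\<theta> + \<alpha>) \<bullet> \<rho>" using Pos_pos p by (simp add: inner_add_left add_pos_pos)
    ultimately have "\<theta> + \<alpha> \<in> Pos" by (simp add: Pos_def)
    moreover have "r \<bullet> \<omega> \<beta> \<le> (\<theta> + \<alpha>) \<bullet> \<omega> \<beta>" if "\<beta> \<in> \<Delta>" for \<beta>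
      using \<theta>(1) coeff_nonneg[OF p(2), of \<beta>] that by (force simp: A_def inner_add_left)
    ultimately have "\<theta> + \<alpha> \<in> A" by (simp add: A_def)
    then show False using \<theta>(2)[of "\<theta> + \<alpha>"] Pos_pos[OF p(2)] by (simp add: inner_add_left)
  qed
  then show ?thesis using that \<theta>(1) by (auto simp: \<Theta>_def A_def)
qed

text \<open>Dominance gives \<open>\<theta> \<bullet> \<beta> >= 0\<close>, but expanding
  \<open>\<theta>\<close> over its support gives only nonpositive terms. So all of them
  vanish.\<close>

lemma supp_orthogonal:
  assumes t: "\<theta> \<in> \<Theta>" and a: "\<alpha> \<in> supp \<theta>" and b: "\<beta> \<in> \<Delta>" "\<beta> \<notin> supp \<theta>"
  shows "\<alpha> \<bullet> \<beta> = 0"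
proof -
  have nonpos: "(\<theta> \<bullet> \<omega> \<gamma>) * (\<gamma> \<bullet> \<beta>) \<le> 0" if "\<gamma> \<in> supp \<theta>" for \<gamma>
    using that b simple_inner_le[of \<gamma> \<beta>] by (intro mult_nonneg_nonpos) (auto simp: supp_def)
  have "0 \<le> \<theta> \<bullet> \<beta>" using \<Theta>_dom t b by blast
  then have "(\<Sum>\<gamma>\<in>supp \<theta>. - ((\<theta> \<bullet> \<omega> \<gamma>) * (\<gamma> \<bullet> \<beta>))) \<le> 0"
    using supp_expansion[OF t, of \<beta>] by (simp add: sum_negf)
  moreover have "0 \<le> (\<Sum>\<gamma>\<in>supp \<theta>. - ((\<theta> \<bullet> \<omega> \<gamma>) * (\<gamma> \<bullet> \<beta>)))" using nonpos by (intro sum_nonneg) auto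
  ultimately have "(\<Sum>\<gamma>\<in>supp \<theta>. - ((\<theta> \<bullet> \<omega> \<gamma>) * (\<gamma> \<bullet> \<beta>))) = 0" by simp
  then have "\<forall>\<gamma>\<in>supp \<theta>. - ((\<theta> \<bullet> \<omega> \<gamma>) * (\<gamma> \<bullet> \<beta>)) = 0"
    using finite_supp nonpos by (subst (asm) sum_nonneg_eq_0_iff) auto
  then show ?thesis using a by (auto simp: supp_def)
qed

text \<open>A splitting would write \<open>\<theta>\<close> as a sum of two orthogonal nonzero
  lattice vectors. Each has squared norm at least 2, but their sum has squared norm 2.\<close>

lemma supp_connected:
  assumes t: "\<theta> \<in> \<Theta>" and X: "X \<subseteq> supp \<theta>" "X \<noteq> {}"
    and orth: "\<And>x y. x \<in> X \<Longrightarrow> y \<in> supp \<theta> - X \<Longrightarrow> x \<bullet> y = 0"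
  shows "X = supp \<theta>"
proof (rule ccontr)
  assume ne: "X \<noteq> supp \<theta>"
  define u where "u = (\<Sum>\<alpha>\<in>X. (\<theta> \<bullet> \<omega> \<alpha>) *\<^sub>R \<alpha>)"
  define v where "v = (\<Sum>\<alpha>\<in>supp \<theta> - X. (\<theta> \<bullet> \<omega> \<alpha>) *\<^sub>R \<alpha>)"
  have XD: "X \<subseteq> \<Delta>" "supp \<theta> - X \<subseteq> \<Delta>" using X supp_subset by auto
  have sub: "(\<Sum>\<alpha>\<in>Y. (\<theta> \<bullet> \<omega> \<alpha>) *\<^sub>R \<alpha>) \<in> L" if "Y \<subseteq> \<Delta>" for Y
  proof -
    have "finite Y" using that finite_\<Delta> finite_subset by blast
    then show ?thesis using that
    proof induction
      case (insert y Y)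
      have "\<theta> \<in> L" using t \<Theta>_Pos Pos_root root_in by blast
      then have "\<theta> \<bullet> \<omega> y \<in> \<int>" by (rule coeff_L)
      then obtain k where k: "\<theta> \<bullet> \<omega> y = real_of_int k" by (rule Ints_cases)
      have "y \<in> L" using insert simple_Pos Pos_root root_in by blast
      then have "(\<theta> \<bullet> \<omega> y) *\<^sub>R y \<in> L" unfolding k by (rule int_scale_in)
      then show ?case using insert add_in by simp
    qed (simp add: zero_in)
  qed
  have "\<theta> = (\<Sum>\<alpha>\<in>supp \<theta>. (\<theta> \<bullet> \<omega> \<alpha>) *\<^sub>R \<alpha>)"
    by (rule supp_sum[OF t, symmetric])
  also have "\<dots> = u + v" unfolding u_def v_def using sum.subset_diff[OF X(1) finite_supp] by (simp add: add.commute)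
  finally have \<theta>: "\<theta> = u + v" .
  have "u \<bullet> v = 0" unfolding u_def v_def inner_sum_left inner_sum_right
    by (intro sum.neutral ballI) (simp add: orth)
  then have "u \<bullet> u + v \<bullet> v = \<theta> \<bullet> \<theta>" unfolding \<theta> by (simp add: inner_add_left inner_add_right inner_commute)
  also have "\<dots> = 2" using t \<Theta>_Pos Pos_root root_norm by blast
  finally have sum: "u \<bullet> u + v \<bullet> v = 2" .
  obtain x y where xy: "x \<in> X" "y \<in> supp \<theta> - X" using X ne by blast
  have "u \<bullet> \<omega> x \<noteq> 0" "v \<bullet> \<omega> y \<noteq> 0"
    unfolding u_def v_def sum_inner_\<omega>[OF XD(1)] sum_inner_\<omega>[OF XD(2)] using xy X by (auto simp: supp_def)
  then have "u \<noteq> 0" "v \<noteq> 0" by auto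
  then show False using norm_ge_2[of u] norm_ge_2[of v] sub[OF XD(1)] sub[OF XD(2)] sum
    by (simp add: u_def[symmetric] v_def[symmetric])
qed

text \<open>A common element makes the supports equal, by connectedness and orthogonality to the
  outside, and dominance then gives a positive inner product. It is not 1: otherwise the difference
  or its negative would be a positive root having inner product -1 with a dominant root.\<close>

lemma supp_disjoint:
  assumes t: "\<theta> \<in> \<Theta>" "\<theta>' \<in> \<Theta>" and a: "\<alpha> \<in> supp \<theta>" "\<alpha> \<in> supp \<theta>'"
  shows "\<theta> = \<theta>'"
proof -
  have "supp \<theta> \<inter> supp \<theta>' = supp \<theta>" "supp \<theta> \<inter> supp \<theta>' = supp \<theta>'"
    using t a supp_orthogonal supp_subset by (intro supp_connected; blast)+
  then have eq: "supp \<theta> = supp \<theta>'" by simp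
  have R: "\<theta> \<in> Pos" "\<theta>' \<in> Pos" "\<theta> \<in> \<Phi>" "\<theta>' \<in> \<Phi>" using t \<Theta>_Pos Pos_root by auto
  have "\<theta> \<bullet> \<theta>' \<noteq> 0"
  proof
    assume 0: "\<theta> \<bullet> \<theta>' = 0"
    have terms: "0 \<le> (\<theta> \<bullet> \<omega> \<gamma>) * (\<gamma> \<bullet> \<theta>')" if "\<gamma> \<in> supp \<theta>" for \<gamma>
      using that \<Theta>_dom[OF t(2), of \<gamma>] by (intro mult_nonneg_nonneg) (auto simp: supp_def inner_commute[of \<theta>'])
    have "\<forall>\<gamma>\<in>supp \<theta>. (\<theta> \<bullet> \<omega> \<gamma>) * (\<gamma> \<bullet> \<theta>') = 0"
      using 0 terms finite_supp unfolding supp_expansion[OF t(1), of \<theta>'] by (subst (asm) sum_nonneg_eq_0_iff) auto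
    then have "\<forall>\<gamma>\<in>supp \<theta>'. \<gamma> \<bullet> \<theta>' = 0" unfolding eq[symmetric] by (auto simp: supp_def)
    then have "\<theta>' \<bullet> \<theta>' = 0" unfolding supp_expansion[OF t(2), of \<theta>'] by simp
    then show False using root_norm[OF R(4)] by simp
  qed
  moreover have "0 \<le> \<theta> \<bullet> \<theta>'" using \<Theta>_Pos_inner t(2) R by blast
  moreover have "\<theta> \<noteq> - \<theta>'" using uminus_Pos[of \<theta>'] R by auto
  moreover have "\<theta> \<bullet> \<theta>' \<noteq> 1"
  proof
    assume 1: "\<theta> \<bullet> \<theta>' = 1"
    then have "\<theta> - \<theta>' \<in> \<Phi>" using root_diff R by blast
    then consider "\<theta> - \<theta>' \<in> Pos" | "\<theta>' - \<theta> \<in> Pos" using root_cases[of "\<theta> - \<theta>'"] by auto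
    then show False
    proof cases
      case 1
      then have "0 \<le> (\<theta> - \<theta>') \<bullet> \<theta>'" using \<Theta>_Pos_inner t by blast
      then show False using \<open>\<theta> \<bullet> \<theta>' = 1\<close> root_norm R by (simp add: inner_diff_left)
    next
      case 2
      then have "0 \<le> (\<theta>' - \<theta>) \<bullet> \<theta>" using \<Theta>_Pos_inner t by blast
      then show False using \<open>\<theta> \<bullet> \<theta>' = 1\<close> root_norm R by (simp add: inner_diff_left inner_commute[of \<theta>' \<theta>])
    qed
  qed
  ultimately show ?thesis using root_inner_cases[OF R(3,4)] by auto
qed

lemma supp_cover: "\<alpha> \<in> \<Delta> \<Longrightarrow> \<exists>\<theta>\<in>\<Theta>. \<alpha> \<in> supp \<theta>"
proof -
  assume a: "\<alpha> \<in> \<Delta>"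
  obtain \<theta> where \<theta>: "\<theta> \<in> \<Theta>" "\<And>\<beta>. \<beta> \<in> \<Delta> \<Longrightarrow> \<alpha> \<bullet> \<omega> \<beta> \<le> \<theta> \<bullet> \<omega> \<beta>" using below_dominant[OF simple_Pos[OF a]] by blast
  have "1 \<le> \<theta> \<bullet> \<omega> \<alpha>" using \<theta>(2)[OF a] inner_\<omega>[OF a] by simp
  then show ?thesis using \<theta>(1) a by (auto simp: supp_def intro!: bexI[of _ \<theta>])
qed

text \<open>The part \<open>y\<close> of \<open>\<omega> \<alpha>\<close> outside the component is
  orthogonal to every simple root, hence zero.\<close>

lemma \<omega>_orthogonal:
  assumes t: "\<theta> \<in> \<Theta>" and a: "\<alpha> \<in> supp \<theta>" and b: "\<beta> \<in> \<Delta>" "\<beta> \<notin> supp \<theta>"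
  shows "\<omega> \<alpha> \<bullet> \<omega> \<beta> = 0"
proof -
  define y where "y = (\<Sum>\<gamma>\<in>\<Delta> - supp \<theta>. (\<omega> \<alpha> \<bullet> \<omega> \<gamma>) *\<^sub>R \<gamma>)"
  define x where "x = (\<Sum>\<gamma>\<in>supp \<theta>. (\<omega> \<alpha> \<bullet> \<omega> \<gamma>) *\<^sub>R \<gamma>)"
  have "\<omega> \<alpha> = (\<Sum>\<gamma>\<in>\<Delta>. (\<omega> \<alpha> \<bullet> \<omega> \<gamma>) *\<^sub>R \<gamma>)" by (rule expansion)
  also have "\<dots> = y + x"
    unfolding x_def y_def by (rule sum.subset_diff[OF supp_subset finite_\<Delta>])
  finally have xy: "\<omega> \<alpha> = y + x" .
  have "y = 0"
  proof (rule orthogonal_\<Delta>_zero)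
    fix \<delta> assume d: "\<delta> \<in> \<Delta>"
    show "y \<bullet> \<delta> = 0"
    proof (cases "\<delta> \<in> supp \<theta>")
      case True
      then show ?thesis unfolding y_def inner_sum_left
        using supp_orthogonal[OF t True] by (intro sum.neutral) (auto simp: inner_commute)
    next
      case False
      have "x \<bullet> \<delta> = 0" unfolding x_def inner_sum_left
        using supp_orthogonal[OF t _ d False] by (intro sum.neutral) auto
      moreover have "\<omega> \<alpha> \<bullet> \<delta> = 0" using \<omega>_inner[OF d] False a by auto
      ultimately show ?thesis using xy by (simp add: inner_add_left)
    qed
  qed
  then have "y \<bullet> \<omega> \<beta> = 0" by simp
  then show ?thesis unfolding y_def using sum_inner_\<omega>[of "\<Delta> - supp \<theta>" _ \<beta>] b by simp
qed

lemma \<omega>_span: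
  assumes t: "\<theta> \<in> \<Theta>" and a: "\<alpha> \<in> supp \<theta>"
  shows "\<omega> \<alpha> \<in> span (supp \<theta>)"
proof -
  have "\<omega> \<alpha> = (\<Sum>\<gamma>\<in>\<Delta>. (\<omega> \<alpha> \<bullet> \<omega> \<gamma>) *\<^sub>R \<gamma>)" by (rule expansion)
  also have "\<dots> = (\<Sum>\<gamma>\<in>supp \<theta>. (\<omega> \<alpha> \<bullet> \<omega> \<gamma>) *\<^sub>R \<gamma>)"
    using \<omega>_orthogonal[OF t a] by (intro sum.mono_neutral_right finite_\<Delta> supp_subset) auto
  finally show ?thesis by (metis (no_types, lifting) span_base span_scale span_sum)
qed

lemma \<omega>_nonzero: "\<alpha> \<in> \<Delta> \<Longrightarrow> \<omega> \<alpha> \<noteq> 0"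
  using \<omega>_inner[of \<alpha> \<alpha>] by auto

section \<open>The fundamental alcove and its vertices\<close>

text \<open>Every positive root lies coefficientwise below a dominant one, so on the dominant
  chamber the constraints of the dominant roots imply all others.\<close>

lemma alcove_subset_P:
  assumes "\<And>\<alpha>. \<alpha> \<in> \<Delta> \<Longrightarrow> 0 \<le> \<alpha> \<bullet> z" "\<And>\<theta>. \<theta> \<in> \<Theta> \<Longrightarrow> \<theta> \<bullet> z \<le> 1"
  shows "z \<in> P"
proof -
  have Pos: "0 \<le> r \<bullet> z \<and> r \<bullet> z \<le> 1" if r: "r \<in> Pos" for r
  proof
    show "0 \<le> r \<bullet> z" unfolding expansion_inner[of r z] using assms(1) coeff_nonneg[OF r] by (intro sum_nonneg mult_nonneg_nonneg)
    obtain \<theta> where \<theta>: "\<theta> \<in> \<Theta>" "\<And>\<beta>. \<beta> \<in> \<Delta> \<Longrightarrow> r \<bullet> \<omega> \<beta> \<le> \<theta> \<bullet> \<omega> \<beta>" using below_dominant[OF r] by blast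
    have "r \<bullet> z \<le> \<theta> \<bullet> z" unfolding expansion_inner[of r z] expansion_inner[of \<theta> z]
      using \<theta> assms(1) by (intro sum_mono mult_right_mono)
    then show "r \<bullet> z \<le> 1" using assms(2)[OF \<theta>(1)] by simp
  qed
  have "r \<bullet> z \<le> 1" if "r \<in> \<Phi>" for r using root_cases[OF that] Pos[of r] Pos[of "- r"] by auto
  then show ?thesis by (simp add: P_def)
qed

text \<open>The points \<open>vtx \<theta> j\<close> and the origin are the vertices of the fundamental alcove of the component of \<open>\<theta>\<close>.\<close>

definition vtx where "vtx \<theta> j = \<omega> j /\<^sub>R (\<theta> \<bullet> \<omega> j)"

text \<open>For \<open>\<theta>\<close> in \<open>\<Theta>\<close> this is the orthogonal projection
  of \<open>c\<close> onto the span of the component.\<close>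

definition part where "part \<theta> c = (\<Sum>\<alpha>\<in>supp \<theta>. (\<alpha> \<bullet> c) *\<^sub>R \<omega> \<alpha>)"

lemma inner_part: "\<beta> \<in> \<Delta> \<Longrightarrow> \<beta> \<bullet> part \<theta> c = (if \<beta> \<in> supp \<theta> then \<beta> \<bullet> c else 0)"
proof -
  assume b: "\<beta> \<in> \<Delta>"
  have "\<beta> \<bullet> part \<theta> c = (\<Sum>\<alpha>\<in>supp \<theta>. if \<alpha> = \<beta> then \<alpha> \<bullet> c else 0)"
    unfolding part_def inner_sum_right using b by (intro sum.cong) (auto simp: inner_\<omega>)
  then show ?thesis using finite_supp by simp
qed

lemma inner_vtx: "\<beta> \<in> \<Delta> \<Longrightarrow> \<beta> \<bullet> vtx \<theta> j = (if \<beta> = j then 1 / (\<theta> \<bullet> \<omega> j) else 0)"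
  by (simp add: vtx_def inner_\<omega> divide_inverse)

text \<open>Replacing the component of \<open>c\<close> by any vertex of its alcove stays in
  \<open>P\<close>, so by orthogonality no vertex is longer than the component. But the component is
  a convex combination of the vertices and the origin, and the norm is strictly convex, so it is
  itself a vertex.\<close>

lemma part_eq_vtx:
  assumes c: "c \<in> holes" and dom: "\<And>\<alpha>. \<alpha> \<in> \<Delta> \<Longrightarrow> 0 \<le> \<alpha> \<bullet> c" and t: "\<theta> \<in> \<Theta>"
  obtains i where "i \<in> supp \<theta>" "part \<theta> c = vtx \<theta> i" "\<And>j. j \<in> supp \<theta> \<Longrightarrow> norm (vtx \<theta> j) \<le> norm (vtx \<theta> i)"
proof -
  let ?p = "part \<theta> c"
  define q where "q = c - ?p"
  have qw: "q \<bullet> \<omega> k = 0" if k: "k \<in> supp \<theta>" for k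
  proof -
    have "c = (\<Sum>\<alpha>\<in>\<Delta>. (c \<bullet> \<alpha>) *\<^sub>R \<omega> \<alpha>)" by (rule dual_expansion)
    also have "\<dots> = (\<Sum>\<alpha>\<in>\<Delta> - supp \<theta>. (c \<bullet> \<alpha>) *\<^sub>R \<omega> \<alpha>) + ?p"
      unfolding part_def by (subst sum.subset_diff[OF supp_subset[of \<theta>] finite_\<Delta>]) (simp add: inner_commute)
    finally have "q = (\<Sum>\<alpha>\<in>\<Delta> - supp \<theta>. (c \<bullet> \<alpha>) *\<^sub>R \<omega> \<alpha>)" unfolding q_def by (subst diff_eq_eq)
    then show ?thesis
      using \<omega>_orthogonal[OF t k] by (auto simp: inner_sum_left inner_commute[of "\<omega> _" "\<omega> k"] intro!: sum.neutral)
  qed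
  have M: "0 < \<theta> \<bullet> \<omega> j" if "j \<in> supp \<theta>" for j using that by (simp add: supp_def)
  have le: "norm (vtx \<theta> j) \<le> norm ?p" if j: "j \<in> supp \<theta>" for j
  proof -
    have jD: "j \<in> \<Delta>" using j supp_subset by auto
    have ip: "\<alpha> \<bullet> (q + vtx \<theta> j) = (if \<alpha> \<in> supp \<theta> then \<alpha> \<bullet> vtx \<theta> j else \<alpha> \<bullet> c)" if "\<alpha> \<in> \<Delta>" for \<alpha>
      using that j by (auto simp: q_def inner_add_right inner_diff_right inner_part inner_vtx)
    have "q + vtx \<theta> j \<in> P"
    proof (rule alcove_subset_P)
      show "0 \<le> \<alpha> \<bullet> (q + vtx \<theta> j)" if "\<alpha> \<in> \<Delta>" for \<alpha>
        using ip[OF that] dom[OF that] inner_vtx[OF that, of \<theta> j] M[OF j] by auto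
      show "\<theta>' \<bullet> (q + vtx \<theta> j) \<le> 1" if t': "\<theta>' \<in> \<Theta>" for \<theta>'
      proof (cases "\<theta>' = \<theta>")
        case True
        have "\<theta> \<bullet> (q + vtx \<theta> j) = (\<Sum>\<alpha>\<in>supp \<theta>. if \<alpha> = j then 1 else 0)"
          unfolding supp_expansion[OF t, of "q + vtx \<theta> j"] using M[OF j] ip supp_subset
          by (intro sum.cong) (auto simp: inner_vtx subset_iff)
        then show ?thesis using True finite_supp j by simp
      next
        case False
        have "\<theta>' \<bullet> (q + vtx \<theta> j) = \<theta>' \<bullet> c"
          unfolding supp_expansion[OF t', of "q + vtx \<theta> j"] supp_expansion[OF t', of c] using supp_disjoint[OF t t'] False ip supp_subset
          by (intro sum.cong) (auto simp: subset_iff)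
        also have "\<theta>' \<bullet> c \<le> 1" using c t' \<Theta>_Pos Pos_root by (auto simp: holes_def P_def)
        finally show ?thesis .
      qed
    qed
    then have "norm (q + vtx \<theta> j) \<le> norm (q + ?p)" using c by (simp add: holes_def q_def)
    then have "(q + vtx \<theta> j) \<bullet> (q + vtx \<theta> j) \<le> (q + ?p) \<bullet> (q + ?p)" by (simp add: norm_le)
    moreover have "q \<bullet> vtx \<theta> j = 0" using qw[OF j] by (simp add: vtx_def)
    moreover have "q \<bullet> ?p = 0" unfolding part_def inner_sum_right using qw by (intro sum.neutral) auto
    ultimately show ?thesis by (simp add: inner_add_left inner_add_right inner_commute norm_le)
  qed
  \<comment> \<open>Barycentric coordinates of the component. They sum to
    \<open>\<theta> \<bullet> c\<close>, at most 1, and the missing weight belongs to the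
    origin.\<close>
  define wt where "wt j = (\<theta> \<bullet> \<omega> j) * (j \<bullet> c)" for j
  have l0: "0 \<le> wt j" if "j \<in> supp \<theta>" for j
    unfolding wt_def using M[OF that] dom[of j] that supp_subset[of \<theta>] by (intro mult_nonneg_nonneg) auto
  have l1: "(\<Sum>j\<in>supp \<theta>. wt j) \<le> 1"
  proof -
    have "(\<Sum>j\<in>supp \<theta>. wt j) = \<theta> \<bullet> c" unfolding wt_def supp_expansion[OF t, symmetric] ..
    also have "\<dots> \<le> 1" using c t \<Theta>_Pos Pos_root by (auto simp: holes_def P_def)
    finally show ?thesis .
  qed
  have comb: "?p = (\<Sum>j\<in>supp \<theta>. wt j *\<^sub>R vtx \<theta> j)"
    unfolding part_def wt_def vtx_def using M by (intro sum.cong refl) (auto simp: less_imp_neq[symmetric])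
  \<comment> \<open>If every vertex fell short, averaging with the weights would force all weights
    and hence \<open>?p\<close> to vanish, although the vertices are nonzero and no longer than
    \<open>?p\<close>.\<close>
  have "\<exists>i\<in>supp \<theta>. ?p \<bullet> ?p \<le> vtx \<theta> i \<bullet> ?p"
  proof (rule ccontr)
    assume "\<not> ?thesis"
    then have less: "\<And>j. j \<in> supp \<theta> \<Longrightarrow> 0 < ?p \<bullet> ?p - vtx \<theta> j \<bullet> ?p" by force
    have "(\<Sum>j\<in>supp \<theta>. wt j * (?p \<bullet> ?p - vtx \<theta> j \<bullet> ?p))
        = (\<Sum>j\<in>supp \<theta>. wt j) * (?p \<bullet> ?p) - (\<Sum>j\<in>supp \<theta>. wt j *\<^sub>R vtx \<theta> j) \<bullet> ?p"
      by (simp add: right_diff_distrib sum_subtractf sum_distrib_right inner_sum_left)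
    also have "\<dots> = ((\<Sum>j\<in>supp \<theta>. wt j) - 1) * (?p \<bullet> ?p)" by (simp add: comb[symmetric] left_diff_distrib)
    also have "\<dots> \<le> 0" using l1 by (intro mult_nonpos_nonneg) auto
    finally have "(\<Sum>j\<in>supp \<theta>. wt j * (?p \<bullet> ?p - vtx \<theta> j \<bullet> ?p)) \<le> 0" .
    moreover have "0 \<le> wt j * (?p \<bullet> ?p - vtx \<theta> j \<bullet> ?p)" if "j \<in> supp \<theta>" for j
      using l0[OF that] less[OF that] by (intro mult_nonneg_nonneg) auto
    ultimately have "\<forall>j\<in>supp \<theta>. wt j * (?p \<bullet> ?p - vtx \<theta> j \<bullet> ?p) = 0"
      using finite_supp by (subst sum_nonneg_eq_0_iff[symmetric]) (auto intro!: antisym sum_nonneg)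
    then have "\<forall>j\<in>supp \<theta>. wt j = 0" using less by force
    then have p0: "?p = 0" unfolding comb by simp
    have "\<theta> \<noteq> 0" using Pos_pos[OF \<Theta>_Pos[OF t]] by auto
    moreover have "\<theta> \<bullet> \<theta> = 0" if "supp \<theta> = {}" using supp_expansion[OF t, of \<theta>] that by simp
    ultimately obtain j where j: "j \<in> supp \<theta>" by auto
    have "vtx \<theta> j \<noteq> 0" using M[OF j] \<omega>_nonzero[of j] j supp_subset[of \<theta>] by (auto simp: vtx_def)
    then show False using le[OF j] p0 by simp
  qed
  then obtain i where i: "i \<in> supp \<theta>" "?p \<bullet> ?p \<le> vtx \<theta> i \<bullet> ?p" by blast
  have "vtx \<theta> i \<bullet> vtx \<theta> i \<le> ?p \<bullet> ?p" using le[OF i(1)] by (simp add: norm_le)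
  then have "(?p - vtx \<theta> i) \<bullet> (?p - vtx \<theta> i) \<le> 0"
    using i(2) by (simp add: inner_diff_left inner_diff_right inner_commute)
  then have "?p - vtx \<theta> i = 0" by (metis inner_eq_zero_iff inner_ge_zero order_antisym)
  then have "?p = vtx \<theta> i" by simp
  then show ?thesis using that[OF i(1)] le by simp
qed

section \<open>From diagram symmetries to isometries of the lattice\<close>

text \<open>A simple \<open>\<theta>\<close> is a component of type A1, whose nodes
  \<open>\<theta>\<close> and \<open>- \<theta>\<close> have inner product -2, against
  \<open>inner_cases\<close>. That case is treated in \<open>component_symmetry\<close>, where the
  support is a single node.\<close>

lemma marked_diagram_supp:
  assumes t: "\<theta> \<in> \<Theta>" and nt: "\<theta> \<notin> \<Delta>"
  shows "marked_diagram (supp \<theta>) (- \<theta>) (\<lambda>j. if j = - \<theta> then 1 else nat \<lfloor>\<theta> \<bullet> \<omega> j\<rfloor>)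
    (\<lambda>j. if j = - \<theta> then 0 else vtx \<theta> j)"
proof -
  let ?m = "\<lambda>j. if j = - \<theta> then 1 else nat \<lfloor>\<theta> \<bullet> \<omega> j\<rfloor>"
  have R: "\<theta> \<in> Pos" "\<theta> \<in> \<Phi>" using t \<Theta>_Pos Pos_root by auto
  have S: "\<alpha> \<in> Pos" "\<alpha> \<in> \<Phi>" "\<alpha> \<in> \<Delta>" if "\<alpha> \<in> supp \<theta>" for \<alpha>
    using that supp_subset simple_Pos Pos_root by blast+
  have z: "- \<theta> \<notin> supp \<theta>" using uminus_Pos[OF R(1)] S by blast
  have m: "real (?m j) = \<theta> \<bullet> \<omega> j" if "j \<in> supp \<theta>" for j
  proof -
    obtain n :: nat where "\<theta> \<bullet> \<omega> j = real n" using coeff_Pos[OF R(1)] by blast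
    then show ?thesis using that z by auto
  qed
  have ip\<theta>: "\<theta> \<bullet> \<alpha> = 0 \<or> \<theta> \<bullet> \<alpha> = 1" if "\<alpha> \<in> supp \<theta>" for \<alpha>
  proof -
    have "\<theta> \<noteq> \<alpha>" using S(3)[OF that] nt by auto
    moreover have "\<theta> \<noteq> - \<alpha>" using uminus_Pos[OF S(1)[OF that]] R by auto
    moreover have "0 \<le> \<theta> \<bullet> \<alpha>" using \<Theta>_dom t S that by blast
    ultimately show ?thesis using root_inner_cases[OF R(2) S(2)[OF that]] by auto
  qed
  show ?thesis
  proof unfold_locales
    show "finite (supp \<theta>)" "- \<theta> \<notin> supp \<theta>" using finite_supp z by auto
    show "v \<bullet> v = 2" if "v \<in> insert (- \<theta>) (supp \<theta>)" for v
      using that root_norm[OF R(2)] root_norm[OF S(2)] by auto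
    show "u \<bullet> v = 0 \<or> u \<bullet> v = -1" if "u \<in> insert (- \<theta>) (supp \<theta>)" "v \<in> insert (- \<theta>) (supp \<theta>)" "u \<noteq> v" for u v
    proof -
      have *: "(- \<theta>) \<bullet> \<alpha> = 0 \<or> (- \<theta>) \<bullet> \<alpha> = -1" if "\<alpha> \<in> supp \<theta>" for \<alpha>
        using ip\<theta>[OF that] by auto
      from that consider "u = - \<theta>" "v \<in> supp \<theta>" | "v = - \<theta>" "u \<in> supp \<theta>" | "u \<in> supp \<theta>" "v \<in> supp \<theta>"
        by blast
      then show ?thesis
      proof cases
        case 1 then show ?thesis using * by blast
      next
        case 2 then show ?thesis using *[of u] inner_commute[of u v] by simp
      next
        case 3 then show ?thesis using simple_inner[of u v] S(3) that(3) by blast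
      qed
    qed
    show "0 < ?m v" if v: "v \<in> insert (- \<theta>) (supp \<theta>)" for v
    proof (cases "v = - \<theta>")
      case False
      then have v: "v \<in> supp \<theta>" using v by simp
      then have "0 < real (?m v)" using m[OF v] by (simp add: supp_def)
      then show ?thesis by simp
    qed simp
    show "?m (- \<theta>) = 1" "(if - \<theta> = - \<theta> then 0 else vtx \<theta> (- \<theta>)) = 0" by auto
    have "\<theta> = (\<Sum>\<alpha>\<in>supp \<theta>. (\<theta> \<bullet> \<omega> \<alpha>) *\<^sub>R \<alpha>)"
      by (rule supp_sum[OF t, symmetric])
    also have "\<dots> = (\<Sum>v\<in>supp \<theta>. real (?m v) *\<^sub>R v)" using m by (intro sum.cong refl) metis
    finally show "(\<Sum>v\<in>insert (- \<theta>) (supp \<theta>). real (?m v) *\<^sub>R v) = 0"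
      using finite_supp z by (subst sum.insert) auto
    show "(if j = - \<theta> then 0 else vtx \<theta> j) \<in> span (supp \<theta>)" if "j \<in> supp \<theta>" for j
      using that \<omega>_span[OF t that] by (auto simp: vtx_def span_0 intro!: span_scale)
    show "(if j = - \<theta> then 0 else vtx \<theta> j) \<bullet> k = (if j = k then 1 / real (?m j) else 0)"
      if "j \<in> supp \<theta>" "k \<in> supp \<theta>" for j k
    proof -
      have "j \<noteq> - \<theta>" using that z by auto
      then show ?thesis using m[OF that(1)] inner_vtx[OF S(3)[OF that(2)], of \<theta> j] by (auto simp: inner_commute)
    qed
  qed
qed

lemma component_symmetry:
  assumes t: "\<theta> \<in> \<Theta>" and i: "i \<in> supp \<theta>" "i' \<in> supp \<theta>"
    "\<And>j. j \<in> supp \<theta> \<Longrightarrow> norm (vtx \<theta> j) \<le> norm (vtx \<theta> i)" "norm (vtx \<theta> i') = norm (vtx \<theta> i)"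
  shows "\<exists>\<sigma>. bij_betw \<sigma> (supp \<theta>) (supp \<theta>) \<and> (\<forall>u\<in>supp \<theta>. \<forall>v\<in>supp \<theta>. \<sigma> u \<bullet> \<sigma> v = u \<bullet> v) \<and> \<sigma> i = i'"
proof (cases "\<theta> \<in> \<Delta>")
  case True
  then have "supp \<theta> = {\<theta>}" using inner_\<omega>[OF True] by (auto simp: supp_def split: if_splits)
  then have "i = i'" using i by simp
  then show ?thesis by (intro exI[of _ id]) auto
next
  case False
  interpret marked_diagram "supp \<theta>" "- \<theta>" "\<lambda>j. if j = - \<theta> then 1 else nat \<lfloor>\<theta> \<bullet> \<omega> j\<rfloor>"
    "\<lambda>j. if j = - \<theta> then 0 else vtx \<theta> j"
    by (rule marked_diagram_supp[OF t False])
  have g: "g j = (norm (vtx \<theta> j))\<^sup>2" if "j \<in> supp \<theta>" for j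
    using that z_notin_K by (auto simp: g_def power2_norm_eq_inner)
  have "exchangeable i i'"
  proof (rule maximal_exchangeable[OF i(1,2)])
    show "g j \<le> g i" if "j \<in> supp \<theta>" for j using i(3)[OF that] g[OF that] g[OF i(1)] by (simp add: power_mono)
    show "g i' = g i" using i g by simp
  qed
  then show ?thesis unfolding exchangeable_def .
qed

text \<open>In each component both holes are vertices of maximal norm, exchanged by a symmetry of
  the component. Different components are orthogonal, so these symmetries glue to a permutation
  \<open>\<tau>\<close> of the simple roots that preserves inner products, and its linear extension
  \<open>T\<close> is an isometry of \<open>L\<close> taking \<open>c\<close> to
  \<open>d\<close>.\<close>

lemma dominant_holes_equivalent:
  assumes c: "c \<in> holes" "\<And>\<alpha>. \<alpha> \<in> \<Delta> \<Longrightarrow> 0 \<le> \<alpha> \<bullet> c" and d: "d \<in> holes" "\<And>\<alpha>. \<alpha> \<in> \<Delta> \<Longrightarrow> 0 \<le> \<alpha> \<bullet> d"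
  shows "gaussian_sum L a d = gaussian_sum L a c"
proof -
  define Q where "Q \<theta> \<sigma> i i' \<longleftrightarrow> i \<in> supp \<theta> \<and> i' \<in> supp \<theta> \<and> part \<theta> c = vtx \<theta> i \<and> part \<theta> d = vtx \<theta> i'
      \<and> norm (vtx \<theta> i) = norm (vtx \<theta> i') \<and> bij_betw \<sigma> (supp \<theta>) (supp \<theta>)
      \<and> (\<forall>u\<in>supp \<theta>. \<forall>v\<in>supp \<theta>. \<sigma> u \<bullet> \<sigma> v = u \<bullet> v) \<and> \<sigma> i = i'" for \<theta> and \<sigma> :: "'a \<Rightarrow> 'a" and i i'
  have "\<exists>\<sigma> i i'. Q \<theta> \<sigma> i i'" if t: "\<theta> \<in> \<Theta>" for \<theta>
  proof -
    obtain i where i: "i \<in> supp \<theta>" "part \<theta> c = vtx \<theta> i" "\<And>j. j \<in> supp \<theta> \<Longrightarrow> norm (vtx \<theta> j) \<le> norm (vtx \<theta> i)"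
      using part_eq_vtx[OF c t] by blast
    obtain i' where i': "i' \<in> supp \<theta>" "part \<theta> d = vtx \<theta> i'" "\<And>j. j \<in> supp \<theta> \<Longrightarrow> norm (vtx \<theta> j) \<le> norm (vtx \<theta> i')"
      using part_eq_vtx[OF d t] by blast
    have n: "norm (vtx \<theta> i') = norm (vtx \<theta> i)" using i i' by (simp add: antisym)
    from component_symmetry[OF t i(1) i'(1) i(3) n] show ?thesis unfolding Q_def using i(1,2) i'(1,2) n by metis
  qed
  then obtain S I I' where Q: "\<And>\<theta>. \<theta> \<in> \<Theta> \<Longrightarrow> Q \<theta> (S \<theta>) (I \<theta>) (I' \<theta>)" by metis
  have SI: "\<And>\<theta>. \<theta> \<in> \<Theta> \<Longrightarrow> I \<theta> \<in> supp \<theta>" "\<And>\<theta>. \<theta> \<in> \<Theta> \<Longrightarrow> I' \<theta> \<in> supp \<theta>"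
    "\<And>\<theta>. \<theta> \<in> \<Theta> \<Longrightarrow> part \<theta> c = vtx \<theta> (I \<theta>)" "\<And>\<theta>. \<theta> \<in> \<Theta> \<Longrightarrow> part \<theta> d = vtx \<theta> (I' \<theta>)"
    "\<And>\<theta>. \<theta> \<in> \<Theta> \<Longrightarrow> norm (vtx \<theta> (I \<theta>)) = norm (vtx \<theta> (I' \<theta>))"
    "\<And>\<theta>. \<theta> \<in> \<Theta> \<Longrightarrow> bij_betw (S \<theta>) (supp \<theta>) (supp \<theta>)"
    "\<And>\<theta> u v. \<theta> \<in> \<Theta> \<Longrightarrow> u \<in> supp \<theta> \<Longrightarrow> v \<in> supp \<theta> \<Longrightarrow> S \<theta> u \<bullet> S \<theta> v = u \<bullet> v"
    "\<And>\<theta>. \<theta> \<in> \<Theta> \<Longrightarrow> S \<theta> (I \<theta>) = I' \<theta>"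
    using Q unfolding Q_def by blast+
  \<comment> \<open>\<open>h \<alpha>\<close> is the dominant root of the component containing
    \<open>\<alpha>\<close>; by \<open>hu\<close> it is the only one.\<close>
  obtain h where h: "\<And>\<alpha>. \<alpha> \<in> \<Delta> \<Longrightarrow> h \<alpha> \<in> \<Theta>" "\<And>\<alpha>. \<alpha> \<in> \<Delta> \<Longrightarrow> \<alpha> \<in> supp (h \<alpha>)" using supp_cover by metis
  have hu: "h \<alpha> = \<theta>" if "\<theta> \<in> \<Theta>" "\<alpha> \<in> supp \<theta>" for \<alpha> \<theta>
    using supp_disjoint[of "h \<alpha>" \<theta> \<alpha>] h[of \<alpha>] that supp_subset[of \<theta>] by auto
  define \<tau> where "\<tau> \<alpha> = S (h \<alpha>) \<alpha>" for \<alpha>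
  have \<tau>s: "\<tau> \<alpha> \<in> supp (h \<alpha>)" if "\<alpha> \<in> \<Delta>" for \<alpha> using SI(6)[OF h(1)[OF that]] h(2)[OF that] by (auto simp: \<tau>_def bij_betw_def)
  have \<tau>D: "\<tau> \<alpha> \<in> \<Delta>" if "\<alpha> \<in> \<Delta>" for \<alpha> using \<tau>s[OF that] supp_subset by blast
  have h\<tau>: "h (\<tau> \<alpha>) = h \<alpha>" if "\<alpha> \<in> \<Delta>" for \<alpha> using hu[OF h(1)[OF that] \<tau>s[OF that]] .
  have inj: "inj_on \<tau> \<Delta>"
  proof (rule inj_onI)
    fix \<alpha> \<beta> assume ab: "\<alpha> \<in> \<Delta>" "\<beta> \<in> \<Delta>" "\<tau> \<alpha> = \<tau> \<beta>"
    then have hh: "h \<alpha> = h \<beta>" using h\<tau> by metis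
    then have "S (h \<alpha>) \<alpha> = S (h \<alpha>) \<beta>" using ab by (simp add: \<tau>_def)
    moreover have "inj_on (S (h \<alpha>)) (supp (h \<alpha>))" using SI(6)[OF h(1)[OF ab(1)]] by (simp add: bij_betw_def)
    ultimately show "\<alpha> = \<beta>" using h(2)[OF ab(1)] h(2)[OF ab(2)] hh by (auto simp: inj_on_def)
  qed
  have bij: "bij_betw \<tau> \<Delta> \<Delta>"
    using inj endo_inj_surj[OF finite_\<Delta> _ inj] \<tau>D by (auto simp: bij_betw_def)
  have \<tau>ip: "\<tau> \<alpha> \<bullet> \<tau> \<beta> = \<alpha> \<bullet> \<beta>" if ab: "\<alpha> \<in> \<Delta>" "\<beta> \<in> \<Delta>" for \<alpha> \<beta>
  proof (cases "h \<alpha> = h \<beta>")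
    case True
    then show ?thesis using SI(7)[OF h(1)[OF ab(1)], of \<alpha> \<beta>] h(2)[OF ab(1)] h(2)[OF ab(2)] by (simp add: \<tau>_def)
  next
    case False
    have "\<beta> \<notin> supp (h \<alpha>)" using hu[OF h(1)[OF ab(1)], of \<beta>] False by auto
    moreover have "\<tau> \<beta> \<notin> supp (h \<alpha>)" using hu[OF h(1)[OF ab(1)], of "\<tau> \<beta>"] h\<tau>[OF ab(2)] False by auto
    ultimately show ?thesis
      using supp_orthogonal[OF h(1)[OF ab(1)]] h(2)[OF ab(1)] \<tau>s[OF ab(1)] \<tau>D[OF ab(2)] ab by simp
  qed
  define T where "T x = (\<Sum>\<alpha>\<in>\<Delta>. (x \<bullet> \<omega> \<alpha>) *\<^sub>R \<tau> \<alpha>)" for x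
  have lin: "linear T"
    by (rule linearI) (simp_all add: T_def inner_add_left scaleR_add_left sum.distrib scaleR_sum_right)
  have bil: "(\<Sum>\<alpha>\<in>\<Delta>. (x \<bullet> \<omega> \<alpha>) *\<^sub>R f \<alpha>) \<bullet> (\<Sum>\<beta>\<in>\<Delta>. (y \<bullet> \<omega> \<beta>) *\<^sub>R f \<beta>)
      = (\<Sum>\<alpha>\<in>\<Delta>. \<Sum>\<beta>\<in>\<Delta>. (x \<bullet> \<omega> \<alpha>) * ((y \<bullet> \<omega> \<beta>) * (f \<alpha> \<bullet> f \<beta>)))" for x y and f :: "'a \<Rightarrow> 'a"
  proof -
    have "(\<Sum>\<alpha>\<in>\<Delta>. (x \<bullet> \<omega> \<alpha>) *\<^sub>R f \<alpha>) \<bullet> (\<Sum>\<beta>\<in>\<Delta>. (y \<bullet> \<omega> \<beta>) *\<^sub>R f \<beta>)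
      = (\<Sum>\<alpha>\<in>\<Delta>. ((x \<bullet> \<omega> \<alpha>) *\<^sub>R f \<alpha>) \<bullet> (\<Sum>\<beta>\<in>\<Delta>. (y \<bullet> \<omega> \<beta>) *\<^sub>R f \<beta>))" by (rule inner_sum_left)
    also have "\<dots> = (\<Sum>\<alpha>\<in>\<Delta>. \<Sum>\<beta>\<in>\<Delta>. (x \<bullet> \<omega> \<alpha>) * ((y \<bullet> \<omega> \<beta>) * (f \<alpha> \<bullet> f \<beta>)))"
      by (simp add: inner_sum_right sum_distrib_left mult.left_commute)
    finally show ?thesis .
  qed
  have Tip: "T x \<bullet> T y = x \<bullet> y" for x y
  proof -
    have "T x \<bullet> T y = (\<Sum>\<alpha>\<in>\<Delta>. \<Sum>\<beta>\<in>\<Delta>. (x \<bullet> \<omega> \<alpha>) * ((y \<bullet> \<omega> \<beta>) * (\<alpha> \<bullet> \<beta>)))"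
      unfolding T_def bil by (intro sum.cong refl) (simp add: \<tau>ip)
    also have "\<dots> = x \<bullet> y" unfolding bil[symmetric, of x y "\<lambda>\<alpha>. \<alpha>"] expansion[symmetric] ..
    finally show ?thesis .
  qed
  have Tn: "norm (T x) = norm x" for x by (simp add: norm_eq_sqrt_inner Tip)
  have comb: "(\<Sum>\<alpha>\<in>\<Delta>. (x \<bullet> f \<alpha>) *\<^sub>R g \<alpha>) \<in> L"
    if "\<And>\<alpha>. \<alpha> \<in> \<Delta> \<Longrightarrow> x \<bullet> f \<alpha> \<in> \<int>" "\<And>\<alpha>. \<alpha> \<in> \<Delta> \<Longrightarrow> g \<alpha> \<in> \<Delta>" for x f g
  proof -
    have "(x \<bullet> f \<alpha>) *\<^sub>R g \<alpha> \<in> L" if a: "\<alpha> \<in> \<Delta>" for \<alpha>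
    proof -
      obtain k where "x \<bullet> f \<alpha> = real_of_int k" using \<open>\<And>\<alpha>. \<alpha> \<in> \<Delta> \<Longrightarrow> x \<bullet> f \<alpha> \<in> \<int>\<close>[OF a] by (auto elim: Ints_cases)
      moreover have "g \<alpha> \<in> L" using \<open>\<And>\<alpha>. \<alpha> \<in> \<Delta> \<Longrightarrow> g \<alpha> \<in> \<Delta>\<close>[OF a] simple_Pos Pos_root root_in by blast
      ultimately show ?thesis using int_scale_in by simp
    qed
    then have "\<And>X. finite X \<Longrightarrow> X \<subseteq> \<Delta> \<Longrightarrow> (\<Sum>\<alpha>\<in>X. (x \<bullet> f \<alpha>) *\<^sub>R g \<alpha>) \<in> L"
    proof -
      fix X :: "'a set" assume *: "\<And>\<alpha>. \<alpha> \<in> \<Delta> \<Longrightarrow> (x \<bullet> f \<alpha>) *\<^sub>R g \<alpha> \<in> L" "finite X" "X \<subseteq> \<Delta>"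
      from *(2,3) show "(\<Sum>\<alpha>\<in>X. (x \<bullet> f \<alpha>) *\<^sub>R g \<alpha>) \<in> L"
        by induction (auto simp: zero_in intro!: add_in *(1))
    qed
    then show ?thesis using finite_\<Delta> by blast
  qed
  have TL: "T x \<in> L" if "x \<in> L" for x unfolding T_def using coeff_L[OF that] \<tau>D by (intro comb)
  have surj: "\<exists>x\<in>L. T x = y" if y: "y \<in> L" for y
  proof
    define x where "x = (\<Sum>\<alpha>\<in>\<Delta>. (y \<bullet> \<omega> (\<tau> \<alpha>)) *\<^sub>R \<alpha>)"
    show "x \<in> L" unfolding x_def using coeff_L[OF y] by (intro comb)
    have "x \<bullet> \<omega> \<alpha> = y \<bullet> \<omega> (\<tau> \<alpha>)" if "\<alpha> \<in> \<Delta>" for \<alpha> unfolding x_def using that by (subst sum_inner_\<omega>) auto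
    then have "T x = (\<Sum>\<alpha>\<in>\<Delta>. (y \<bullet> \<omega> (\<tau> \<alpha>)) *\<^sub>R \<tau> \<alpha>)" unfolding T_def by (intro sum.cong refl) simp
    also have "\<dots> = (\<Sum>\<beta>\<in>\<Delta>. (y \<bullet> \<omega> \<beta>) *\<^sub>R \<beta>)" by (rule sum.reindex_bij_betw[OF bij])
    also have "\<dots> = y" by (rule expansion[symmetric])
    finally show "T x = y" .
  qed
  have injT: "inj T" using linear_injective_0[OF lin] Tn by (metis norm_eq_zero)
  have bijL: "bij_betw T L L"
    unfolding bij_betw_def using TL surj injT by (auto simp: inj_on_def inj_def)
  have T\<alpha>: "T \<alpha> = \<tau> \<alpha>" if "\<alpha> \<in> \<Delta>" for \<alpha>
  proof -
    have "T \<alpha> = (\<Sum>\<beta>\<in>\<Delta>. if \<beta> = \<alpha> then \<tau> \<beta> else 0)"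
      unfolding T_def using that by (intro sum.cong refl) (auto simp: inner_\<omega>)
    then show ?thesis using that finite_\<Delta> by simp
  qed
  have T\<omega>: "T (\<omega> \<alpha>) = \<omega> (\<tau> \<alpha>)" if a: "\<alpha> \<in> \<Delta>" for \<alpha>
  proof -
    have "T (\<omega> \<alpha>) - \<omega> (\<tau> \<alpha>) = 0"
    proof (rule orthogonal_\<Delta>_zero)
      fix \<gamma> assume "\<gamma> \<in> \<Delta>"
      then obtain \<beta> where b: "\<beta> \<in> \<Delta>" "\<gamma> = \<tau> \<beta>" using bij by (auto simp: bij_betw_def)
      have "T (\<omega> \<alpha>) \<bullet> \<gamma> = \<omega> \<alpha> \<bullet> \<beta>" using Tip[of "\<omega> \<alpha>" \<beta>] T\<alpha> b by simp
      moreover have "\<tau> \<beta> = \<tau> \<alpha> \<longleftrightarrow> \<beta> = \<alpha>" using inj a b by (auto simp: inj_on_def)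
      ultimately show "(T (\<omega> \<alpha>) - \<omega> (\<tau> \<alpha>)) \<bullet> \<gamma> = 0"
        using \<omega>_inner[OF b(1), of \<alpha>] \<omega>_inner[OF \<tau>D[OF b(1)], of "\<tau> \<alpha>"] b by (simp add: inner_diff_left)
    qed
    then show ?thesis by simp
  qed
  have coord: "\<tau> \<alpha> \<bullet> d = \<alpha> \<bullet> c" if a: "\<alpha> \<in> \<Delta>" for \<alpha>
  proof -
    define \<theta> where "\<theta> = h \<alpha>"
    have t: "\<theta> \<in> \<Theta>" and as: "\<alpha> \<in> supp \<theta>" and \<tau>a: "\<tau> \<alpha> \<in> supp \<theta>" using h[OF a] \<tau>s[OF a] by (auto simp: \<theta>_def)
    have I: "I \<theta> \<in> supp \<theta>" "I \<theta> \<in> \<Delta>" using SI(1)[OF t] supp_subset by auto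
    have \<tau>I: "\<tau> (I \<theta>) = I' \<theta>" using SI(8)[OF t] hu[OF t I(1)] by (simp add: \<tau>_def)
    have 1: "\<alpha> \<bullet> c = (if \<alpha> = I \<theta> then 1 / (\<theta> \<bullet> \<omega> (I \<theta>)) else 0)"
      using inner_part[OF a, of \<theta> c] as SI(3)[OF t] inner_vtx[OF a] by simp
    have 2: "\<tau> \<alpha> \<bullet> d = (if \<tau> \<alpha> = I' \<theta> then 1 / (\<theta> \<bullet> \<omega> (I' \<theta>)) else 0)"
      using inner_part[OF \<tau>D[OF a], of \<theta> d] \<tau>a SI(4)[OF t] inner_vtx[OF \<tau>D[OF a]] by simp
    have eq: "\<tau> \<alpha> = I' \<theta> \<longleftrightarrow> \<alpha> = I \<theta>" using \<tau>I inj a I by (metis inj_on_def)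
    \<comment> \<open>A symmetry is only known to preserve inner products of simple roots. That the
      two vertices have equal marks follows here from equal norms of the vertices and of the
      weights, the latter because \<open>T\<close> is an isometry.\<close>
    have "norm (\<omega> (I' \<theta>)) = norm (\<omega> (I \<theta>))" using T\<omega>[OF I(2)] Tn \<tau>I by metis
    moreover have "norm (\<omega> (I \<theta>)) \<noteq> 0" using \<omega>_nonzero[OF I(2)] by simp
    moreover have "0 < \<theta> \<bullet> \<omega> (I \<theta>)" "0 < \<theta> \<bullet> \<omega> (I' \<theta>)" using I SI(2)[OF t] by (auto simp: supp_def)
    ultimately have "\<theta> \<bullet> \<omega> (I \<theta>) = \<theta> \<bullet> \<omega> (I' \<theta>)" using SI(5)[OF t] by (simp add: vtx_def field_simps)
    then show ?thesis using 1 2 eq by simp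
  qed
  have "T c = (\<Sum>\<alpha>\<in>\<Delta>. (c \<bullet> \<alpha>) *\<^sub>R T (\<omega> \<alpha>))"
    by (subst dual_expansion[of c]) (simp add: linear_sum[OF lin] linear_scale[OF lin])
  also have "\<dots> = (\<Sum>\<alpha>\<in>\<Delta>. (d \<bullet> \<tau> \<alpha>) *\<^sub>R \<omega> (\<tau> \<alpha>))"
    using coord T\<omega> by (intro sum.cong refl) (simp add: inner_commute)
  also have "\<dots> = (\<Sum>\<beta>\<in>\<Delta>. (d \<bullet> \<beta>) *\<^sub>R \<omega> \<beta>)" by (rule sum.reindex_bij_betw[OF bij])
  also have "\<dots> = d" by (rule dual_expansion[symmetric])
  finally have "T c = d" .
  then show ?thesis using gaussian_sum_isometry[OF lin Tn bijL] by blast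
qed

text \<open>Among the finitely many holes with the same Gaussian sums choose one with largest
  \<open>d \<bullet> \<rho>\<close>. If \<open>\<alpha> \<bullet> d\<close> were negative,
  reflecting in \<open>\<alpha>\<close> would give such a hole with a larger value.\<close>

lemma dominant_representative:
  assumes c: "c \<in> holes"
  obtains d where "d \<in> holes" "\<And>a. gaussian_sum L a d = gaussian_sum L a c" "\<And>\<alpha>. \<alpha> \<in> \<Delta> \<Longrightarrow> 0 \<le> \<alpha> \<bullet> d"
proof -
  define E where "E = {d \<in> holes. \<forall>a. gaussian_sum L a d = gaussian_sum L a c}"
  have "finite E" "E \<noteq> {}" using finite_holes c by (auto simp: E_def)
  then obtain d where d: "d \<in> E" "\<And>e. e \<in> E \<Longrightarrow> e \<bullet> \<rho> \<le> d \<bullet> \<rho>"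
    using finite_maximizer[of E "\<lambda>s. s \<bullet> \<rho>"] by blast
  have "0 \<le> \<alpha> \<bullet> d" if a: "\<alpha> \<in> \<Delta>" for \<alpha>
  proof (rule ccontr)
    assume neg: "\<not> 0 \<le> \<alpha> \<bullet> d"
    have R: "\<alpha> \<in> Pos" "\<alpha> \<in> \<Phi>" using a simple_Pos Pos_root by auto
    define s where "s x = x - (x \<bullet> \<alpha>) *\<^sub>R \<alpha>" for x
    have lin: "linear s" by (rule linearI) (simp_all add: s_def algebra_simps inner_add_left)
    have inv: "s (s x) = x" for x
      using root_norm[OF R(2)] by (simp add: s_def inner_diff_left)
    have ip: "s x \<bullet> s x = x \<bullet> x" for x
      using root_norm[OF R(2)] by (simp add: s_def inner_diff_left inner_diff_right inner_commute)
    have n: "norm (s x) = norm x" for x by (simp add: norm_eq_sqrt_inner ip)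
    have sL: "s x \<in> L" if x: "x \<in> L" for x
    proof -
      obtain k where "x \<bullet> \<alpha> = real_of_int k" using integral[OF x root_in[OF R(2)]] by (auto elim: Ints_cases)
      then show ?thesis using diff_in[OF x int_scale_in[OF root_in[OF R(2)], of k]] by (simp add: s_def)
    qed
    have bij: "bij_betw s L L" by (rule bij_betw_byWitness[of _ s]) (use inv sL in auto)
    have "s d \<in> holes" using isometry_holes[OF lin n bij] d(1) by (simp add: E_def)
    moreover have "gaussian_sum L a (s d) = gaussian_sum L a d" for a by (rule gaussian_sum_isometry[OF lin n bij])
    ultimately have "s d \<in> E" using d(1) by (simp add: E_def)
    then have "s d \<bullet> \<rho> \<le> d \<bullet> \<rho>" using d(2) by blast
    moreover have "(d \<bullet> \<alpha>) * (\<alpha> \<bullet> \<rho>) < 0" using neg Pos_pos[OF R(1)] by (intro mult_neg_pos) (auto simp: inner_commute)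
    ultimately show False by (simp add: s_def inner_diff_left)
  qed
  then show ?thesis using that d(1) by (auto simp: E_def)
qed

end

section \<open>Equality of the Gaussian sums at all holes, and conclusion\<close>

lemma (in full_root_lattice) holes_equivalent:
  assumes "c \<in> holes" "d \<in> holes"
  shows "gaussian_sum L a d = gaussian_sum L a c"
proof -
  have "0 \<notin> \<Phi>" by (auto simp: \<Phi>_def)
  then obtain \<rho> where "\<And>r. r \<in> \<Phi> \<Longrightarrow> r \<bullet> \<rho> \<noteq> 0" using exists_generic[OF finite_roots] by blast
  then interpret generic_root_lattice L \<rho> by unfold_locales
  obtain c' where c': "c' \<in> holes" "\<And>a. gaussian_sum L a c' = gaussian_sum L a c" "\<And>\<alpha>. \<alpha> \<in> \<Delta> \<Longrightarrow> 0 \<le> \<alpha> \<bullet> c'"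
    using dominant_representative[OF assms(1)] by blast
  obtain d' where d': "d' \<in> holes" "\<And>a. gaussian_sum L a d' = gaussian_sum L a d" "\<And>\<alpha>. \<alpha> \<in> \<Delta> \<Longrightarrow> 0 \<le> \<alpha> \<bullet> d'"
    using dominant_representative[OF assms(2)] by blast
  show ?thesis using dominant_holes_equivalent[OF c'(1,3) d'(1,3)] c'(2) d'(2) by simp
qed

theorem theorem1p3:
  fixes L :: "(real ^ 'n) set" and c :: "real ^ 'n"
  assumes "root_lattice L"
    and "dim L = CARD('n)"
    and "deep_hole L c"
  shows "stable_cold_spot L c"
proof -
  have gen: "L = group_closure {v \<in> L. v \<bullet> v = 2}"
    using assms(1) by (simp add: root_lattice_def power2_norm_eq_inner)
  interpret full_root_lattice L
  proof unfold_locales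
    show "0 \<in> L" by (subst gen) simp
    show "x - y \<in> L" if "x \<in> L" "y \<in> L" for x y
      using that gen group_closure.diff by metis
    show "x \<bullet> y \<in> \<int>" if "x \<in> L" "y \<in> L" for x y
      using that assms(1) by (auto simp: root_lattice_def)
    show "span L = UNIV" using assms(2) dim_eq_full[of L] by simp
  qed (rule gen)
  obtain x where x: "x \<in> L" "c - x \<in> holes" by (rule deep_hole_translate[OF assms(3)])
  then have "stable_cold_spot L (c - x)"
    using stable_cold_spot_hole holes_equivalent by blast
  then show ?thesis
    using gaussian_sum_translate[OF x(1)] by (simp add: stable_cold_spot_def)
qed

end
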